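(* Let $W\subset GL(V)$ be an irreducible finite complex reflection group and let $A\in\mathcal{F}_W$ be an irreducible subspace. The map $$(i_A)_*:P(W_A)\to P(W)$$ induced by the inclusion $i_A:X(W_A)\hookrightarrow X(W)$ is injective. It maps the inertia element $z_{W_A}\in P(W_A)$ to $z_A\in P(W)$ (the latter being understood as a conjugacy class).
   Context: Setting. $V$ is a finite-dimensional complex vector space with a $W$-invariant Hermitian inner product, used to identify $V$ with its dual; $B^\perp$ denotes the orthogonal of $B\subset V$. $\mathcal{A}_W$ is the set of reflecting hyperplanes of $W$, assumed essential ($\bigcap_{H\in\mathcal A_W}H=\{0\}$). $X(W)=X_W=V\setminus\bigcup_{H\in\mathcal{A}_W}H$ and $P(W)=\pi_1^{top}(X_W)$. Irreducible subspaces. $\mathcal{C}_W$ is the set of all sums of lines $H^\perp$, $H\in\mathcal{A}_W$. A decomposition of $U\in\mathcal{C}_W$ is a collection $\{U_1,\dots,U_k\}$, $k>1$, of nonzero elements of $\mathcal{C}_W$ with $U=U_1\oplus\cdots\oplus U_k$ such that for every $C\in\mathcal{C}_W$ with $C\subset U$ one has $C\cap U_j\in\mathcal{C}_W$ for all $j$ and $C=\bigoplus_j(C\cap U_j)$. $\mathcal{F}_W$ is the set of nonzero $U\in\mathcal{C}_W$ admitting no decomposition (irreducible subspaces). Wonderful model. $\overline{X}_W$ is the closure of the image of the natural map $X_W\to V\times\prod_{F\in\mathcal{F}_W}\mathbb{P}(V/F^\perp)$. It is a smooth variety containing $X_W$ as an open subset, and $\overline{X}_W\setminus X_W$ is a strict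 normal crossings divisor whose irreducible components $\mathcal{D}_F$ are indexed by $F\in\mathcal{F}_W$; $\mathcal{D}_F$ is the unique component with $\pi(\mathcal{D}_F)=F^\perp$, where $\pi:\overline{X}_W\to V$ is the projection. Inertia. For $A\in\mathcal{F}_W$, $z_A$ is the homotopy class (a conjugacy class in $P(W)$) of a small counterclockwise loop around $\mathcal{D}_A$ in $X_W\subset\overline{X}_W$. Parabolic subgroup. $W_A=\{w\in W: w \text{ fixes } A^\perp\text{ pointwise}\}$; it is an irreducible complex reflection group acting essentially on $A$, with reflecting hyperplanes $H\cap A$ for $H\in\mathcal{A}_W$, $H\supset A^\perp$. $X(W_A)$ is its hyperplane complement in $A$, $P(W_A)=\pi_1^{top}(X(W_A))$, and $\overline{X}(W_A)$ is the corresponding wonderful model. $z_{W_A}\in P(W_A)$ is the inertia element (class of a small counterclockwise loop) around the component of $\overline{X}(W_A)\setminus X(W_A)$ indexed by the maximal irreducible subspace $A$; it is central in $P(W_A)$. The inclusion $i_A$. Choose $x\in A^\perp$ not lying on any $H\in\mathcal{A}_W$ that does not contain $A^\perp$, and a ball $B_x\subset V$ centered at $x$ so small that it avoids all hyperplanes of $\mathcal{A}_W$ not containing $x$. Then $(x+A)\cap B_x\cap X(W)$ is the translate by $x$ of the intersection of $X(W_A)$ with a small ball around $0$ in $A$, which is identified with $X(W_A)$ (by radial contraction). This gives $i_A:X(W_A)\hookrightarrow X(W)$, well defined up to homotopy. *)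

theory Defs
  imports "HOL-Analysis.Analysis" "HOL-Algebra.Generated_Groups"
begin

text \<open>
  \<open>V\<close> is \<open>complex ^ 'n\<close>, with complex scalar multiplication \<open>*s\<close> and the complex linear algebra
  of the interpretation \<open>vec\<close>; linear automorphisms are invertible matrices. Since \<open>X(W\<^sub>A)\<close> and
  its wonderful model live in the subspace \<open>A\<close>, the arrangement notions below take an ambient
  subspace \<open>E\<close> and a set \<open>G\<close> of matrices mapping \<open>E\<close> to itself: \<open>(E, G) = (UNIV, W)\<close> gives the
  objects of \<open>W\<close> and \<open>(E, G) = (A, parabolic h W A)\<close> those of \<open>W\<^sub>A\<close>.
\<close>

type_synonym 'n herm = "complex ^ 'n \<Rightarrow> complex ^ 'n \<Rightarrow> complex"

definition hermitian_inner :: "'n::finite herm \<Rightarrow> bool" where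
  "hermitian_inner h \<longleftrightarrow>
     (\<forall>x y z. h (x + y) z = h x z + h y z) \<and>
     (\<forall>c x y. h (c *s x) y = c * h x y) \<and>
     (\<forall>x y. h y x = cnj (h x y)) \<and>
     (\<forall>x. x \<noteq> 0 \<longrightarrow> 0 < Re (h x x))"

definition hnorm :: "'n::finite herm \<Rightarrow> complex ^ 'n \<Rightarrow> real" where
  "hnorm h v = sqrt (Re (h v v))"

definition orth :: "'n::finite herm \<Rightarrow> (complex ^ 'n) set \<Rightarrow> (complex ^ 'n) set \<Rightarrow> (complex ^ 'n) set" where
  "orth h E B = {v \<in> E. \<forall>b\<in>B. h v b = 0}"


section \<open>Complex reflection groups\<close>

definition GLn :: "(complex ^ 'n ^ 'n::finite) monoid" where
  "GLn = \<lparr>carrier = {M. invertible M}, mult = (**), one = mat 1\<rparr>"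

definition fix_space :: "(complex ^ 'n) set \<Rightarrow> complex ^ 'n ^ 'n::finite \<Rightarrow> (complex ^ 'n) set" where
  "fix_space E g = {v \<in> E. g *v v = v}"

definition is_reflection :: "complex ^ 'n ^ 'n::finite \<Rightarrow> bool" where
  "is_reflection g \<longleftrightarrow> vec.dim (fix_space UNIV g) + 1 = CARD('n)"

definition finite_reflection_group :: "(complex ^ 'n ^ 'n::finite) set \<Rightarrow> bool" where
  "finite_reflection_group W \<longleftrightarrow>
     subgroup W GLn \<and> finite W \<and> W = generate GLn {g \<in> W. is_reflection g}"

definition irreducible_action :: "(complex ^ 'n ^ 'n::finite) set \<Rightarrow> bool" where
  "irreducible_action W \<longleftrightarrow>
     (\<forall>U. vec.subspace U \<and> (\<forall>g\<in>W. \<forall>u\<in>U. g *v u \<in> U) \<longrightarrow> U = {0} \<or> U = UNIV)"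

definition invariant_form :: "'n::finite herm \<Rightarrow> (complex ^ 'n ^ 'n) set \<Rightarrow> bool" where
  "invariant_form h W \<longleftrightarrow> (\<forall>g\<in>W. \<forall>x y. h (g *v x) (g *v y) = h x y)"

definition refl_hyps :: "(complex ^ 'n) set \<Rightarrow> (complex ^ 'n ^ 'n::finite) set \<Rightarrow> (complex ^ 'n) set set" where
  "refl_hyps E G = {H. \<exists>g\<in>G. H = fix_space E g \<and> vec.dim H + 1 = vec.dim E}"

definition parabolic :: "'n::finite herm \<Rightarrow> (complex ^ 'n ^ 'n) set \<Rightarrow> (complex ^ 'n) set \<Rightarrow> (complex ^ 'n ^ 'n) set" where
  "parabolic h W A = {w \<in> W. \<forall>v \<in> orth h UNIV A. w *v v = v}"

definition hyp_compl :: "(complex ^ 'n) set \<Rightarrow> (complex ^ 'n ^ 'n::finite) set \<Rightarrow> (complex ^ 'n) set" where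
  "hyp_compl E G = E - \<Union>(refl_hyps E G)"


section \<open>Irreducible subspaces\<close>

definition line_sums :: "'n::finite herm \<Rightarrow> (complex ^ 'n) set \<Rightarrow> (complex ^ 'n ^ 'n) set \<Rightarrow> (complex ^ 'n) set set" where
  "line_sums h E G = {U. \<exists>S. S \<subseteq> refl_hyps E G \<and> U = vec.span (\<Union>H\<in>S. orth h E H)}"

text \<open>\<open>is_direct_sum U D f\<close>: \<open>U\<close> is the direct sum of the subspaces \<open>f j\<close>, \<open>j \<in> D\<close>
  (an indexed family, because several \<open>f j\<close> may be zero).\<close>

definition is_direct_sum :: "(complex ^ 'n::finite) set \<Rightarrow> 'i set \<Rightarrow> ('i \<Rightarrow> (complex ^ 'n) set) \<Rightarrow> bool" where
  "is_direct_sum U D f \<longleftrightarrow>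
     U = vec.span (\<Union>j\<in>D. f j) \<and>
     (\<forall>u. (\<forall>j\<in>D. u j \<in> f j) \<and> (\<Sum>j\<in>D. u j) = 0 \<longrightarrow> (\<forall>j\<in>D. u j = 0))"

definition is_decomposition ::
  "'n::finite herm \<Rightarrow> (complex ^ 'n) set \<Rightarrow> (complex ^ 'n ^ 'n) set \<Rightarrow> (complex ^ 'n) set \<Rightarrow> (complex ^ 'n) set set \<Rightarrow> bool" where
  "is_decomposition h E G U D \<longleftrightarrow>
     finite D \<and> card D > 1 \<and> D \<subseteq> line_sums h E G - {{0}} \<and>
     is_direct_sum U D (\<lambda>Uj. Uj) \<and>
     (\<forall>C \<in> line_sums h E G. C \<subseteq> U \<longrightarrow>
        (\<forall>Uj\<in>D. C \<inter> Uj \<in> line_sums h E G) \<and> is_direct_sum C D (\<lambda>Uj. C \<inter> Uj))"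

definition irred_subspaces :: "'n::finite herm \<Rightarrow> (complex ^ 'n) set \<Rightarrow> (complex ^ 'n ^ 'n) set \<Rightarrow> (complex ^ 'n) set set" where
  "irred_subspaces h E G =
     {U \<in> line_sums h E G. U \<noteq> {0} \<and> (\<nexists>D. is_decomposition h E G U D)}"


section \<open>The wonderful model\<close>

text \<open>For subspaces \<open>K \<subseteq> E\<close>, a point of \<open>\<P>(E/K)\<close>, i.e. a line in \<open>E/K\<close>, is encoded by its
  preimage in \<open>E\<close>; the topology is the quotient topology along \<open>v \<mapsto> K + \<complex>v\<close>, \<open>v \<in> E - K\<close>.\<close>

definition proj_points :: "(complex ^ 'n::finite) set \<Rightarrow> (complex ^ 'n) set \<Rightarrow> (complex ^ 'n) set set" where
  "proj_points E K = {L. vec.subspace L \<and> K \<subseteq> L \<and> L \<subseteq> E \<and> vec.dim L = vec.dim K + 1}"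

definition proj_class :: "(complex ^ 'n::finite) set \<Rightarrow> complex ^ 'n \<Rightarrow> (complex ^ 'n) set" where
  "proj_class K v = vec.span (insert v K)"

definition proj_open :: "(complex ^ 'n::finite) set \<Rightarrow> (complex ^ 'n) set \<Rightarrow> (complex ^ 'n) set set \<Rightarrow> bool" where
  "proj_open E K U \<longleftrightarrow> U \<subseteq> proj_points E K \<and>
     openin (top_of_set (E - K)) {v \<in> E - K. proj_class K v \<in> U}"

definition proj_topology :: "(complex ^ 'n::finite) set \<Rightarrow> (complex ^ 'n) set \<Rightarrow> (complex ^ 'n) set topology" where
  "proj_topology E K = topology (proj_open E K)"

lemma istopology_proj_open: "istopology (proj_open E K)"
proof -
  have "proj_open E K (S \<inter> T)" if S: "proj_open E K S" and T: "proj_open E K T" for S T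
  proof -
    have eq: "{v \<in> E - K. proj_class K v \<in> S \<inter> T} =
        {v \<in> E - K. proj_class K v \<in> S} \<inter> {v \<in> E - K. proj_class K v \<in> T}" by blast
    have "openin (top_of_set (E - K)) {v \<in> E - K. proj_class K v \<in> S}"
      and "openin (top_of_set (E - K)) {v \<in> E - K. proj_class K v \<in> T}"
      and "S \<inter> T \<subseteq> proj_points E K"
      using S T unfolding proj_open_def by blast+
    then show ?thesis unfolding proj_open_def eq by (intro conjI openin_Int)
  qed
  moreover have "proj_open E K (\<Union>\<K>)" if *: "\<And>S. S \<in> \<K> \<Longrightarrow> proj_open E K S" for \<K>
  proof -
    have eq: "{v \<in> E - K. proj_class K v \<in> \<Union>\<K>} =
        \<Union>((\<lambda>S. {v \<in> E - K. proj_class K v \<in> S}) ` \<K>)" by blast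
    have "openin (top_of_set (E - K)) (\<Union>((\<lambda>S. {v \<in> E - K. proj_class K v \<in> S}) ` \<K>))"
    proof (rule openin_Union)
      fix T assume "T \<in> (\<lambda>S. {v \<in> E - K. proj_class K v \<in> S}) ` \<K>"
      then obtain S where "S \<in> \<K>" "T = {v \<in> E - K. proj_class K v \<in> S}" by (rule imageE)
      then show "openin (top_of_set (E - K)) T" using *[of S] unfolding proj_open_def by blast
    qed
    moreover have "\<Union>\<K> \<subseteq> proj_points E K"
      using * unfolding proj_open_def by (intro Union_least) blast
    ultimately show ?thesis unfolding proj_open_def eq by (intro conjI)
  qed
  ultimately show ?thesis unfolding istopology_def by blast
qed

lemma openin_proj_topology: "openin (proj_topology E K) U \<longleftrightarrow> proj_open E K U"
  unfolding proj_topology_def topology_inverse'[OF istopology_proj_open] ..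

type_synonym 'n wpoint = "(complex ^ 'n) \<times> ((complex ^ 'n) set \<Rightarrow> (complex ^ 'n) set)"

definition wm_ambient :: "'n::finite herm \<Rightarrow> (complex ^ 'n) set \<Rightarrow> (complex ^ 'n ^ 'n) set \<Rightarrow> 'n wpoint topology" where
  "wm_ambient h E G =
     prod_topology (top_of_set E)
       (product_topology (\<lambda>F. proj_topology E (orth h E F)) (irred_subspaces h E G))"

definition wm_embed :: "'n::finite herm \<Rightarrow> (complex ^ 'n) set \<Rightarrow> (complex ^ 'n ^ 'n) set \<Rightarrow> complex ^ 'n \<Rightarrow> 'n wpoint" where
  "wm_embed h E G v = (v, \<lambda>F\<in>irred_subspaces h E G. proj_class (orth h E F) v)"

definition wm_set :: "'n::finite herm \<Rightarrow> (complex ^ 'n) set \<Rightarrow> (complex ^ 'n ^ 'n) set \<Rightarrow> 'n wpoint set" where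
  "wm_set h E G = wm_ambient h E G closure_of (wm_embed h E G ` hyp_compl E G)"

definition wm :: "'n::finite herm \<Rightarrow> (complex ^ 'n) set \<Rightarrow> (complex ^ 'n ^ 'n) set \<Rightarrow> 'n wpoint topology" where
  "wm h E G = subtopology (wm_ambient h E G) (wm_set h E G)"

definition wm_boundary :: "'n::finite herm \<Rightarrow> (complex ^ 'n) set \<Rightarrow> (complex ^ 'n ^ 'n) set \<Rightarrow> 'n wpoint set" where
  "wm_boundary h E G = wm_set h E G - wm_embed h E G ` hyp_compl E G"


section \<open>Holomorphic charts of the wonderful model\<close>

text \<open>Holomorphy on a relatively open subset of a complex subspace: the real Frechet derivative
  exists and is complex linear, i.e. given by a complex matrix.\<close>

definition holo_on :: "(complex ^ 'n::finite) set \<Rightarrow> (complex ^ 'n \<Rightarrow> complex ^ 'n) \<Rightarrow> bool" where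
  "holo_on S g \<longleftrightarrow> (\<forall>z\<in>S. \<exists>M. (g has_derivative (*v) M) (at z within S))"

text \<open>\<open>s\<close> is a holomorphic lift on \<open>U\<close>, with values in \<open>E - K\<close>, of the map \<open>f\<close> into \<open>\<P>(E/K)\<close>.\<close>

definition holo_lift ::
  "(complex ^ 'n::finite) set \<Rightarrow> (complex ^ 'n) set \<Rightarrow> (complex ^ 'n) set
    \<Rightarrow> (complex ^ 'n \<Rightarrow> (complex ^ 'n) set) \<Rightarrow> (complex ^ 'n \<Rightarrow> complex ^ 'n) \<Rightarrow> bool" where
  "holo_lift E K U f s \<longleftrightarrow>
     holo_on U s \<and> (\<forall>y\<in>U. s y \<in> E - K \<and> f y = proj_class K (s y))"

text \<open>Holomorphic maps from \<open>\<Omega> \<subseteq> E\<close> to \<open>E \<times> \<Prod>\<^sub>F \<P>(E/F\<^sup>\<bottom>)\<close>.\<close>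

definition holo_map ::
  "'n::finite herm \<Rightarrow> (complex ^ 'n) set \<Rightarrow> (complex ^ 'n ^ 'n) set
    \<Rightarrow> (complex ^ 'n) set \<Rightarrow> (complex ^ 'n \<Rightarrow> 'n wpoint) \<Rightarrow> bool" where
  "holo_map h E G \<Omega> \<phi> \<longleftrightarrow>
     holo_on \<Omega> (\<lambda>y. fst (\<phi> y)) \<and>
     (\<forall>F \<in> irred_subspaces h E G. \<forall>z\<in>\<Omega>. \<exists>U s.
        openin (top_of_set \<Omega>) U \<and> z \<in> U \<and> holo_lift E (orth h E F) U (\<lambda>y. snd (\<phi> y) F) s)"

text \<open>\<open>killed_direction h E G \<Omega> \<phi> z u\<close>: the differential of \<open>\<phi>\<close> at \<open>z\<close> vanishes on \<open>u\<close>. The tangent space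
  of \<open>\<P>(E/K)\<close> at the line \<open>L/K\<close> is \<open>Hom(L/K, E/L)\<close>, so for a map with local lift \<open>s\<close> this means
  that the derivative of \<open>s\<close> in direction \<open>u\<close> lies in \<open>L\<close>; it does not depend on the lift.\<close>

definition killed_direction ::
  "'n::finite herm \<Rightarrow> (complex ^ 'n) set \<Rightarrow> (complex ^ 'n ^ 'n) set
    \<Rightarrow> (complex ^ 'n) set \<Rightarrow> (complex ^ 'n \<Rightarrow> 'n wpoint) \<Rightarrow> complex ^ 'n \<Rightarrow> complex ^ 'n \<Rightarrow> bool" where
  "killed_direction h E G \<Omega> \<phi> z u \<longleftrightarrow>
     (\<exists>M. ((\<lambda>y. fst (\<phi> y)) has_derivative (*v) M) (at z within \<Omega>) \<and> M *v u = 0) \<and>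
     (\<forall>F \<in> irred_subspaces h E G. \<exists>U s M.
        openin (top_of_set \<Omega>) U \<and> z \<in> U \<and>
        holo_lift E (orth h E F) U (\<lambda>y. snd (\<phi> y) F) s \<and>
        (s has_derivative (*v) M) (at z within U) \<and> M *v u \<in> snd (\<phi> z) F)"

text \<open>Holomorphic local parametrizations of the complex submanifold \<open>wm_set h E G\<close>, with the
  complex vector space \<open>E\<close> as model space: holomorphic immersions that are homeomorphisms onto
  an open subset.\<close>

definition wm_chart ::
  "'n::finite herm \<Rightarrow> (complex ^ 'n) set \<Rightarrow> (complex ^ 'n ^ 'n) set
    \<Rightarrow> (complex ^ 'n) set \<Rightarrow> (complex ^ 'n \<Rightarrow> 'n wpoint) \<Rightarrow> bool" where
  "wm_chart h E G \<Omega> \<phi> \<longleftrightarrow>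
     openin (top_of_set E) \<Omega> \<and>
     openin (wm h E G) (\<phi> ` \<Omega>) \<and>
     homeomorphic_map (top_of_set \<Omega>) (subtopology (wm h E G) (\<phi> ` \<Omega>)) \<phi> \<and>
     holo_map h E G \<Omega> \<phi> \<and>
     (\<forall>z\<in>\<Omega>. \<forall>u\<in>E. killed_direction h E G \<Omega> \<phi> z u \<longrightarrow> u = 0)"

text \<open>A chart in which the boundary becomes the linear hyperplane \<open>K\<close> of \<open>E\<close>.\<close>

definition adapted_chart ::
  "'n::finite herm \<Rightarrow> (complex ^ 'n) set \<Rightarrow> (complex ^ 'n ^ 'n) set
    \<Rightarrow> (complex ^ 'n) set \<Rightarrow> (complex ^ 'n \<Rightarrow> 'n wpoint) \<Rightarrow> (complex ^ 'n) set \<Rightarrow> bool" where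
  "adapted_chart h E G \<Omega> \<phi> K \<longleftrightarrow>
     wm_chart h E G \<Omega> \<phi> \<and>
     vec.subspace K \<and> K \<subseteq> E \<and> vec.dim K + 1 = vec.dim E \<and>
     (\<forall>z\<in>\<Omega>. \<phi> z \<in> wm_boundary h E G \<longleftrightarrow> z \<in> K)"


section \<open>Divisor components and inertia\<close>

text \<open>The regular locus of the boundary consists of the points near which it is a smooth
  hypersurface. The irreducible components of a hypersurface are the closures of the connected
  components of its regular locus.\<close>

definition boundary_regular :: "'n::finite herm \<Rightarrow> (complex ^ 'n) set \<Rightarrow> (complex ^ 'n ^ 'n) set \<Rightarrow> 'n wpoint set" where
  "boundary_regular h E G = {p. \<exists>\<Omega> \<phi> K z. adapted_chart h E G \<Omega> \<phi> K \<and> z \<in> \<Omega> \<inter> K \<and> p = \<phi> z}"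

definition boundary_components :: "'n::finite herm \<Rightarrow> (complex ^ 'n) set \<Rightarrow> (complex ^ 'n ^ 'n) set \<Rightarrow> 'n wpoint set set" where
  "boundary_components h E G =
     (\<lambda>C. wm h E G closure_of C) `
       connected_components_of (subtopology (wm h E G) (boundary_regular h E G))"

definition wm_divisor :: "'n::finite herm \<Rightarrow> (complex ^ 'n) set \<Rightarrow> (complex ^ 'n ^ 'n) set \<Rightarrow> (complex ^ 'n) set \<Rightarrow> 'n wpoint set" where
  "wm_divisor h E G F = (THE D. D \<in> boundary_components h E G \<and> fst ` D = orth h E F)"

text \<open>Small counterclockwise loops around the divisor indexed by \<open>F\<close>, as loops in the hyperplane
  complement: boundaries of small round discs transverse to the boundary in an adapted chart
  and centered at a point of the divisor. (\<open>fst\<close> inverts \<open>wm_embed\<close>.)\<close>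

definition meridians ::
  "'n::finite herm \<Rightarrow> (complex ^ 'n) set \<Rightarrow> (complex ^ 'n ^ 'n) set \<Rightarrow> (complex ^ 'n) set \<Rightarrow> (real \<Rightarrow> complex ^ 'n) set" where
  "meridians h E G F =
     {\<mu>. \<exists>\<Omega> \<phi> K z u \<epsilon>. adapted_chart h E G \<Omega> \<phi> K \<and>
        z \<in> \<Omega> \<inter> K \<and> \<phi> z \<in> wm_divisor h E G F \<and> u \<in> E - K \<and> 0 < (\<epsilon>::real) \<and>
        (\<forall>\<zeta>. cmod \<zeta> \<le> \<epsilon> \<longrightarrow> z + \<zeta> *s u \<in> \<Omega>) \<and>
        \<mu> = (\<lambda>t. fst (\<phi> (z + (of_real \<epsilon> * exp (2 * of_real pi * \<i> * of_real t)) *s u)))}"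

definition loops_at :: "'a::topological_space set \<Rightarrow> 'a \<Rightarrow> (real \<Rightarrow> 'a) set" where
  "loops_at X a = {\<gamma>. path \<gamma> \<and> path_image \<gamma> \<subseteq> X \<and> pathstart \<gamma> = a \<and> pathfinish \<gamma> = a}"

definition path_class :: "'a::topological_space set \<Rightarrow> (real \<Rightarrow> 'a) \<Rightarrow> (real \<Rightarrow> 'a) set" where
  "path_class X \<gamma> = {\<delta>. homotopic_paths X \<gamma> \<delta>}"

definition pi1 :: "'a::topological_space set \<Rightarrow> 'a \<Rightarrow> (real \<Rightarrow> 'a) set monoid" where
  "pi1 X a =
     \<lparr>carrier = path_class X ` loops_at X a,
      mult = (\<lambda>c d. \<Union>\<gamma>\<in>c. \<Union>\<delta>\<in>d. path_class X (\<gamma> +++ \<delta>)),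
      one = path_class X (\<lambda>_. a)\<rparr>"

definition pi1_map :: "'b::topological_space set \<Rightarrow> ('a::topological_space \<Rightarrow> 'b) \<Rightarrow> (real \<Rightarrow> 'a) set \<Rightarrow> (real \<Rightarrow> 'b) set" where
  "pi1_map Y f c = (\<Union>\<gamma>\<in>c. path_class Y (f \<circ> \<gamma>))"

text \<open>The homotopy class \<open>z\<^sub>F\<close>, as a subset of \<open>\<pi>\<^sub>1(X, a)\<close>: a free homotopy class of loops in the
  path-connected space \<open>X\<close> is the same as a conjugacy class of \<open>\<pi>\<^sub>1(X, a)\<close>.\<close>

definition inertia_class ::
  "'n::finite herm \<Rightarrow> (complex ^ 'n) set \<Rightarrow> (complex ^ 'n ^ 'n) set \<Rightarrow> (complex ^ 'n) set \<Rightarrow> complex ^ 'n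
    \<Rightarrow> (real \<Rightarrow> complex ^ 'n) set set" where
  "inertia_class h E G F a =
     {c \<in> carrier (pi1 (hyp_compl E G) a).
        \<exists>\<gamma>\<in>c. \<exists>\<mu>\<in>meridians h E G F. homotopic_loops (hyp_compl E G) \<gamma> \<mu>}"

text \<open>For the maximal irreducible subspace \<open>E\<close> itself, that conjugacy class consists of a single
  (central) element.\<close>

definition central_inertia ::
  "'n::finite herm \<Rightarrow> (complex ^ 'n) set \<Rightarrow> (complex ^ 'n ^ 'n) set \<Rightarrow> complex ^ 'n
    \<Rightarrow> (real \<Rightarrow> complex ^ 'n) set" where
  "central_inertia h E G a = (THE c. c \<in> inertia_class h E G E a)"


section \<open>The inclusion of a parabolic hyperplane complement\<close>

text \<open>Radial contraction onto the open ball of radius \<open>r\<close>, followed by translation by \<open>x\<close>.\<close>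

definition incl_map :: "'n::finite herm \<Rightarrow> complex ^ 'n \<Rightarrow> real \<Rightarrow> complex ^ 'n \<Rightarrow> complex ^ 'n" where
  "incl_map h x r v = x + (r / (1 + hnorm h v)) *\<^sub>R v"

end

theory Submission
  imports Defs "HOL-Complex_Analysis.Complex_Analysis"
begin

text \<open>
  Injectivity: the orthogonal projection \<open>V \<rightarrow> A\<close> maps \<open>X(W)\<close> into \<open>X(W\<^sub>A)\<close> and, composed with
  \<open>i\<^sub>A\<close>, is multiplication by a positive function, hence homotopic to the identity.

  Inertia: only the finite arrangement of hyperplanes matters. The points of the wonderful model
  lying over a generic \<open>y \<in> B\<^sup>\<bottom>\<close> in a generic direction of \<open>B\<close> form a connected set \<open>D0 B\<close> of
  regular boundary points, near which the model is the blow-up of \<open>B\<^sup>\<bottom>\<close>. The sets \<open>D0 B\<close> are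
  dense in the boundary, and at a regular boundary point only one of their closures passes, by the
  identity theorem for the holomorphic map \<open>\<pi>\<close> on the boundary of a chart. So the divisor of \<open>B\<close> is
  the closure of \<open>D0 B\<close>. For the maximal subspace \<open>E\<close>, a meridian at a point of \<open>D0 E\<close> is to first
  order \<open>\<zeta> \<mapsto> \<zeta> w\<close> with \<open>w \<in> X\<close>, since the chart is immersive. Hence every meridian is freely
  homotopic to the scalar circle \<open>t \<mapsto> exp(2\<pi>it) a\<close>, whose class is central, and \<open>i\<^sub>A\<close> sends this
  circle to an explicit meridian of the divisor of \<open>A\<close>.
\<close>

section \<open>Hermitian linear algebra\<close>

text \<open>The two sides of the inertia statement are not symmetric. For \<open>W\<close> a single
  meridian of the divisor of \<open>A\<close> has to be exhibited. For \<open>W\<^sub>A\<close>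
  every meridian has to be controlled, because \<open>central_inertia\<close> is a definite
  description. Such a meridian comes from an arbitrary adapted chart, known only to be a holomorphic
  immersion with linear boundary \<open>K\<close>, and its centre may be a point of the divisor with
  no explicit coordinates. Linearity of \<open>K\<close> is the way out: the centre slides inside
  \<open>K\<close> to a nearby point of \<open>D0 E\<close> while the transverse direction stays the
  same. The divisor is a definite description as well, through the connected components of the
  regular locus. It has to be identified although explicit charts are built only at generic points.
  That two closures never meet at a regular point takes the place of any local analysis of the
  crossings.\<close>

lemma scaleR_vec_complex: "r *\<^sub>R (v :: complex ^ 'n) = of_real r *s v"
  by (simp add: vec_eq_iff scaleR_conv_of_real[where 'a = complex])

lemma complex_linear_imp_bounded_linear:
  fixes f :: "complex ^ 'n::finite \<Rightarrow> complex ^ 'm::finite"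
  assumes "Vector_Spaces.linear (*s) (*s) f"
  shows "bounded_linear f"
proof -
  interpret f: Vector_Spaces.linear "(*s)" "(*s)" f by fact
  have "linear f" by (rule linearI) (simp_all add: f.add f.scale scaleR_vec_complex)
  then show ?thesis by (simp add: linear_conv_bounded_linear)
qed

lemma bounded_bilinear_vector_scalar_mult:
  "bounded_bilinear ((*s) :: complex \<Rightarrow> complex ^ 'n::finite \<Rightarrow> complex ^ 'n)"
proof -
  have "bilinear ((*s) :: complex \<Rightarrow> complex ^ 'n \<Rightarrow> complex ^ 'n)"
    unfolding bilinear_def
    by (intro allI conjI linearI) (simp_all add: vec_eq_iff algebra_simps)
  then show ?thesis by (simp add: bilinear_conv_bounded_bilinear)
qed

lemmas continuous_on_vector_scalar_mult [continuous_intros] =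
  bounded_bilinear.continuous_on [OF bounded_bilinear_vector_scalar_mult]
lemma closed_vec_subspace:
  fixes S :: "(complex ^ 'n::finite) set"
  assumes "vec.subspace S"
  shows "closed S"
proof -
  have "subspace S"
    using assms unfolding subspace_def vec.subspace_def by (simp add: scaleR_vec_complex)
  then show ?thesis by (rule closed_subspace)
qed

lemma open_Compl_vec_subspace:
  fixes S :: "(complex ^ 'n::finite) set"
  shows "vec.subspace S \<Longrightarrow> open (- S)"
  by (simp add: closed_vec_subspace open_Compl)

lemmas span_vec_subspace = vec.span_eq_iff[THEN iffD2]

locale hermitian =
  fixes h :: "'n::finite herm"
  assumes hermitian: "hermitian_inner h"
begin

lemma add_left: "h (x + y) z = h x z + h y z"
  and scale_left: "h (c *s x) z = c * h x z"
  and cnj_swap: "h y x = cnj (h x y)"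
  and pos: "x \<noteq> 0 \<Longrightarrow> 0 < Re (h x x)"
  using hermitian unfolding hermitian_inner_def by blast+

lemma add_right: "h z (x + y) = h z x + h z y"
  by (metis add_left cnj_swap complex_cnj_add)

lemma scale_right: "h z (c *s x) = cnj c * h z x"
  by (metis scale_left cnj_swap complex_cnj_mult)

lemma zero_left [simp]: "h 0 z = 0"
  using scale_left[of 0 0 z] by simp

lemma zero_right [simp]: "h z 0 = 0"
  using scale_right[of z 0 0] by simp

lemma minus_left: "h (- x) z = - h x z"
  using scale_left[of "-1" x z] by simp

lemma diff_left: "h (x - y) z = h x z - h y z"
  using add_left[of x "- y" z] by (simp add: minus_left)

lemma self_eq_0_iff [simp]: "h x x = 0 \<longleftrightarrow> x = 0"
  using pos[of x] by (cases "x = 0") auto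

lemma eq_0_swap: "h x y = 0 \<longleftrightarrow> h y x = 0"
  using cnj_swap[of x y] by auto

lemma of_real_Re_self: "of_real (Re (h x x)) = h x x"
  using cnj_swap[of x x] by (simp add: complex_eq_iff)

text \<open>Conjugate-linearity in the second slot is linearity over the reals, and real bilinearity
  is all that continuity and the product rule for derivatives require.\<close>

lemma bounded_bilinear: "bounded_bilinear h"
proof -
  have "bilinear h"
    unfolding bilinear_def
    by (intro allI conjI linearI)
      (simp_all add: add_left add_right scaleR_vec_complex scale_left scale_right scaleR_conv_of_real)
  then show ?thesis by (simp add: bilinear_conv_bounded_bilinear)
qed

lemmas continuous_on_h [continuous_intros] = bounded_bilinear.continuous_on [OF bounded_bilinear]
lemmas bounded_linear_h_left = bounded_bilinear.bounded_linear_left [OF bounded_bilinear]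

lemma hnorm_nonneg: "0 \<le> hnorm h v"
  using pos[of v] unfolding hnorm_def by (cases "v = 0") auto

lemma hnorm_scale: "hnorm h (c *s v) = cmod c * hnorm h v"
proof -
  have "h (c *s v) (c *s v) = (c * cnj c) * h v v"
    by (simp add: scale_left scale_right)
  also have "\<dots> = of_real ((cmod c)\<^sup>2 * Re (h v v))"
    by (simp add: complex_norm_square[symmetric] of_real_Re_self)
  finally have "Re (h (c *s v) (c *s v)) = (cmod c)\<^sup>2 * Re (h v v)" by simp
  then show ?thesis unfolding hnorm_def by (simp add: real_sqrt_mult)
qed

lemma continuous_on_hnorm [continuous_intros]:
  assumes "continuous_on S f"
  shows "continuous_on S (\<lambda>v. hnorm h (f v))"
  unfolding hnorm_def by (intro continuous_intros assms)

lemma orth_span: "orth h E (vec.span S) = orth h E S"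
proof -
  have "h v b = 0" if "\<forall>s\<in>S. h v s = 0" "b \<in> vec.span S" for v b
    using that(2)
    by (induction rule: vec.span_induct_alt) (use that(1) in \<open>auto simp: add_right scale_right\<close>)
  then show ?thesis unfolding orth_def by (auto intro: vec.span_base)
qed

lemma orth_antimono: "B \<subseteq> C \<Longrightarrow> orth h E C \<subseteq> orth h E B"
  unfolding orth_def by auto

lemma subspace_orth: "vec.subspace E \<Longrightarrow> vec.subspace (orth h E B)"
  unfolding vec.subspace_def orth_def by (auto simp: add_left scale_left)

text \<open>Gram-Schmidt along a finite spanning set: a new vector \<open>s\<close> is replaced by
  its component \<open>d\<close> orthogonal to the span already treated, and the old projection is
  corrected by a multiple of \<open>d\<close>.\<close>

lemma orth_decomposition:
  assumes "vec.subspace B"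
  shows "\<exists>p\<in>B. \<forall>b\<in>B. h (v - p) b = 0"
proof -
  have *: "\<forall>v. \<exists>p\<in>vec.span S. \<forall>b\<in>S. h (v - p) b = 0" if "finite S" for S
    using that
  proof induction
    case empty
    then show ?case by auto
  next
    case (insert s S)
    obtain q where q: "q \<in> vec.span S" "\<forall>b\<in>S. h (s - q) b = 0" using insert.IH by blast
    show ?case
    proof
      fix v
      obtain p where p: "p \<in> vec.span S" "\<forall>b\<in>S. h (v - p) b = 0" using insert.IH by blast
      define d where "d = s - q"
      have d: "h d b = 0" if "b \<in> S" for b using q(2) that by (simp add: d_def)
      have dq: "h d q = 0"
        using q(1) by (induction rule: vec.span_induct_alt) (auto simp: add_right scale_right d)
      have dS: "d \<in> vec.span (insert s S)"
        using q(1) vec.span_mono[OF subset_insertI[of S s]] unfolding d_def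
        by (intro vec.span_diff) (auto intro: vec.span_base)
      have pS: "p \<in> vec.span (insert s S)"
        using p(1) vec.span_mono[of S "insert s S"] by blast
      have vpq: "h (v - p) q = 0"
        using q(1) by (induction rule: vec.span_induct_alt) (auto simp: add_right scale_right p(2))
      show "\<exists>p\<in>vec.span (insert s S). \<forall>b\<in>insert s S. h (v - p) b = 0"
      proof (cases "d = 0")
        case True
        then have "s = q" by (simp add: d_def)
        then show ?thesis using pS p vpq by auto
      next
        case False
        define c where "c = h (v - p) d / h d d"
        define p' where "p' = p + c *s d"
        have "h (v - p') b = 0" if "b \<in> S" for b
          using p(2) d[OF that] that by (simp add: p'_def diff_left add_left scale_left)
        moreover have "h (v - p') s = 0"
        proof -
          have "h (v - p') q = 0"
            using vpq dq by (simp add: p'_def diff_left add_left scale_left)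
          moreover have "h (v - p') d = 0"
            using False by (simp add: p'_def diff_left add_left scale_left c_def)
          moreover have "s = d + q" by (simp add: d_def)
          ultimately show ?thesis by (simp add: add_right)
        qed
        moreover have "p' \<in> vec.span (insert s S)"
          unfolding p'_def by (intro vec.span_add pS vec.span_scale dS)
        ultimately show ?thesis by auto
      qed
    qed
  qed
  obtain S where S: "finite S" "vec.span S = B"
    using vec.basis_exists[of B] vec.finiteI_independent
    by (metis assms vec.span_minimal subset_antisym)
  obtain p where p: "p \<in> B" "\<forall>b\<in>S. h (v - p) b = 0" using *[OF S(1)] S(2) by blast
  then have "v - p \<in> orth h UNIV S" by (simp add: orth_def)
  then have "v - p \<in> orth h UNIV B" using orth_span[of UNIV S] S(2) by simp
  then show ?thesis using p(1) by (auto simp: orth_def)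
qed

end

section \<open>Orthogonal projections, orthogonals and hyperplane normals\<close>

definition oproj :: "'n::finite herm \<Rightarrow> (complex ^ 'n) set \<Rightarrow> complex ^ 'n \<Rightarrow> complex ^ 'n" where
  "oproj h B v = (THE p. p \<in> B \<and> (\<forall>b\<in>B. h (v - p) b = 0))"

context hermitian
begin

lemma oproj_unique:
  assumes B: "vec.subspace B" and p: "p \<in> B" "\<And>b. b \<in> B \<Longrightarrow> h (v - p) b = 0"
  shows "oproj h B v = p"
  unfolding oproj_def
proof (rule the_equality)
  show "p \<in> B \<and> (\<forall>b\<in>B. h (v - p) b = 0)" using p by blast
next
  fix q assume q: "q \<in> B \<and> (\<forall>b\<in>B. h (v - q) b = 0)"
  then have d: "p - q \<in> B" using p(1) B by (simp add: vec.subspace_diff)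
  then have "h (v - p) (p - q) = 0" "h (v - q) (p - q) = 0" using p q by auto
  then have "h (p - q) (p - q) = 0" by (simp add: diff_left)
  then show "q = p" by simp
qed

lemma oproj_mem: "vec.subspace B \<Longrightarrow> oproj h B v \<in> B"
  and oproj_orth: "vec.subspace B \<Longrightarrow> b \<in> B \<Longrightarrow> h (v - oproj h B v) b = 0"
  using orth_decomposition[of B v] oproj_unique[of B _ v] by metis+

lemma oproj_eq: "vec.subspace B \<Longrightarrow> v \<in> B \<Longrightarrow> oproj h B v = v"
  by (rule oproj_unique) auto

lemma oproj_eq_0: "vec.subspace B \<Longrightarrow> (\<And>b. b \<in> B \<Longrightarrow> h v b = 0) \<Longrightarrow> oproj h B v = 0"
  by (rule oproj_unique) (auto simp: vec.subspace_0)

lemma linear_oproj: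
  assumes B: "vec.subspace B"
  shows "Vector_Spaces.linear (*s) (*s) (oproj h B)"
proof -
  have 1: "oproj h B (x + y) = oproj h B x + oproj h B y" for x y
  proof (rule oproj_unique[OF B])
    fix b assume b: "b \<in> B"
    have "h (x - oproj h B x) b + h (y - oproj h B y) b = 0" using oproj_orth[OF B b] by simp
    then show "h (x + y - (oproj h B x + oproj h B y)) b = 0"
      by (simp add: diff_left add_left algebra_simps)
  qed (intro vec.subspace_add B oproj_mem)
  have 2: "oproj h B (c *s x) = c *s oproj h B x" for c x
  proof (rule oproj_unique[OF B])
    fix b assume b: "b \<in> B"
    have "c * h (x - oproj h B x) b = 0" using oproj_orth[OF B b] by simp
    then show "h (c *s x - c *s oproj h B x) b = 0"
      by (simp add: diff_left scale_left algebra_simps)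
  qed (intro vec.subspace_scale B oproj_mem)
  show ?thesis using 1 2 by unfold_locales auto
qed

lemma oproj_add: "vec.subspace B \<Longrightarrow> oproj h B (x + y) = oproj h B x + oproj h B y"
  and oproj_diff: "vec.subspace B \<Longrightarrow> oproj h B (x - y) = oproj h B x - oproj h B y"
  and oproj_scale: "vec.subspace B \<Longrightarrow> oproj h B (c *s x) = c *s oproj h B x"
  using linear_oproj[of B]
  by (simp_all add: vec.linear_add vec.linear_diff vec.linear_scale)

lemma bounded_linear_oproj: "vec.subspace B \<Longrightarrow> bounded_linear (oproj h B)"
  by (intro complex_linear_imp_bounded_linear linear_oproj)

lemma continuous_on_oproj [continuous_intros]:
  "vec.subspace B \<Longrightarrow> continuous_on S f \<Longrightarrow> continuous_on S (\<lambda>v. oproj h B (f v))"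
  by (rule bounded_linear.continuous_on[OF bounded_linear_oproj])

lemma h_oproj:
  assumes "vec.subspace B" "b \<in> B"
  shows "h (oproj h B v) b = h v b"
  using oproj_orth[OF assms, of v] by (simp add: diff_left)

lemma diff_oproj_mem_orth:
  assumes "vec.subspace E" "vec.subspace B" "B \<subseteq> E" "v \<in> E"
  shows "v - oproj h B v \<in> orth h E B"
  using assms oproj_orth[of B _ v] oproj_mem[of B v]
  unfolding orth_def by (auto intro: vec.subspace_diff)

lemma oproj_eq_0_iff:
  assumes "vec.subspace B" "v \<in> E"
  shows "oproj h B v = 0 \<longleftrightarrow> v \<in> orth h E B"
proof
  assume "oproj h B v = 0"
  then show "v \<in> orth h E B" using oproj_orth[OF assms(1), of _ v] assms(2) by (auto simp: orth_def)
next
  assume "v \<in> orth h E B"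
  then show "oproj h B v = 0" by (intro oproj_eq_0 assms) (auto simp: orth_def)
qed

lemma orth_orth:
  assumes E: "vec.subspace E" and B: "vec.subspace B" "B \<subseteq> E"
  shows "orth h E (orth h E B) = B"
proof
  show "B \<subseteq> orth h E (orth h E B)"
    using B eq_0_swap unfolding orth_def by blast
next
  show "orth h E (orth h E B) \<subseteq> B"
  proof
    fix v assume v: "v \<in> orth h E (orth h E B)"
    then have vE: "v \<in> E" by (simp add: orth_def)
    define w where "w = v - oproj h B v"
    have w: "w \<in> orth h E B" unfolding w_def by (rule diff_oproj_mem_orth[OF E B vE])
    have "h v w = 0" using v w by (auto simp: orth_def)
    moreover have "h (oproj h B v) w = 0"
      using w oproj_mem[OF B(1), of v] eq_0_swap by (auto simp: orth_def)
    ultimately have "h w w = 0" unfolding w_def by (simp add: diff_left)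
    then have "v = oproj h B v" by (simp add: w_def)
    then show "v \<in> B" using oproj_mem[OF B(1), of v] by simp
  qed
qed

lemma orth_subset_iff:
  assumes "vec.subspace E" "vec.subspace B" "B \<subseteq> E" "vec.subspace C" "C \<subseteq> E"
  shows "orth h E B \<subseteq> orth h E C \<longleftrightarrow> C \<subseteq> B"
  using assms orth_orth orth_antimono by metis

lemma orth_self:
  assumes "vec.subspace E"
  shows "orth h E E = {0}"
  using assms unfolding orth_def by (auto simp: vec.subspace_0)

lemma orth_sing: "orth h E {b} = {v \<in> E. h v b = 0}"
  by (auto simp: orth_def)

lemma orth_orth_sing:
  assumes "vec.subspace E" "b \<in> E"
  shows "orth h E {v \<in> E. h v b = 0} = vec.span {b}"
proof -
  have "vec.span {b} \<subseteq> E" using assms by (simp add: vec.span_minimal)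
  then have "orth h E (orth h E (vec.span {b})) = vec.span {b}"
    by (intro orth_orth assms vec.subspace_span)
  then show ?thesis by (simp add: orth_span orth_sing)
qed

lemma dim_hyperplane:
  assumes E: "vec.subspace E" and b: "b \<in> E" "b \<noteq> 0"
  shows "vec.dim {v \<in> E. h v b = 0} + 1 = vec.dim E"
proof -
  let ?K = "{v \<in> E. h v b = 0}"
  have K: "vec.subspace ?K" using subspace_orth[OF E, of "{b}"] by (simp add: orth_sing)
  have "b \<notin> ?K" using b by simp
  then have "b \<notin> vec.span ?K" unfolding span_vec_subspace[OF K] .
  then have "vec.dim (insert b ?K) = vec.dim ?K + 1" by (simp add: vec.dim_insert)
  moreover have "vec.span (insert b ?K) = E"
  proof
    show "vec.span (insert b ?K) \<subseteq> E" using b E by (intro vec.span_minimal) auto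
    show "E \<subseteq> vec.span (insert b ?K)"
    proof
      fix v assume v: "v \<in> E"
      have "v - (h v b / h b b) *s b \<in> ?K"
        using v b E by (simp add: diff_left scale_left vec.subspace_diff vec.subspace_scale)
      then show "v \<in> vec.span (insert b ?K)"
        unfolding vec.span_breakdown_eq by (meson vec.span_base)
    qed
  qed
  ultimately show ?thesis by (metis vec.dim_span)
qed

lemma hyperplane_normal:
  assumes E: "vec.subspace E" and H: "vec.subspace H" "H \<subseteq> E" "vec.dim H + 1 = vec.dim E"
  obtains b where "b \<in> E" "b \<noteq> 0" "H = {v \<in> E. h v b = 0}"
proof -
  have "H \<noteq> E" using H(3) by auto
  then obtain v where v: "v \<in> E" "v \<notin> H" using H(2) by blast
  define b where "b = v - oproj h H v"
  have b: "b \<in> orth h E H" unfolding b_def by (rule diff_oproj_mem_orth[OF E H(1,2) v(1)])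
  have "b \<noteq> 0" using v(2) oproj_mem[OF H(1), of v] by (auto simp: b_def)
  have bE: "b \<in> E" using b by (simp add: orth_def)
  let ?K = "{v \<in> E. h v b = 0}"
  have K: "vec.subspace ?K" using subspace_orth[OF E, of "{b}"] by (simp add: orth_sing)
  have HK: "H \<subseteq> ?K" using H(2) b eq_0_swap by (auto simp: orth_def)
  have "vec.dim ?K + 1 = vec.dim E" by (rule dim_hyperplane[OF E bE \<open>b \<noteq> 0\<close>])
  then have "H = ?K" using H by (intro vec.subspace_dim_equal HK H K) simp
  then show ?thesis using that[OF bE \<open>b \<noteq> 0\<close>] by blast
qed

end

section \<open>Topology of the projective spaces\<close>

lemma mem_proj_class_iff:
  assumes "vec.subspace K"
  shows "w \<in> proj_class K v \<longleftrightarrow> (\<exists>c. w - c *s v \<in> K)"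
  unfolding proj_class_def vec.span_breakdown_eq span_vec_subspace[OF assms] ..

lemma subspace_proj_class: "vec.subspace (proj_class K v)"
  unfolding proj_class_def by simp

lemma mem_proj_class: "v \<in> proj_class K v"
  unfolding proj_class_def by (simp add: vec.span_base)

lemma subset_proj_class: "K \<subseteq> proj_class K v"
  unfolding proj_class_def by (auto intro: vec.span_base)

lemma proj_class_cong:
  assumes K: "vec.subspace K" and d: "v - c *s w \<in> K" "c \<noteq> 0"
  shows "proj_class K v = proj_class K w"
proof -
  have "v \<in> proj_class K w" using d mem_proj_class_iff[OF K] by blast
  then have 1: "proj_class K v \<subseteq> proj_class K w"
    using subset_proj_class[of K w] subspace_proj_class[of K w] unfolding proj_class_def[of K v]
    by (intro vec.span_minimal) auto
  have "(- 1 / c) *s (v - c *s w) = w - (1 / c) *s v"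
    using d by (simp add: vec_eq_iff field_simps)
  moreover have "(- 1 / c) *s (v - c *s w) \<in> K" using K d(1) by (rule vec.subspace_scale)
  ultimately have "w \<in> proj_class K v" unfolding mem_proj_class_iff[OF K] by (metis (no_types))
  then have 2: "proj_class K w \<subseteq> proj_class K v"
    using subset_proj_class[of K v] subspace_proj_class[of K v] unfolding proj_class_def[of K w]
    by (intro vec.span_minimal) auto
  from 1 2 show ?thesis by blast
qed

lemma proj_class_in_proj_points:
  assumes E: "vec.subspace E" and K: "vec.subspace K" "K \<subseteq> E" and v: "v \<in> E - K"
  shows "proj_class K v \<in> proj_points E K"
proof -
  have "v \<notin> vec.span K" using v unfolding span_vec_subspace[OF K(1)] by blast
  then have "vec.dim (proj_class K v) = vec.dim K + 1"
    unfolding proj_class_def by (simp add: vec.dim_insert)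
  moreover have "proj_class K v \<subseteq> E"
    using v K E unfolding proj_class_def by (intro vec.span_minimal) auto
  ultimately show ?thesis
    unfolding proj_points_def using subspace_proj_class subset_proj_class by blast
qed

lemma proj_points_eq_proj_class:
  assumes K: "vec.subspace K" and L: "L \<in> proj_points E K" and v: "v \<in> L" "v \<notin> K"
  shows "L = proj_class K v"
proof -
  have "v \<notin> vec.span K" using v unfolding span_vec_subspace[OF K(1)] by blast
  then have "vec.dim (proj_class K v) = vec.dim K + 1"
    unfolding proj_class_def by (simp add: vec.dim_insert)
  moreover have "proj_class K v \<subseteq> L"
    using v L unfolding proj_class_def proj_points_def by (intro vec.span_minimal) auto
  ultimately show ?thesis
    using L vec.subspace_dim_equal[OF subspace_proj_class[of K v], of L]
    unfolding proj_points_def by auto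
qed

lemma proj_points_cases:
  assumes K: "vec.subspace K" and L: "L \<in> proj_points E K"
  obtains v where "v \<in> E - K" "L = proj_class K v"
proof -
  have "\<not> L \<subseteq> K" using L vec.dim_subset[of L K] by (auto simp: proj_points_def)
  then obtain v where "v \<in> L" "v \<notin> K" by blast
  then show ?thesis using that proj_points_eq_proj_class[OF K L] L by (auto simp: proj_points_def)
qed

lemma topspace_proj_topology:
  assumes E: "vec.subspace E" and K: "vec.subspace K" "K \<subseteq> E"
  shows "topspace (proj_topology E K) = proj_points E K"
proof -
  have "{v \<in> E - K. proj_class K v \<in> proj_points E K} = E - K"
    using proj_class_in_proj_points[OF E K] by blast
  then have "proj_open E K (proj_points E K)"
    unfolding proj_open_def by simp
  then show ?thesis
    unfolding topspace_def openin_proj_topology proj_open_def by blast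
qed

lemma continuous_map_proj_class:
  assumes E: "vec.subspace E" and K: "vec.subspace K" "K \<subseteq> E"
    and s: "continuous_map T (top_of_set (E - K)) s"
  shows "continuous_map T (proj_topology E K) (\<lambda>x. proj_class K (s x))"
proof -
  have "continuous_map (top_of_set (E - K)) (proj_topology E K) (proj_class K)"
    unfolding continuous_map_def topspace_proj_topology[OF E K]
    using proj_class_in_proj_points[OF E K]
    by (auto simp: openin_proj_topology proj_open_def)
  then have "continuous_map T (proj_topology E K) (proj_class K \<circ> s)"
    by (rule continuous_map_compose[OF s])
  then show ?thesis by (simp add: o_def)
qed

text \<open>Because H contains K, the line encoded by \<open>proj_class K v\<close> lies in H
  exactly when v does, so the preimage in \<open>E - K\<close> is the complement of a closed
  subspace.\<close>

lemma openin_proj_not_subset: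
  assumes E: "vec.subspace E" and K: "vec.subspace K" and H: "vec.subspace H" "K \<subseteq> H"
  shows "openin (proj_topology E K) {L \<in> proj_points E K. \<not> L \<subseteq> H}"
proof -
  have *: "{v \<in> E - K. proj_class K v \<in> {L \<in> proj_points E K. \<not> L \<subseteq> H}} =
      (E - K) \<inter> {v. proj_class K v \<in> proj_points E K} \<inter> - H"
  proof -
    have "proj_class K v \<subseteq> H \<longleftrightarrow> v \<in> H" for v
      using H vec.span_minimal[of "insert v K" H] vec.span_base[of v "insert v K"]
      unfolding proj_class_def by auto
    then show ?thesis by blast
  qed
  \<comment> \<open>If K does not lie in E, then \<open>proj_points E K\<close> is empty, since
    every point of it would contain K.\<close>
  have 2: "(E - K) \<inter> {v. proj_class K v \<in> proj_points E K} = (if K \<subseteq> E then E - K else {})"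
  proof (cases "K \<subseteq> E")
    case True
    then show ?thesis using proj_class_in_proj_points[OF E K] by auto
  next
    case False
    then show ?thesis using subset_proj_class[of K] unfolding proj_points_def by auto
  qed
  have "open (- H)" by (rule open_Compl_vec_subspace[OF H(1)])
  then have "openin (top_of_set (E - K)) ((E - K) \<inter> - H)" by (simp add: openin_open_Int)
  then show ?thesis
    unfolding openin_proj_topology proj_open_def * 2 by auto
qed

text \<open>The affine chart of \<open>\<P>(E/K)\<close> on which the functional \<open>h \<cdot> b\<close> does not vanish, with values
  in the orthogonal of \<open>K\<close>.\<close>

definition sect ::
  "'n::finite herm \<Rightarrow> (complex ^ 'n) set \<Rightarrow> (complex ^ 'n) set \<Rightarrow> complex ^ 'n \<Rightarrow> (complex ^ 'n) set \<Rightarrow> complex ^ 'n" where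
  "sect h E K b L = (THE v. v \<in> L \<and> v \<in> orth h E K \<and> h v b = 1)"

context hermitian
begin

text \<open>The vector b is orthogonal to K, so pairing with b does not change when v is replaced by
  \<open>v - oproj h K v\<close>, its representative in the orthogonal of K; dividing by the pairing
  normalises it. Two normalised representatives differ by a vector of K that is also orthogonal to
  K, hence by 0.\<close>

lemma sect_proj_class:
  assumes E: "vec.subspace E" and K: "vec.subspace K" "K \<subseteq> E"
    and b: "b \<in> orth h E K" and v: "v \<in> E" "h v b \<noteq> 0"
  shows "sect h E K b (proj_class K v) = (1 / h v b) *s (v - oproj h K v)"
  unfolding sect_def
proof (rule the_equality)
  let ?q = "v - oproj h K v"
  have q: "?q \<in> orth h E K" by (rule diff_oproj_mem_orth[OF E K v(1)])
  have hK: "h k b = 0" if "k \<in> K" for k using b that eq_0_swap by (auto simp: orth_def)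
  have hq: "h ?q b = h v b" using hK[OF oproj_mem[OF K(1)]] by (simp add: diff_left)
  have "?q \<in> proj_class K v"
    using subset_proj_class[of K v] oproj_mem[OF K(1), of v]
    by (intro vec.subspace_diff mem_proj_class subspace_proj_class) auto
  then show "(1 / h v b) *s ?q \<in> proj_class K v \<and> (1 / h v b) *s ?q \<in> orth h E K \<and>
      h ((1 / h v b) *s ?q) b = 1"
    using hq v
    by (intro conjI vec.subspace_scale subspace_proj_class subspace_orth[OF E] q)
      (simp_all only: scale_left, simp)
  fix w assume w: "w \<in> proj_class K v \<and> w \<in> orth h E K \<and> h w b = 1"
  then obtain c where c: "w - c *s v \<in> K" using mem_proj_class_iff[OF K(1)] by blast
  have "h w b = c * h v b" using hK[OF c] by (simp add: diff_left scale_left)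
  then have c': "c = 1 / h v b" using w v by (simp add: field_simps)
  have "(w - c *s v) + c *s oproj h K v \<in> K"
    using c K oproj_mem[OF K(1), of v] by (simp add: vec.subspace_add vec.subspace_scale)
  moreover have "(w - c *s v) + c *s oproj h K v = w - c *s ?q"
    by (simp add: vec_eq_iff algebra_simps)
  moreover have "w - c *s ?q \<in> orth h E K"
    by (rule vec.subspace_diff[OF subspace_orth[OF E] _ vec.subspace_scale[OF subspace_orth[OF E] q]])
      (use w in blast)
  ultimately have "h (w - c *s ?q) (w - c *s ?q) = 0" by (simp add: orth_def)
  then show "w = (1 / h v b) *s ?q" using c' by simp
qed

lemma Ex_proj_class_nonzero_iff:
  assumes K: "vec.subspace K" and b: "b \<in> orth h E K"
  shows "(\<exists>w\<in>proj_class K v. h w b \<noteq> 0) \<longleftrightarrow> h v b \<noteq> 0"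
proof
  assume "\<exists>w\<in>proj_class K v. h w b \<noteq> 0"
  then obtain w c where w: "h w b \<noteq> 0" "w - c *s v \<in> K" using mem_proj_class_iff[OF K] by blast
  have "h (w - c *s v) b = 0" using w b eq_0_swap by (auto simp: orth_def)
  then show "h v b \<noteq> 0" using w by (auto simp: diff_left scale_left)
qed (use mem_proj_class in blast)

definition pchart :: "(complex ^ 'n) set \<Rightarrow> (complex ^ 'n) set \<Rightarrow> complex ^ 'n \<Rightarrow> (complex ^ 'n) set set" where
  "pchart E K b = {L \<in> proj_points E K. \<exists>w\<in>L. h w b \<noteq> 0}"

lemma not_mem_if_nonzero: "b \<in> orth h E K \<Longrightarrow> h v b \<noteq> 0 \<Longrightarrow> v \<notin> K"
  using eq_0_swap by (auto simp: orth_def)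

lemma proj_class_mem_pchart_iff:
  assumes E: "vec.subspace E" and K: "vec.subspace K" "K \<subseteq> E" and b: "b \<in> orth h E K" and v: "v \<in> E"
  shows "proj_class K v \<in> pchart E K b \<longleftrightarrow> h v b \<noteq> 0"
  using Ex_proj_class_nonzero_iff[OF K(1) b, of v] proj_class_in_proj_points[OF E K, of v] v
    not_mem_if_nonzero[OF b, of v]
  unfolding pchart_def by blast

text \<open>The topology is a quotient topology, so both claims are checked upstairs on
  \<open>E - K\<close>, where the section is the explicit continuous expression of
  \<open>sect_proj_class\<close>.\<close>

lemma
  assumes E: "vec.subspace E" and K: "vec.subspace K" "K \<subseteq> E" and b: "b \<in> orth h E K"
  shows openin_pchart: "openin (proj_topology E K) (pchart E K b)"
    and continuous_map_sect:
      "continuous_map (subtopology (proj_topology E K) (pchart E K b)) euclidean (sect h E K b)"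
proof -
  have cont: "continuous_on {v \<in> E - K. h v b \<noteq> 0} (\<lambda>v. (1 / h v b) *s (v - oproj h K v))"
    by (intro continuous_intros K) auto
  have op: "openin (top_of_set (E - K)) {v \<in> E - K. h v b \<noteq> 0}"
  proof -
    have "open {v. h v b \<noteq> 0}"
      by (intro open_Collect_neq continuous_intros)
    then have "openin (top_of_set (E - K)) ((E - K) \<inter> {v. h v b \<noteq> 0})" by (rule openin_open_Int)
    moreover have "(E - K) \<inter> {v. h v b \<noteq> 0} = {v \<in> E - K. h v b \<noteq> 0}" by blast
    ultimately show ?thesis by simp
  qed
  have pre: "proj_open E K {L \<in> pchart E K b. sect h E K b L \<in> T}" if "open T" for T
  proof -
    have "{v \<in> E - K. proj_class K v \<in> {L \<in> pchart E K b. sect h E K b L \<in> T}} =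
       {v \<in> E - K. h v b \<noteq> 0} \<inter> (\<lambda>v. (1 / h v b) *s (v - oproj h K v)) -` T"
      using proj_class_mem_pchart_iff[OF E K b] sect_proj_class[OF E K b] by auto
    moreover have "openin (top_of_set {v \<in> E - K. h v b \<noteq> 0})
        ({v \<in> E - K. h v b \<noteq> 0} \<inter> (\<lambda>v. (1 / h v b) *s (v - oproj h K v)) -` T)"
      by (rule continuous_openin_preimage_gen[OF cont that])
    ultimately show ?thesis
      unfolding proj_open_def using openin_trans[OF _ op] by (auto simp: pchart_def)
  qed
  show 1: "openin (proj_topology E K) (pchart E K b)"
    using pre[of UNIV] by (simp add: openin_proj_topology)
  show "continuous_map (subtopology (proj_topology E K) (pchart E K b)) euclidean (sect h E K b)"
    unfolding continuous_map_def
  proof (intro conjI allI impI)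
    fix T :: "(complex ^ 'n) set" assume "openin euclidean T"
    then have "proj_open E K {L \<in> pchart E K b. sect h E K b L \<in> T}" by (intro pre) simp
    moreover have "{L \<in> topspace (subtopology (proj_topology E K) (pchart E K b)). sect h E K b L \<in> T} =
        {L \<in> pchart E K b. sect h E K b L \<in> T}"
      using topspace_proj_topology[OF E K] by (auto simp: pchart_def)
    ultimately show "openin (subtopology (proj_topology E K) (pchart E K b))
        {L \<in> topspace (subtopology (proj_topology E K) (pchart E K b)). sect h E K b L \<in> T}"
      using 1 by (auto simp: openin_open_subtopology openin_proj_topology pchart_def)
  qed simp
qed

end

section \<open>Line sums and irreducible subspaces\<close>

lemma span_Union_sum:
  fixes f :: "'i \<Rightarrow> (complex ^ 'n::finite) set"
  assumes fin: "finite I" and sub: "\<And>i. i \<in> I \<Longrightarrow> vec.subspace (f i)"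
    and v: "v \<in> vec.span (\<Union>i\<in>I. f i)"
  shows "\<exists>u. (\<forall>i\<in>I. u i \<in> f i) \<and> v = (\<Sum>i\<in>I. u i)"
  using v
proof (induction rule: vec.span_induct_alt)
  case base
  show ?case by (rule exI[of _ "\<lambda>_. 0"]) (simp add: sub vec.subspace_0)
next
  case (step c x y)
  then obtain u i where u: "\<forall>i\<in>I. u i \<in> f i" "y = (\<Sum>i\<in>I. u i)" and i: "i \<in> I" "x \<in> f i"
    by blast
  let ?w = "u(i := c *s x + u i)"
  have "(\<Sum>j\<in>I. ?w j) = (\<Sum>j\<in>I. if j = i then c *s x + u j else u j)" by (rule sum.cong) auto
  also have "\<dots> = (\<Sum>j\<in>I. (if j = i then c *s x else 0) + u j)" by (rule sum.cong) auto
  also have "\<dots> = c *s x + y" using fin i by (simp add: sum.distrib u)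
  finally show ?case
    using u i sub by (intro exI[of _ ?w]) (auto simp: vec.subspace_add vec.subspace_scale)
qed

lemma is_direct_sum_cong:
  assumes "\<And>j. j \<in> D \<Longrightarrow> f j = g j"
  shows "is_direct_sum U D f \<longleftrightarrow> is_direct_sum U D g"
  using assms unfolding is_direct_sum_def by simp

lemma direct_sum_disjoint:
  assumes D: "is_direct_sum U D (\<lambda>j. j)" "finite D" "\<And>i. i \<in> D \<Longrightarrow> vec.subspace i"
    and j: "j \<in> D" and v: "v \<in> j" "v \<in> vec.span (\<Union>i\<in>D - {j}. i)"
  shows "v = 0"
proof -
  obtain u where u: "\<forall>i\<in>D - {j}. u i \<in> i" "v = (\<Sum>i\<in>D - {j}. u i)"
    using span_Union_sum[of "D - {j}" "\<lambda>i. i" v] D v by blast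
  let ?w = "u(j := - v)"
  have "(\<Sum>i\<in>D. ?w i) = - v + (\<Sum>i\<in>D - {j}. ?w i)" using D j by (simp add: sum.remove)
  also have "(\<Sum>i\<in>D - {j}. ?w i) = v" unfolding u(2) by (rule sum.cong) auto
  finally have "(\<Sum>i\<in>D. ?w i) = 0" by simp
  moreover have "\<forall>i\<in>D. ?w i \<in> i" using u v D j by (auto simp: vec.subspace_neg)
  ultimately have "\<forall>i\<in>D. ?w i = 0" using D(1) unfolding is_direct_sum_def by blast
  then show ?thesis using j by (metis fun_upd_same neg_equal_0_iff_equal)
qed

text \<open>Passes from a family indexed by D to the set of its nonzero members. Traces of a
  decomposition on a smaller subspace form a family in which zero may repeat, whereas
  \<open>is_decomposition\<close> speaks of a set of nonzero subspaces.\<close>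

lemma direct_sum_reindex:
  assumes D: "is_direct_sum C D (\<lambda>j. g (r j))" "finite D"
    and inj: "inj_on r {j \<in> D. r j \<noteq> {0}}" and g: "g {0} = {0}"
  shows "is_direct_sum C (r ` D - {{0}}) g"
  unfolding is_direct_sum_def
proof (intro conjI allI impI)
  have "(\<Union>j\<in>D. g (r j)) \<subseteq> insert 0 (\<Union>U\<in>r ` D - {{0}}. g U)" using g by auto
  moreover have "(\<Union>U\<in>r ` D - {{0}}. g U) \<subseteq> (\<Union>j\<in>D. g (r j))" by auto
  ultimately have "vec.span (\<Union>j\<in>D. g (r j)) = vec.span (\<Union>U\<in>r ` D - {{0}}. g U)"
    by (metis (no_types, lifting) subset_antisym vec.span_insert_0 vec.span_mono)
  then show "C = vec.span (\<Union>U\<in>r ` D - {{0}}. g U)"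
    using D(1) by (simp add: is_direct_sum_def)
next
  fix u assume u: "(\<forall>U\<in>r ` D - {{0}}. u U \<in> g U) \<and> (\<Sum>U\<in>r ` D - {{0}}. u U) = 0"
  let ?D = "{j \<in> D. r j \<noteq> {0}}"
  let ?w = "\<lambda>j. if r j \<noteq> {0} then u (r j) else 0"
  have img: "r ` D - {{0}} = r ` ?D" by auto
  have "(\<Sum>j\<in>D. ?w j) = (\<Sum>j\<in>?D. u (r j))"
    using D(2) by (simp add: sum.If_cases Int_def)
  also have "\<dots> = (\<Sum>U\<in>r ` D - {{0}}. u U)" unfolding img by (simp add: sum.reindex[OF inj])
  finally have "(\<Sum>j\<in>D. ?w j) = 0" using u by simp
  moreover have "\<forall>j\<in>D. ?w j \<in> g (r j)" using u g by auto
  ultimately have "\<forall>j\<in>D. ?w j = 0" using D(1)[unfolded is_direct_sum_def, THEN conjunct2, THEN spec[of _ ?w]] by blast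
  then show "\<forall>U\<in>r ` D - {{0}}. u U = 0" by (simp add: ball_conj_distrib[symmetric] split: if_splits) blast
qed

text \<open>Interpreted twice in the end: for W on the whole space and for the parabolic subgroup on
  A. Facts on models, charts and meridians are thereby available for both at once.\<close>

locale arrangement = hermitian h for h :: "'n::finite herm" +
  fixes E :: "(complex ^ 'n) set" and G :: "(complex ^ 'n ^ 'n) set"
  assumes subspace_E: "vec.subspace E" and finite_hyps: "finite (refl_hyps E G)"
begin

abbreviation "Hs \<equiv> refl_hyps E G"
abbreviation "Irr \<equiv> irred_subspaces h E G"
abbreviation "perp \<equiv> orth h E"
abbreviation "X \<equiv> hyp_compl E G"

lemma hyp_subspace: "H \<in> Hs \<Longrightarrow> vec.subspace H"
  and hyp_subset: "H \<in> Hs \<Longrightarrow> H \<subseteq> E"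
proof -
  assume "H \<in> Hs"
  then obtain g where H: "H = fix_space E g" unfolding refl_hyps_def by blast
  show "H \<subseteq> E" using H by (auto simp: fix_space_def)
  show "vec.subspace H"
    using subspace_E unfolding H fix_space_def vec.subspace_def
    by (auto simp: matrix_vector_right_distrib vec.scale)
qed

lemma hyp_normal:
  assumes "H \<in> Hs"
  obtains b where "b \<in> E" "b \<noteq> 0" "H = {v \<in> E. h v b = 0}"
proof -
  have "vec.dim H + 1 = vec.dim E" using assms by (auto simp: refl_hyps_def)
  then show ?thesis
    using hyperplane_normal[OF subspace_E hyp_subspace[OF assms] hyp_subset[OF assms]] that by blast
qed

lemma subspace_perp [simp]: "vec.subspace (perp F)"
  by (rule subspace_orth[OF subspace_E])

lemma perp_subset: "perp F \<subseteq> E"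
  by (auto simp: orth_def)

lemma perp_perp_hyp: "H \<in> Hs \<Longrightarrow> perp (perp H) = H"
  by (intro orth_orth subspace_E hyp_subspace hyp_subset)

lemma line_sums_subspace: "U \<in> line_sums h E G \<Longrightarrow> vec.subspace U"
  and line_sums_subset: "U \<in> line_sums h E G \<Longrightarrow> U \<subseteq> E"
proof -
  assume "U \<in> line_sums h E G"
  then obtain S where "U = vec.span (\<Union>H\<in>S. perp H)" unfolding line_sums_def by blast
  then show "vec.subspace U" "U \<subseteq> E"
    using vec.span_minimal[OF _ subspace_E, of "\<Union>H\<in>S. perp H"] perp_subset by auto
qed

lemma Irr_line_sums: "F \<in> Irr \<Longrightarrow> F \<in> line_sums h E G"
  and Irr_nonzero: "F \<in> Irr \<Longrightarrow> F \<noteq> {0}"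
  by (auto simp: irred_subspaces_def)

lemmas Irr_subspace = line_sums_subspace[OF Irr_line_sums]
lemmas Irr_subset = line_sums_subset[OF Irr_line_sums]

lemma perp_perp: "U \<in> line_sums h E G \<Longrightarrow> perp (perp U) = U"
  by (intro orth_orth subspace_E line_sums_subspace line_sums_subset)

lemma perp_subset_iff:
  "U \<in> line_sums h E G \<Longrightarrow> C \<in> line_sums h E G \<Longrightarrow> perp U \<subseteq> perp C \<longleftrightarrow> C \<subseteq> U"
  by (intro orth_subset_iff subspace_E line_sums_subspace line_sums_subset)

lemma hyp_perp_subset_iff:
  assumes "H \<in> Hs" "U \<in> line_sums h E G"
  shows "perp H \<subseteq> U \<longleftrightarrow> perp U \<subseteq> H"
  using orth_subset_iff[OF subspace_E line_sums_subspace[OF assms(2)] line_sums_subset[OF assms(2)]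
      subspace_perp[of H] perp_subset[of H]] perp_perp_hyp[OF assms(1)] by simp

text \<open>\<open>perp U\<close> is the intersection of the reflecting hyperplanes that contain it,
  because U is spanned by lines. This turns every avoidance condition for flats into one for
  hyperplanes.\<close>

lemma not_mem_perp:
  assumes U: "U \<in> line_sums h E G" and v: "v \<in> E" "v \<notin> perp U"
  obtains H where "H \<in> Hs" "perp U \<subseteq> H" "v \<notin> H"
proof -
  obtain S where S: "S \<subseteq> Hs" "U = vec.span (\<Union>H\<in>S. perp H)" using U unfolding line_sums_def by blast
  have "v \<notin> perp (\<Union>H\<in>S. perp H)" using v(2) unfolding S(2) orth_span .
  then obtain H where H: "H \<in> S" "v \<notin> perp (perp H)" using v unfolding orth_def by auto
  have "perp H \<subseteq> U" unfolding S(2) using H by (auto intro!: vec.span_base)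
  moreover have HH: "H \<in> Hs" using S(1) H(1) by blast
  moreover have "v \<notin> H" using H(2) unfolding perp_perp_hyp[OF HH] .
  ultimately show ?thesis using that[of H] hyp_perp_subset_iff[OF HH U] by blast
qed

lemma line_in_line_sums: "H \<in> Hs \<Longrightarrow> perp H \<in> line_sums h E G"
  using span_vec_subspace[OF subspace_perp[of H]] unfolding line_sums_def
  by (intro CollectI exI[of _ "{H}"]) (simp del: vec.span_eq_iff)

lemma finite_line_sums: "finite (line_sums h E G)"
proof -
  have "line_sums h E G = (\<lambda>S. vec.span (\<Union>H\<in>S. perp H)) ` Pow Hs"
    unfolding line_sums_def by auto
  then show ?thesis using finite_hyps by simp
qed

lemma finite_Irr: "finite Irr"
  using finite_line_sums by (simp add: irred_subspaces_def)

lemma hyp_of_nonzero: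
  assumes U: "U \<in> line_sums h E G" "U \<noteq> {0}"
  obtains H where "H \<in> Hs" "perp U \<subseteq> H"
proof -
  have "perp U \<noteq> E"
  proof
    assume "perp U = E"
    then have "U = {0}" using perp_perp[OF U(1)] orth_self[OF subspace_E] by simp
    with U show False by blast
  qed
  then obtain v where "v \<in> E" "v \<notin> perp U" using perp_subset by blast
  then show ?thesis using not_mem_perp[OF U(1)] that by blast
qed

section \<open>Decompositions and the splitting off of an irreducible summand\<close>

lemma decomposition_D:
  assumes D: "is_decomposition h E G U D"
  shows "finite D" "\<And>j. j \<in> D \<Longrightarrow> vec.subspace j" "\<And>j. j \<in> D \<Longrightarrow> j \<noteq> {0}"
    "\<And>j. j \<in> D \<Longrightarrow> j \<in> line_sums h E G" "is_direct_sum U D (\<lambda>j. j)" "card D > 1"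
    "\<And>j. j \<in> D \<Longrightarrow> j \<subseteq> U"
proof -
  show *: "finite D" "\<And>j. j \<in> D \<Longrightarrow> j \<noteq> {0}" "\<And>j. j \<in> D \<Longrightarrow> j \<in> line_sums h E G"
    "is_direct_sum U D (\<lambda>j. j)" "card D > 1"
    using D unfolding is_decomposition_def by auto
  then show "\<And>j. j \<in> D \<Longrightarrow> vec.subspace j" using line_sums_subspace by blast
  show "\<And>j. j \<in> D \<Longrightarrow> j \<subseteq> U"
    using *(4) unfolding is_direct_sum_def by (auto intro: vec.span_base)
qed

lemma decomposition_Int:
  assumes D: "is_decomposition h E G U D" and ij: "i \<in> D" "j \<in> D" "i \<noteq> j" and v: "v \<in> i" "v \<in> j"
  shows "v = 0"
proof (rule direct_sum_disjoint[OF decomposition_D(5,1,2)[OF D] ij(2) v(2)])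
  show "v \<in> vec.span (\<Union>i\<in>D - {j}. i)" using ij v by (auto intro: vec.span_base)
qed

lemma line_in_Irr:
  assumes H: "H \<in> Hs"
  shows "perp H \<in> Irr"
proof -
  obtain b where b: "b \<in> E" "b \<noteq> 0" "H = {v \<in> E. h v b = 0}" using hyp_normal[OF H] .
  have line: "perp H = vec.span {b}" using b orth_orth_sing[OF subspace_E b(1)] by simp
  have "\<not> is_decomposition h E G (perp H) D" for D
  proof
    assume D: "is_decomposition h E G (perp H) D"
    note D' = decomposition_D[OF D]
    obtain i where i: "i \<in> D" using D'(6) by (cases "D = {}") auto
    have "D \<noteq> {i}" using D'(6) by auto
    then obtain j where j: "j \<in> D" "i \<noteq> j" using i by blast
    have "b \<in> k" if k: "k \<in> D" for k
    proof -
      obtain v where v: "v \<in> k" "v \<noteq> 0" using D'(2,3)[OF k] vec.subspace_0 by blast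
      then have "v \<in> vec.span {b}" using D'(7)[OF k] line by blast
      then obtain c where c: "v = c *s b" by (auto simp: vec.span_singleton)
      then have "b = (1 / c) *s v" using v by auto
      then show ?thesis using v D'(2)[OF k] by (simp add: vec.subspace_scale)
    qed
    then show False using decomposition_Int[OF D i j(1,2)] i j b by blast
  qed
  moreover have "perp H \<noteq> {0}" using b vec.span_base[of b "{b}"] line by auto
  ultimately show ?thesis using line_in_line_sums[OF H] by (auto simp: irred_subspaces_def)
qed

text \<open>A decomposition of U induces one on every line sum inside U, by taking traces on F and
  dropping those that vanish. If F lay in no summand, at least two traces would be nonzero and F
  would be decomposable.\<close>

lemma irreducible_in_summand:
  assumes D: "is_decomposition h E G U D" and F: "F \<in> Irr" "F \<subseteq> U"
  shows "\<exists>j\<in>D. F \<subseteq> j"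
proof (rule ccontr)
  assume no: "\<not> (\<exists>j\<in>D. F \<subseteq> j)"
  note D' = decomposition_D[OF D]
  have FL: "F \<in> line_sums h E G" using F by (simp add: Irr_line_sums)
  have restr: "C \<inter> j \<in> line_sums h E G" "is_direct_sum C D (\<lambda>j. C \<inter> j)"
    if "C \<in> line_sums h E G" "C \<subseteq> F" "j \<in> D" for C j
    using D that F unfolding is_decomposition_def by blast+
  let ?r = "\<lambda>j. F \<inter> j"
  let ?D = "?r ` D - {{0}}"
  \<comment> \<open>Distinct summands meet only in 0, so equal nonzero traces come from the same
    summand.\<close>
  have inj: "inj_on ?r {j \<in> D. ?r j \<noteq> {0}}"
  proof (rule inj_onI)
    fix i j assume ij: "i \<in> {j \<in> D. ?r j \<noteq> {0}}" "j \<in> {j \<in> D. ?r j \<noteq> {0}}" "?r i = ?r j"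
    have "0 \<in> ?r i" using ij D'(2) Irr_subspace[OF F(1)] by (auto simp: vec.subspace_0)
    then obtain v where "v \<in> ?r i" "v \<noteq> 0" using ij by blast
    then show "i = j" using ij decomposition_Int[OF D, of i j v] by blast
  qed
  have sum: "is_direct_sum C ?D (\<lambda>U. C \<inter> U)" if C: "C \<in> line_sums h E G" "C \<subseteq> F" for C
  proof (rule direct_sum_reindex[OF _ D'(1) inj])
    have "\<exists>j. j \<in> D" using D'(6) by (cases "D = {}") auto
    then have "is_direct_sum C D (\<lambda>j. C \<inter> j)" using restr C by blast
    moreover have "(\<lambda>j. C \<inter> (F \<inter> j)) = (\<lambda>j. C \<inter> j)" using C by blast
    ultimately show "is_direct_sum C D (\<lambda>j. C \<inter> (F \<inter> j))" by simp
    show "C \<inter> {0} = {0}" using line_sums_subspace[OF C(1)] by (auto simp: vec.subspace_0)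
  qed
  have "is_decomposition h E G F ?D"
    unfolding is_decomposition_def
  proof (intro conjI ballI impI)
    show "finite ?D" using D' by simp
    have F_eq: "F = vec.span (\<Union>U\<in>?D. F \<inter> U)"
      using sum[OF FL] by (simp add: is_direct_sum_def)
    \<comment> \<open>With no member the sum F would be zero; with exactly one, F would lie inside a
      single summand.\<close>
    show "1 < card ?D"
    proof (rule ccontr)
      assume "\<not> 1 < card ?D"
      then have "card ?D = 0 \<or> card ?D = 1" by linarith
      then show False
      proof
        assume "card ?D = 0"
        then have "?D = {}" using \<open>finite ?D\<close> by (metis card_0_eq)
        have "F = {0}" using F_eq unfolding \<open>?D = {}\<close> by simp
        then show False using Irr_nonzero F by blast
      next
        assume "card ?D = 1"
        then obtain U where U: "?D = {U}" by (meson card_1_singletonE)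
        then have "U \<in> ?D" by simp
        then obtain j where j: "j \<in> D" "U = F \<inter> j" by blast
        have FU: "vec.subspace (F \<inter> U)"
          using j D'(2) Irr_subspace[OF F(1)] by (simp add: vec.subspace_inter)
        have "F = vec.span (F \<inter> U)" using F_eq unfolding U by simp
        then have "F = F \<inter> U" unfolding span_vec_subspace[OF FU] .
        then have "F \<subseteq> U" by blast
        then show False using no j by blast
      qed
    qed
    show "?D \<subseteq> line_sums h E G - {{0}}" using restr FL by blast
    have "is_direct_sum F ?D (\<lambda>U. F \<inter> U)" by (rule sum[OF FL]) simp
    moreover have "is_direct_sum F ?D (\<lambda>U. F \<inter> U) \<longleftrightarrow> is_direct_sum F ?D (\<lambda>U. U)"
      by (rule is_direct_sum_cong) blast
    ultimately show "is_direct_sum F ?D (\<lambda>U. U)" by blast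
  next
    fix C U assume C: "C \<in> line_sums h E G" "C \<subseteq> F" and "U \<in> ?D"
    then obtain j where "j \<in> D" "U = F \<inter> j" by blast
    moreover from this have "C \<inter> U = C \<inter> j" using C by blast
    ultimately show "C \<inter> U \<in> line_sums h E G" using restr(1)[OF C \<open>j \<in> D\<close>] by simp
  qed (rule sum)
  then show False using F by (auto simp: irred_subspaces_def)
qed

text \<open>Descent on the dimension of B, starting from \<open>C\<close> and \<open>{0}\<close>. As
  long as B is decomposable, one summand becomes the new B and the others are absorbed into B'.
  Irreducible subspaces stay on one side of the splitting because each of those inside B lies in a
  single summand.\<close>

lemma irreducible_splitting:
  assumes C: "C \<in> line_sums h E G" "C \<noteq> {0}"
  obtains B B' where "B \<in> Irr" "B \<subseteq> C" "vec.subspace B'" "B' \<subseteq> C" "B \<inter> B' = {0}"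
    "C = vec.span (B \<union> B')" "\<And>F. F \<in> Irr \<Longrightarrow> F \<subseteq> C \<Longrightarrow> F \<subseteq> B \<or> F \<subseteq> B'"
proof -
  define P where "P B B' \<longleftrightarrow> B \<subseteq> C \<and> vec.subspace B' \<and> B' \<subseteq> C \<and> B \<inter> B' = {0} \<and>
    C = vec.span (B \<union> B') \<and> (\<forall>F\<in>Irr. F \<subseteq> C \<longrightarrow> F \<subseteq> B \<or> F \<subseteq> B')" for B B'
  have "\<exists>B B'. B \<in> Irr \<and> P B B'"
    if "B \<in> line_sums h E G" "B \<noteq> {0}" "P B B'" for B B'
    using that
  proof (induction "vec.dim B" arbitrary: B B' rule: less_induct)
    case less
    show ?case
    proof (cases "B \<in> Irr")
      case True
      then show ?thesis using less by blast
    next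
      case False
      then obtain D where D: "is_decomposition h E G B D"
        using less by (auto simp: irred_subspaces_def)
      note D' = decomposition_D[OF D]
      obtain j where j: "j \<in> D" using D'(6) by (cases "D = {}") auto
      have "D \<noteq> {j}" using D'(6) by auto
      then obtain i where i: "i \<in> D" "i \<noteq> j" using j by blast
      \<comment> \<open>R collects the other summands of B; together with the old B' it forms the
        new complement of \<open>j\<close>.\<close>
      define R where "R = vec.span (\<Union>k\<in>D - {j}. k)"
      define B'' where "B'' = vec.span (R \<union> B')"
      have B: "vec.subspace B" "B \<subseteq> C" using less line_sums_subspace by (auto simp: P_def)
      have B': "vec.subspace B'" "B \<inter> B' = {0}" "B' \<subseteq> C" "C = vec.span (B \<union> B')"
        using less by (auto simp: P_def)
      have RB: "R \<subseteq> B" unfolding R_def using D'(7) B by (intro vec.span_minimal) auto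
      have RB'': "R \<subseteq> B''" "B' \<subseteq> B''" unfolding B''_def by (auto intro: vec.span_base)
      have "vec.subspace C" using C line_sums_subspace by blast
      have "j \<inter> B'' = {0}"
      proof -
        have "v = 0" if v: "v \<in> j" "v \<in> B''" for v
        proof -
          obtain r b where rb: "r \<in> R" "b \<in> B'" "v = r + b"
            using v(2) unfolding B''_def vec.span_Un R_def vec.span_span
              span_vec_subspace[OF B'(1)] by blast
          have "v - r \<in> B" using v D'(7)[OF j] RB rb B by (intro vec.subspace_diff) auto
          then have "b \<in> B \<inter> B'" using rb by auto
          then have "v \<in> R" using B' rb by auto
          then show "v = 0"
            using direct_sum_disjoint[OF D'(5,1,2) j v(1)] by (simp add: R_def)
        qed
        moreover have "0 \<in> j" "0 \<in> B''" using D'(2)[OF j] by (auto simp: vec.subspace_0 B''_def vec.span_zero)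
        ultimately show ?thesis by blast
      qed
      moreover have "C = vec.span (j \<union> B'')"
      proof
        have "B'' \<subseteq> C" unfolding B''_def
          using RB B B' \<open>vec.subspace C\<close> by (intro vec.span_minimal) auto
        then show "vec.span (j \<union> B'') \<subseteq> C"
          using D'(7)[OF j] B \<open>vec.subspace C\<close> by (intro vec.span_minimal) auto
        have "k \<subseteq> vec.span (j \<union> B'')" if "k \<in> D" for k
        proof (cases "k = j")
          case True
          then show ?thesis by (auto intro: vec.span_base)
        next
          case False
          then have "k \<subseteq> R" unfolding R_def using that by (auto intro: vec.span_base)
          then show ?thesis using RB'' by (auto intro: vec.span_base)
        qed
        moreover have "B = vec.span (\<Union>k\<in>D. k)" using D'(5) by (simp add: is_direct_sum_def)
        ultimately have "B \<subseteq> vec.span (j \<union> B'')"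
          by (metis UN_least vec.span_minimal vec.subspace_span)
        moreover have "B' \<subseteq> vec.span (j \<union> B'')" using RB'' by (auto intro: vec.span_base)
        ultimately show "C \<subseteq> vec.span (j \<union> B'')"
          using B'(4) by (metis Un_least vec.span_minimal vec.subspace_span)
      qed
      moreover have "F \<subseteq> j \<or> F \<subseteq> B''" if F: "F \<in> Irr" "F \<subseteq> C" for F
      proof (cases "F \<subseteq> B'")
        case True
        then show ?thesis using RB'' by blast
      next
        case False
        then have "F \<subseteq> B" using F less by (auto simp: P_def)
        then obtain k where k: "k \<in> D" "F \<subseteq> k" using irreducible_in_summand[OF D F(1)] by blast
        have "k \<subseteq> R" if "k \<noteq> j" unfolding R_def using that k by (auto intro: vec.span_base)
        then show ?thesis using k RB'' by blast
      qed
      moreover have "B'' \<subseteq> C"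
        unfolding B''_def using RB B B' \<open>vec.subspace C\<close> by (intro vec.span_minimal) auto
      ultimately have "P j B''"
        using D'(7)[OF j] B by (auto simp: P_def B''_def)
      moreover have "vec.dim j < vec.dim B"
      proof (rule ccontr)
        assume "\<not> vec.dim j < vec.dim B"
        then have "j = B" by (intro vec.subspace_dim_equal D' j B) simp
        then have "i \<subseteq> j" using D'(7)[OF i(1)] by simp
        then have "i \<subseteq> {0}" using decomposition_Int[OF D i(1) j i(2)] by blast
        then show False using D'(2,3)[OF i(1)] vec.subspace_0 by blast
      qed
      ultimately show ?thesis using less.hyps[of j B''] D'(3,4) j by blast
    qed
  qed
  moreover have "P C {0}"
  proof -
    have sC: "vec.subspace C" by (rule line_sums_subspace[OF C(1)])
    then have "C \<union> {0} = C" "C \<inter> {0} = {0}" by (auto simp: vec.subspace_0)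
    then show ?thesis
      unfolding P_def using span_vec_subspace[OF sC] sC
      by (simp add: vec.subspace_0 del: vec.span_eq_iff)
  qed
  ultimately obtain B B' where "B \<in> Irr" "P B B'" using C by blast
  then show ?thesis using that[of B B'] by (auto simp: P_def)
qed

end

text \<open>For \<open>C = B \<oplus> B'\<close>, not necessarily orthogonal, the projection onto
  \<open>C \<inter> B'\<^sup>\<bottom>\<close> along \<open>B\<^sup>\<bottom>\<close>.\<close>

lemma (in hermitian) oblique_projection:
  assumes E: "vec.subspace E" and B: "vec.subspace B" "B \<subseteq> C" and B': "vec.subspace B'" "B' \<subseteq> C"
    and C: "vec.subspace C" "C \<subseteq> E" and Int: "B \<inter> B' = {0}"
  obtains P where "Vector_Spaces.linear (*s) (*s) P" "\<And>w. P w \<in> orth h E B'"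
    "\<And>w. w \<in> E \<Longrightarrow> w - P w \<in> orth h E B" "\<And>w. w \<in> orth h E C \<Longrightarrow> P w = 0"
proof -
  let ?T = "orth h C B'"
  let ?f = "oproj h B"
  interpret f: Vector_Spaces.linear "(*s)" "(*s)" ?f by (rule linear_oproj[OF B(1)])
  have T: "vec.subspace ?T" by (rule subspace_orth[OF C(1)])
  have fT: "vec.subspace (?f ` ?T)" by (rule f.subspace_image[OF T])
  have fTB: "?f ` ?T \<subseteq> B" using oproj_mem[OF B(1)] by blast
  \<comment> \<open>A vector of B orthogonal to the image of \<open>?T\<close> is orthogonal to
    \<open>?T\<close> itself, hence lies in B' and so is 0. Therefore \<open>?T\<close> projects
    onto all of B, and a linear right inverse g with values in \<open>?T\<close> exists; P is g
    after the orthogonal projection.\<close>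
  have "orth h B (?f ` ?T) = {0}"
  proof -
    have "b = 0" if b: "b \<in> orth h B (?f ` ?T)" for b
    proof -
      have bB: "b \<in> B" using b by (simp add: orth_def)
      have "h b t = 0" if "t \<in> ?T" for t
      proof -
        have "h b (?f t) = 0" using b that by (auto simp: orth_def)
        then show ?thesis using h_oproj[OF B(1) bB, of t] eq_0_swap by metis
      qed
      then have "b \<in> orth h C ?T" using bB B by (auto simp: orth_def)
      then have "b \<in> B'" using orth_orth[OF C(1) B'] by simp
      then show "b = 0" using bB Int by blast
    qed
    moreover have "0 \<in> orth h B (?f ` ?T)" using B by (simp add: orth_def vec.subspace_0)
    ultimately show ?thesis by blast
  qed
  then have "?f ` ?T = orth h B {0}" using orth_orth[OF B(1) fT fTB] by simp
  then have fT_eq: "?f ` ?T = B" by (simp add: orth_def)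
  obtain g where g: "g ` UNIV \<subseteq> ?T" "Vector_Spaces.linear (*s) (*s) g" "\<forall>v\<in>?f ` ?T. ?f (g v) = v"
    using vec.linear_exists_right_inverse_on[OF linear_oproj[OF B(1)] T] by blast
  interpret g: Vector_Spaces.linear "(*s)" "(*s)" g by (rule g(2))
  show ?thesis
  proof (rule that[of "g \<circ> ?f"])
    show "Vector_Spaces.linear (*s) (*s) (g \<circ> ?f)"
      by unfold_locales (simp_all add: f.add f.scale g.add g.scale)
    show "(g \<circ> ?f) w \<in> orth h E B'" for w
      using g(1) C(2) unfolding orth_def by fastforce
    show "w - (g \<circ> ?f) w \<in> orth h E B" if "w \<in> E" for w
    proof -
      have gE: "g (?f w) \<in> E" using g(1) C(2) by (fastforce simp: orth_def)
      have "?f (g (?f w)) = ?f w" using g(3) fT_eq oproj_mem[OF B(1)] by simp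
      then have "?f (w - g (?f w)) = 0" by (simp add: f.diff)
      moreover have "w - g (?f w) \<in> E" using that gE E by (simp add: vec.subspace_diff)
      ultimately show ?thesis using oproj_eq_0_iff[OF B(1)] by simp
    qed
    show "(g \<circ> ?f) w = 0" if "w \<in> orth h E C" for w
    proof -
      have "?f w = 0" using that B by (intro oproj_eq_0) (auto simp: orth_def)
      then show ?thesis by simp
    qed
  qed
qed

section \<open>Complements of finitely many subspaces\<close>

text \<open>A subspace met at two parameters contains their difference, hence d and then a. So each
  K is met at most once.\<close>

lemma finite_line_in_subspaces:
  fixes a d :: "complex ^ 'n::finite"
  assumes fin: "finite \<K>" and sub: "\<And>K. K \<in> \<K> \<Longrightarrow> vec.subspace K"
    and d: "\<And>K. K \<in> \<K> \<Longrightarrow> a \<notin> K \<or> d \<notin> K"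
  shows "finite {\<zeta>. a + \<zeta> *s d \<in> \<Union>\<K>}"
proof -
  have one: "finite {\<zeta>. a + \<zeta> *s d \<in> K}" if K: "K \<in> \<K>" for K
  proof -
    have "\<zeta> = \<xi>" if "a + \<zeta> *s d \<in> K" "a + \<xi> *s d \<in> K" for \<zeta> \<xi>
    proof (rule ccontr)
      assume ne: "\<zeta> \<noteq> \<xi>"
      have "(a + \<zeta> *s d) - (a + \<xi> *s d) \<in> K" using that sub[OF K] by (intro vec.subspace_diff)
      then have "(1 / (\<zeta> - \<xi>)) *s ((a + \<zeta> *s d) - (a + \<xi> *s d)) \<in> K"
        using sub[OF K] by (intro vec.subspace_scale)
      moreover have "(1 / (\<zeta> - \<xi>)) *s ((a + \<zeta> *s d) - (a + \<xi> *s d)) = d"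
      proof -
        have "(a + \<zeta> *s d) - (a + \<xi> *s d) = (\<zeta> - \<xi>) *s d" by (simp add: vec_eq_iff algebra_simps)
        then show ?thesis using ne by (simp only: vec.scale_scale) simp
      qed
      ultimately have dK: "d \<in> K" by simp
      then have "(a + \<zeta> *s d) - \<zeta> *s d \<in> K"
        using that sub[OF K] by (intro vec.subspace_diff vec.subspace_scale)
      then show False using d[OF K] dK by simp
    qed
    then show ?thesis
      by (cases "{\<zeta>. a + \<zeta> *s d \<in> K} = {}") (auto intro: finite_subset[of _ "{_}"])
  qed
  have "{\<zeta>. a + \<zeta> *s d \<in> \<Union>\<K>} = (\<Union>K\<in>\<K>. {\<zeta>. a + \<zeta> *s d \<in> K})" by blast
  then show ?thesis using fin one by simp
qed

text \<open>The complex line through a and b meets the removed subspaces in finitely many points,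
  and a plane minus finitely many points is path connected.\<close>

lemma path_connected_subspace_complement:
  fixes S :: "(complex ^ 'n::finite) set"
  assumes S: "vec.subspace S" and fin: "finite \<K>" and sub: "\<And>K. K \<in> \<K> \<Longrightarrow> vec.subspace K"
  shows "path_connected (S - \<Union>\<K>)"
  unfolding path_connected_def
proof (intro ballI)
  fix a b assume a: "a \<in> S - \<Union>\<K>" and b: "b \<in> S - \<Union>\<K>"
  let ?f = "\<lambda>\<zeta>::complex. a + \<zeta> *s (b - a)"
  let ?bad = "{\<zeta>. ?f \<zeta> \<in> \<Union>\<K>}"
  have "finite ?bad" using a by (intro finite_line_in_subspaces fin sub) auto
  then have "path_connected (- ?bad)"
    by (intro path_connected_complement_countable countable_finite) auto
  moreover have "continuous_on (- ?bad) ?f" by (intro continuous_intros)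
  ultimately have pc: "path_connected (?f ` (- ?bad))" by (rule path_connected_continuous_image[rotated])
  have "?f 0 = a" "?f 1 = b" by (simp_all add: vec_eq_iff)
  then have mem: "a \<in> ?f ` (- ?bad)" "b \<in> ?f ` (- ?bad)"
    using a b imageI[of 0 "- ?bad" ?f] imageI[of 1 "- ?bad" ?f] by auto
  have sub: "?f ` (- ?bad) \<subseteq> S - \<Union>\<K>"
    using a b S by (auto intro!: vec.subspace_add vec.subspace_scale vec.subspace_diff)
  show "\<exists>g. path g \<and> path_image g \<subseteq> S - \<Union>\<K> \<and> pathstart g = a \<and> pathfinish g = b"
    using pc mem sub unfolding path_connected_def by (meson subset_trans)
qed

text \<open>A neighbourhood of the limit pulls back to a nonempty open set of reals, which cannot be
  contained in the finite set \<open>bad\<close>. In this way a closure in an abstract product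
  topology is reached by writing down one real curve.\<close>

lemma curve_in_closure:
  fixes f :: "real \<Rightarrow> 'a"
  assumes f: "continuous_map (top_of_set S) T f" and S: "open S" "0 \<in> S"
    and bad: "finite bad" and A: "\<And>s. s \<in> S \<Longrightarrow> s \<notin> bad \<Longrightarrow> f s \<in> A"
  shows "f 0 \<in> T closure_of A"
  unfolding in_closure_of
proof (intro conjI allI impI)
  show "f 0 \<in> topspace T" using f S by (auto simp: continuous_map_def)
  fix U assume U: "f 0 \<in> U \<and> openin T U"
  have "openin (top_of_set S) {s \<in> S. f s \<in> U}"
    using openin_continuous_map_preimage[OF f, of U] U by simp
  then have op: "open {s \<in> S. f s \<in> U}" using S by (simp add: openin_open_eq)
  have "\<exists>s\<in>{s \<in> S. f s \<in> U}. s \<notin> bad"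
    using S U by (intro open_minus_countable countable_finite bad op) auto
  then show "\<exists>y. y \<in> A \<and> y \<in> U" using A by blast
qed

lemma openin_finite_Ball:
  assumes "finite S" "\<And>s. s \<in> S \<Longrightarrow> openin T {q \<in> topspace T. P s q}"
  shows "openin T {q \<in> topspace T. \<forall>s\<in>S. P s q}"
  using assms
proof (induction S rule: finite_induct)
  case (insert s S)
  have "{q \<in> topspace T. \<forall>s\<in>insert s S. P s q} =
      {q \<in> topspace T. P s q} \<inter> {q \<in> topspace T. \<forall>s\<in>S. P s q}" by blast
  moreover have "openin T {q \<in> topspace T. \<forall>s\<in>S. P s q}" "openin T {q \<in> topspace T. P s q}"
    using insert by blast+
  ultimately show ?case by (metis (no_types, lifting) openin_Int)
qed simp

section \<open>Points of the wonderful model\<close>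

context arrangement
begin

abbreviation "amb \<equiv> wm_ambient h E G"
abbreviation "WM \<equiv> wm_set h E G"
abbreviation "emb \<equiv> wm_embed h E G"
abbreviation "bd \<equiv> wm_boundary h E G"

text \<open>Coordinates near the generic points of the divisor of \<open>B\<close>: a base point \<open>v\<close> and a
  direction \<open>e\<close> modulo \<open>B\<^sup>\<bottom>\<close>.\<close>

definition pt :: "(complex ^ 'n) set \<Rightarrow> complex ^ 'n \<Rightarrow> complex ^ 'n \<Rightarrow> 'n wpoint" where
  "pt B v e = (v, \<lambda>F\<in>Irr. if F \<subseteq> B then proj_class (perp F) e else proj_class (perp F) v)"

lemma fst_pt [simp]: "fst (pt B v e) = v"
  by (simp add: pt_def)

lemma snd_pt: "F \<in> Irr \<Longrightarrow> snd (pt B v e) F = (if F \<subseteq> B then proj_class (perp F) e else proj_class (perp F) v)"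
  by (simp add: pt_def)

lemma fst_embed [simp]: "fst (emb v) = v"
  by (simp add: wm_embed_def)

lemma snd_embed: "F \<in> Irr \<Longrightarrow> snd (emb v) F = proj_class (perp F) v"
  by (simp add: wm_embed_def)

lemma mem_X_iff: "v \<in> X \<longleftrightarrow> v \<in> E \<and> (\<forall>H\<in>Hs. v \<notin> H)"
  by (auto simp: hyp_compl_def)

lemma X_not_perp: "v \<in> X \<Longrightarrow> F \<in> Irr \<Longrightarrow> v \<notin> perp F"
  using hyp_of_nonzero[OF Irr_line_sums Irr_nonzero] mem_X_iff by blast

lemma topspace_proj_perp [simp]:
  "topspace (proj_topology E (perp F)) = proj_points E (perp F)"
  by (intro topspace_proj_topology subspace_E subspace_perp perp_subset)

lemma mem_topspace_amb_iff:
  "p \<in> topspace amb \<longleftrightarrow>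
     fst p \<in> E \<and> snd p \<in> extensional Irr \<and> (\<forall>F\<in>Irr. snd p F \<in> proj_points E (perp F))"
  by (cases p) (auto simp: wm_ambient_def PiE_iff)

lemma continuous_map_ambI:
  assumes "continuous_map T euclidean (\<lambda>x. fst (f x))" "\<And>x. x \<in> topspace T \<Longrightarrow> fst (f x) \<in> E"
    and "\<And>F. F \<in> Irr \<Longrightarrow> continuous_map T (proj_topology E (perp F)) (\<lambda>x. snd (f x) F)"
    and "\<And>x. x \<in> topspace T \<Longrightarrow> snd (f x) \<in> extensional Irr"
  shows "continuous_map T amb f"
  using assms
  by (auto simp: wm_ambient_def continuous_map_pairwise continuous_map_componentwise o_def
      continuous_map_in_subtopology)

lemma continuous_map_fst_amb: "continuous_map amb euclidean fst"
proof -
  have "continuous_map amb (top_of_set E) fst" unfolding wm_ambient_def by (rule continuous_map_fst)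
  then show ?thesis by (simp add: continuous_map_in_subtopology)
qed

lemma continuous_map_snd_amb:
  assumes "F \<in> Irr"
  shows "continuous_map amb (proj_topology E (perp F)) (\<lambda>p. snd p F)"
proof -
  have "continuous_map amb (product_topology (\<lambda>F. proj_topology E (perp F)) Irr) snd"
    unfolding wm_ambient_def by (rule continuous_map_snd)
  then show ?thesis using assms by (auto simp: continuous_map_componentwise)
qed

lemma continuous_map_pt:
  assumes f: "continuous_map T euclidean f" "\<And>x. x \<in> topspace T \<Longrightarrow> f x \<in> E"
    and g: "continuous_map T euclidean g" "\<And>x. x \<in> topspace T \<Longrightarrow> g x \<in> E"
    and gF: "\<And>x F. x \<in> topspace T \<Longrightarrow> F \<in> Irr \<Longrightarrow> F \<subseteq> B \<Longrightarrow> g x \<notin> perp F"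
    and fF: "\<And>x F. x \<in> topspace T \<Longrightarrow> F \<in> Irr \<Longrightarrow> \<not> F \<subseteq> B \<Longrightarrow> f x \<notin> perp F"
  shows "continuous_map T amb (\<lambda>x. pt B (f x) (g x))"
proof (rule continuous_map_ambI)
  fix F assume F: "F \<in> Irr"
  show "continuous_map T (proj_topology E (perp F)) (\<lambda>x. snd (pt B (f x) (g x)) F)"
  proof (cases "F \<subseteq> B")
    case True
    have "continuous_map T (top_of_set (E - perp F)) g"
      using g gF[OF _ F True] by (auto simp: continuous_map_in_subtopology)
    then show ?thesis
      using continuous_map_proj_class[OF subspace_E subspace_perp perp_subset] F True
      by (simp add: snd_pt)
  next
    case False
    have "continuous_map T (top_of_set (E - perp F)) f"
      using f fF[OF _ F False] by (auto simp: continuous_map_in_subtopology)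
    then show ?thesis
      using continuous_map_proj_class[OF subspace_E subspace_perp perp_subset] F False
      by (simp add: snd_pt)
  qed
qed (use f in \<open>simp_all add: pt_def\<close>)

lemma WM_topspace: "p \<in> WM \<Longrightarrow> p \<in> topspace amb"
  unfolding wm_set_def using closure_of_subset_topspace by fastforce

lemma WM_approx:
  assumes "p \<in> WM" "openin amb U" "p \<in> U"
  obtains w where "w \<in> X" "emb w \<in> U"
  using assms unfolding wm_set_def in_closure_of by blast

lemma embed_topspace: "w \<in> X \<Longrightarrow> emb w \<in> topspace amb"
  using X_not_perp[of w] mem_X_iff[of w] proj_class_in_proj_points[OF subspace_E subspace_perp perp_subset]
  by (auto simp: mem_topspace_amb_iff snd_embed) (simp add: wm_embed_def)

lemma embed_WM: "w \<in> X \<Longrightarrow> emb w \<in> WM"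
  using closure_of_subset[of "emb ` X" amb] embed_topspace unfolding wm_set_def by blast

text \<open>The model is known explicitly only over X. Equations between continuous vector-valued
  functions that hold there extend to the closure, since the set where the difference is nonzero is
  open.\<close>

lemma WM_limit:
  fixes f g :: "'n wpoint \<Rightarrow> complex ^ 'n"
  assumes p: "p \<in> WM" and U: "openin amb U" "p \<in> U"
    and f: "continuous_map (subtopology amb U) euclidean f"
    and g: "continuous_map (subtopology amb U) euclidean g"
    and fg: "\<And>w. w \<in> X \<Longrightarrow> emb w \<in> U \<Longrightarrow> f (emb w) = g (emb w)"
  shows "f p = g p"
proof (rule ccontr)
  assume ne: "f p \<noteq> g p"
  have UE: "topspace (subtopology amb U) = U" using U openin_subset by fastforce
  have "continuous_map (subtopology amb U) euclidean (\<lambda>q. f q - g q)"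
    using f g by (rule continuous_map_diff)
  then have "openin (subtopology amb U) {q \<in> topspace (subtopology amb U). f q - g q \<in> - {0}}"
    by (rule openin_continuous_map_preimage) (simp add: open_Compl)
  then have op: "openin amb {q \<in> U. f q - g q \<in> - {0}}"
    unfolding UE openin_open_subtopology[OF U(1)] by blast
  obtain w where "w \<in> X" "emb w \<in> {q \<in> U. f q - g q \<in> - {0}}"
    using WM_approx[OF p op] ne U by auto
  then show False using fg by auto
qed

lemma oproj_perp:
  assumes "vec.subspace F" "F \<subseteq> E" "w \<in> E"
  shows "oproj h (perp F) w = w - oproj h F w"
proof (rule oproj_unique[OF subspace_perp])
  show "w - oproj h F w \<in> perp F" by (rule diff_oproj_mem_orth[OF subspace_E assms])
  fix b assume "b \<in> perp F"
  then show "h (w - (w - oproj h F w)) b = 0"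
    using oproj_mem[OF assms(1), of w] eq_0_swap by (auto simp: orth_def)
qed

lemma sect_perp:
  assumes F: "F \<in> Irr" and b: "b \<in> F" and v: "v \<in> E" "h v b \<noteq> 0"
  shows "sect h E (perp F) b (proj_class (perp F) v) = (1 / h v b) *s oproj h F v"
proof -
  have "b \<in> perp (perp F)" using perp_perp[OF Irr_line_sums[OF F]] b by simp
  then show ?thesis
    using sect_proj_class[OF subspace_E subspace_perp perp_subset _ v]
      oproj_perp[OF Irr_subspace[OF F] Irr_subset[OF F] v(1)] by simp
qed

lemma
  assumes F: "F \<in> Irr" and b: "b \<in> F"
  shows openin_sect_domain: "openin amb {q \<in> topspace amb. snd q F \<in> pchart E (perp F) b}"
    and continuous_map_sect_amb:
      "continuous_map (subtopology amb {q \<in> topspace amb. snd q F \<in> pchart E (perp F) b}) euclidean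
         (\<lambda>q. sect h E (perp F) b (snd q F))"
proof -
  let ?U = "{q \<in> topspace amb. snd q F \<in> pchart E (perp F) b}"
  have b': "b \<in> perp (perp F)" using perp_perp[OF Irr_line_sums[OF F]] b by simp
  note op = openin_pchart[OF subspace_E subspace_perp perp_subset b']
  show "openin amb ?U" by (rule openin_continuous_map_preimage[OF continuous_map_snd_amb[OF F] op])
  have "continuous_map (subtopology amb ?U) (subtopology (proj_topology E (perp F)) (pchart E (perp F) b))
      (\<lambda>q. snd q F)"
    using continuous_map_from_subtopology[OF continuous_map_snd_amb[OF F]]
    by (auto simp: continuous_map_in_subtopology)
  from continuous_map_compose[OF this continuous_map_sect[OF subspace_E subspace_perp perp_subset b']]
  show "continuous_map (subtopology amb ?U) euclidean (\<lambda>q. sect h E (perp F) b (snd q F))"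
    by (simp add: o_def)
qed

lemma snd_WM_chart:
  assumes p: "p \<in> topspace amb" and F: "F \<in> Irr"
  obtains e b where "e \<in> E" "e \<notin> perp F" "snd p F = proj_class (perp F) e" "b \<in> F" "h e b \<noteq> 0"
    "snd p F \<in> pchart E (perp F) b"
proof -
  obtain e where e: "e \<in> E - perp F" "snd p F = proj_class (perp F) e"
    using proj_points_cases[OF subspace_perp] p F unfolding mem_topspace_amb_iff by metis
  define b where "b = oproj h F e"
  have b: "b \<in> F" unfolding b_def by (rule oproj_mem[OF Irr_subspace[OF F]])
  have "b \<noteq> 0" using e oproj_eq_0_iff[OF Irr_subspace[OF F]] by (auto simp: b_def)
  moreover have "h e b = h b b" using h_oproj[OF Irr_subspace[OF F] b, of e] by (simp add: b_def)
  ultimately have "h e b \<noteq> 0" by simp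
  moreover have "b \<in> perp (perp F)" using perp_perp[OF Irr_line_sums[OF F]] b by simp
  ultimately show ?thesis
    using that[of e b] e b proj_class_mem_pchart_iff[OF subspace_E subspace_perp perp_subset] by simp
qed

section \<open>Incidence relations between the coordinates of a point of the model\<close>

lemma mem_proj_class_perp:
  assumes F: "F \<in> Irr" and v: "v \<in> E" "e \<in> E" "oproj h F v = c *s oproj h F e"
  shows "v \<in> proj_class (perp F) e"
proof -
  note sF = Irr_subspace[OF F]
  have "oproj h F (v - c *s e) = 0" using v by (simp add: oproj_diff[OF sF] oproj_scale[OF sF])
  moreover have "v - c *s e \<in> E" using v subspace_E by (simp add: vec.subspace_diff vec.subspace_scale)
  ultimately have "v - c *s e \<in> perp F" using oproj_eq_0_iff[OF sF] by blast
  then show ?thesis using mem_proj_class_iff[OF subspace_perp] by blast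
qed

lemma oproj_proj_class:
  assumes F: "F \<in> Irr" and v: "v \<in> proj_class (perp F) e"
  obtains c where "oproj h F v = c *s oproj h F e"
proof -
  note sF = Irr_subspace[OF F]
  obtain c where c: "v - c *s e \<in> perp F" using v mem_proj_class_iff[OF subspace_perp] by blast
  then have "oproj h F (v - c *s e) = 0" using oproj_eq_0_iff[OF sF] perp_subset by blast
  then show ?thesis using that[of c] by (simp add: oproj_diff[OF sF] oproj_scale[OF sF])
qed

text \<open>Membership of a vector in a varying line is rewritten as an equation in an affine chart
  of the projective space, so that it passes from X to the closure by
  \<open>WM_limit\<close>.\<close>

lemma WM_incidence:
  assumes p: "p \<in> WM" and F: "F \<in> Irr" and U: "openin amb U" "p \<in> U"
    and k: "continuous_map (subtopology amb U) euclidean k" "k p \<in> E"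
    and kw: "\<And>w. w \<in> X \<Longrightarrow> emb w \<in> U \<Longrightarrow> k (emb w) \<in> proj_class (perp F) w"
  shows "k p \<in> snd p F"
proof -
  note sF = Irr_subspace[OF F]
  obtain e b where e: "e \<in> E" "e \<notin> perp F" "snd p F = proj_class (perp F) e" and b: "b \<in> F" "h e b \<noteq> 0"
    "snd p F \<in> pchart E (perp F) b"
    using snd_WM_chart[OF WM_topspace[OF p] F] .
  have bb: "b \<in> perp (perp F)" using perp_perp[OF Irr_line_sums[OF F]] b by simp
  let ?U' = "{q \<in> topspace amb. snd q F \<in> pchart E (perp F) b}"
  let ?V = "U \<inter> ?U'" and ?s = "\<lambda>q. sect h E (perp F) b (snd q F)"
  have ck: "continuous_map (subtopology amb ?V) euclidean k"
    using continuous_map_from_subtopology[OF k(1), of ?U'] by (simp add: subtopology_subtopology)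
  have cs: "continuous_map (subtopology amb ?V) euclidean ?s"
    using continuous_map_from_subtopology[OF continuous_map_sect_amb[OF F b(1)], of U]
    by (simp add: subtopology_subtopology Int_commute)
  \<comment> \<open>The projection of \<open>k\<close> must be a multiple of the normalised section,
    and pairing with b shows that the factor is \<open>h (k p) b\<close>.\<close>
  have "oproj h F (k p) = h (k p) b *s ?s p"
  proof (rule WM_limit[OF p openin_Int[OF U(1) openin_sect_domain[OF F b(1)]]])
    show "p \<in> ?V" using p b U WM_topspace by blast
    have "continuous_map euclidean euclidean (oproj h F)"
      using continuous_on_oproj[OF sF continuous_on_id, of UNIV] by simp
    from continuous_map_compose[OF ck this]
    show "continuous_map (subtopology amb ?V) euclidean (\<lambda>q. oproj h F (k q))" by (simp add: o_def)
    have "continuous_map (subtopology amb ?V) (prod_topology euclidean euclidean) (\<lambda>q. (k q, ?s q))"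
      using ck cs unfolding continuous_map_paired by blast
    moreover have "continuous_map (prod_topology euclidean euclidean) euclidean (\<lambda>(x, y). h x b *s y)"
      unfolding euclidean_product_topology[symmetric]
      by (simp add: case_prod_beta continuous_intros)
    ultimately have "continuous_map (subtopology amb ?V) euclidean ((\<lambda>(x, y). h x b *s y) \<circ> (\<lambda>q. (k q, ?s q)))"
      by (rule continuous_map_compose)
    then show "continuous_map (subtopology amb ?V) euclidean (\<lambda>q. h (k q) b *s ?s q)"
      by (simp add: o_def)
    fix w assume w: "w \<in> X" "emb w \<in> ?V"
    then have wE: "w \<in> E" by (simp add: mem_X_iff)
    have n: "h w b \<noteq> 0"
      using w wE proj_class_mem_pchart_iff[OF subspace_E subspace_perp perp_subset bb]
      by (simp add: snd_embed[OF F])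
    obtain c where c: "oproj h F (k (emb w)) = c *s oproj h F w"
      using oproj_proj_class[OF F kw] w by blast
    have "h (k (emb w)) b = h (c *s oproj h F w) b" using h_oproj[OF sF b(1)] c by metis
    then have "h (k (emb w)) b = c * h w b" using h_oproj[OF sF b(1)] by (simp add: scale_left)
    then show "oproj h F (k (emb w)) = h (k (emb w)) b *s ?s (emb w)"
      using n c sect_perp[OF F b(1) wE n] by (simp add: snd_embed[OF F])
  qed
  also have "\<dots> = (h (k p) b / h e b) *s oproj h F e"
    using sect_perp[OF F b(1) e(1) b(2)] e by simp
  finally show ?thesis unfolding e(3) by (rule mem_proj_class_perp[OF F k(2) e(1)])
qed

lemma fst_mem_snd:
  assumes p: "p \<in> WM" and F: "F \<in> Irr"
  shows "fst p \<in> snd p F"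
proof (rule WM_incidence[OF p F openin_topspace])
  show "continuous_map (subtopology amb (topspace amb)) euclidean fst"
    using continuous_map_fst_amb by simp
qed (use WM_topspace[OF p] mem_proj_class in \<open>auto simp: mem_topspace_amb_iff\<close>)

text \<open>Over X the coordinate at B is spanned by \<open>w\<close> and \<open>perp B\<close>,
  which is contained in \<open>perp F\<close> together with \<open>w\<close>.
  \<open>WM_incidence\<close> carries this to the closure, applied to the normalised section of the
  coordinate at B.\<close>

lemma snd_antimono:
  assumes p: "p \<in> WM" and F: "F \<in> Irr" and B: "B \<in> Irr" and FB: "F \<subseteq> B"
  shows "snd p B \<subseteq> snd p F"
proof -
  note sF = Irr_subspace[OF F] and sB = Irr_subspace[OF B]
  note top = WM_topspace[OF p]
  obtain e b where e: "e \<in> E" "e \<notin> perp B" "snd p B = proj_class (perp B) e" and b: "b \<in> B" "h e b \<noteq> 0"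
    "snd p B \<in> pchart E (perp B) b"
    using snd_WM_chart[OF top B] .
  have bb: "b \<in> perp (perp B)" using perp_perp[OF Irr_line_sums[OF B]] b by simp
  have pp: "oproj h F (oproj h B w) = oproj h F w" for w
  proof -
    have "oproj h F (w - oproj h B w) = 0" by (rule oproj_eq_0[OF sF]) (use oproj_orth[OF sB] FB in blast)
    then show ?thesis by (simp add: oproj_diff[OF sF])
  qed
  have "oproj h B w \<in> E" for w using oproj_mem[OF sB, of w] Irr_subset[OF B] by blast
  then have BE: "c *s oproj h B w \<in> E" for c w by (rule vec.subspace_scale[OF subspace_E])
  have sp: "sect h E (perp B) b (snd p B) = (1 / h e b) *s oproj h B e"
    using sect_perp[OF B b(1) e(1) b(2)] e(3) by simp
  have "sect h E (perp B) b (snd p B) \<in> snd p F"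
  proof (rule WM_incidence[OF p F openin_sect_domain[OF B b(1)] _ continuous_map_sect_amb[OF B b(1)]])
    show "p \<in> {q \<in> topspace amb. snd q B \<in> pchart E (perp B) b}" using top b by simp
    show "sect h E (perp B) b (snd p B) \<in> E" unfolding sp by (rule BE)
    fix w assume w: "w \<in> X" "emb w \<in> {q \<in> topspace amb. snd q B \<in> pchart E (perp B) b}"
    then have wE: "w \<in> E" by (simp add: mem_X_iff)
    have n: "h w b \<noteq> 0"
      using w wE proj_class_mem_pchart_iff[OF subspace_E subspace_perp perp_subset bb]
      by (simp add: snd_embed[OF B])
    have "(1 / h w b) *s oproj h B w \<in> proj_class (perp F) w"
      by (rule mem_proj_class_perp[OF F BE wE, where c = "1 / h w b"]) (simp add: oproj_scale[OF sF] pp)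
    then show "sect h E (perp B) b (snd (emb w) B) \<in> proj_class (perp F) w"
      using sect_perp[OF B b(1) wE n] by (simp add: snd_embed[OF B])
  qed
  then have 1: "(1 / h e b) *s oproj h B e \<in> snd p F" unfolding sp .
  have L: "vec.subspace (snd p F)" "perp F \<subseteq> snd p F"
    using top F by (auto simp: mem_topspace_amb_iff proj_points_def)
  then have sub: "perp B \<subseteq> snd p F" using orth_antimono[OF FB] by blast
  have "h e b *s ((1 / h e b) *s oproj h B e) + (e - oproj h B e) \<in> snd p F"
    using diff_oproj_mem_orth[OF subspace_E sB Irr_subset[OF B] e(1)] sub
    by (intro vec.subspace_add[OF L(1) vec.subspace_scale[OF L(1) 1]]) blast
  then have "e \<in> snd p F" using b(2) by simp
  then show ?thesis
    unfolding e(3) proj_class_def using sub by (intro vec.span_minimal L) simp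
qed

lemma snd_eq_fst:
  assumes "p \<in> WM" "F \<in> Irr" "fst p \<notin> perp F"
  shows "snd p F = proj_class (perp F) (fst p)"
  using proj_points_eq_proj_class[OF subspace_perp] fst_mem_snd assms WM_topspace
  unfolding mem_topspace_amb_iff by blast

lemma snd_eq_dir:
  assumes "p \<in> WM" "F \<in> Irr" "B \<in> Irr" "F \<subseteq> B" "e \<in> snd p B" "e \<notin> perp F"
  shows "snd p F = proj_class (perp F) e"
  using proj_points_eq_proj_class[OF subspace_perp] snd_antimono assms WM_topspace
  unfolding mem_topspace_amb_iff by blast

lemma WM_eqI:
  assumes "p \<in> WM" "fst p = fst q" "snd q \<in> extensional Irr" "\<And>F. F \<in> Irr \<Longrightarrow> snd p F = snd q F"
  shows "p = q"
  using assms WM_topspace[OF assms(1)] unfolding mem_topspace_amb_iff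
  by (auto intro!: prod_eqI extensionalityI[of _ Irr])

text \<open>Over X the base point avoids every \<open>perp F\<close>, so incidence determines all
  projective coordinates from it: no point of the closure other than \<open>emb v\<close> lies over
  a point v of X.\<close>

lemma mem_bd_iff: "p \<in> bd \<longleftrightarrow> p \<in> WM \<and> fst p \<notin> X"
proof -
  have "p = emb (fst p)" if "p \<in> WM" "fst p \<in> X"
  proof (rule WM_eqI[OF that(1)])
    show "snd p F = snd (emb (fst p)) F" if "F \<in> Irr" for F
      using snd_eq_fst[OF \<open>p \<in> WM\<close> that X_not_perp[OF \<open>fst p \<in> X\<close> that]] snd_embed[OF that] by simp
  qed (simp_all add: wm_embed_def)
  then show ?thesis unfolding wm_boundary_def by auto
qed

section \<open>Generic points of the divisors\<close>

text \<open>Each hyperplane is the responsibility of one of the two coordinates of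
  \<open>pt B\<close>, according to whether it contains \<open>perp B\<close>. Lying in
  \<open>perp B\<close> is not part of the condition, so that it is open in E and also holds at the
  nearby points of X.\<close>

definition base_generic :: "(complex ^ 'n) set \<Rightarrow> complex ^ 'n \<Rightarrow> bool" where
  "base_generic B v \<longleftrightarrow> v \<in> E \<and> (\<forall>H\<in>Hs. \<not> perp B \<subseteq> H \<longrightarrow> v \<notin> H)"

definition dir_generic :: "(complex ^ 'n) set \<Rightarrow> complex ^ 'n \<Rightarrow> bool" where
  "dir_generic B e \<longleftrightarrow> e \<in> E \<and> (\<forall>H\<in>Hs. perp B \<subseteq> H \<longrightarrow> e \<notin> H)"

definition D0 :: "(complex ^ 'n) set \<Rightarrow> 'n wpoint set" where
  "D0 B = {pt B y e | y e. y \<in> perp B \<and> base_generic B y \<and> dir_generic B e}"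

lemma base_generic_not_perp:
  assumes B: "B \<in> Irr" and v: "base_generic B v" and F: "F \<in> Irr" "\<not> F \<subseteq> B"
  shows "v \<notin> perp F"
proof
  assume vF: "v \<in> perp F"
  have "\<not> perp B \<subseteq> perp F" using perp_subset_iff B F by (simp add: Irr_line_sums)
  then obtain x where x: "x \<in> perp B" "x \<notin> perp F" by blast
  then have "x \<in> E" using perp_subset by blast
  then obtain H where "H \<in> Hs" "perp F \<subseteq> H" "x \<notin> H"
    using not_mem_perp[OF Irr_line_sums[OF F(1)] _ x(2)] by blast
  then show False using vF x v unfolding base_generic_def by blast
qed

lemma dir_generic_not_perp:
  assumes e: "dir_generic B e" and F: "F \<in> Irr" "F \<subseteq> B"
  shows "e \<notin> perp F"
proof -
  obtain H where "H \<in> Hs" "perp F \<subseteq> H"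
    using hyp_of_nonzero[OF Irr_line_sums[OF F(1)] Irr_nonzero[OF F(1)]] .
  then show ?thesis using e orth_antimono[OF F(2)] unfolding dir_generic_def by blast
qed

text \<open>An open set that contains \<open>D0 B\<close> and cuts exactly \<open>D0 B\<close> out
  of the boundary. The direction is tested on the whole line \<open>snd q B\<close>, so no
  representative has to be chosen.\<close>

definition OB :: "(complex ^ 'n) set \<Rightarrow> 'n wpoint set" where
  "OB B = {q \<in> topspace amb. (\<forall>H\<in>{H \<in> Hs. \<not> perp B \<subseteq> H}. fst q \<notin> H) \<and>
     (\<forall>H\<in>{H \<in> Hs. perp B \<subseteq> H}. \<not> snd q B \<subseteq> H)}"

lemma openin_OB:
  assumes B: "B \<in> Irr"
  shows "openin amb (OB B)"
proof -
  have 1: "openin amb {q \<in> topspace amb. fst q \<notin> H}" if "H \<in> Hs" for H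
  proof -
    have "open (- H)" by (rule open_Compl_vec_subspace[OF hyp_subspace[OF that]])
    then show ?thesis
      using openin_continuous_map_preimage[OF continuous_map_fst_amb, of "- H"] by simp
  qed
  have 2: "openin amb {q \<in> topspace amb. \<not> snd q B \<subseteq> H}" if "H \<in> Hs" "perp B \<subseteq> H" for H
  proof -
    note openin_continuous_map_preimage[OF continuous_map_snd_amb[OF B]
        openin_proj_not_subset[OF subspace_E subspace_perp hyp_subspace[OF that(1)] that(2)]]
    moreover have "{q \<in> topspace amb. snd q B \<in> {L \<in> proj_points E (perp B). \<not> L \<subseteq> H}} =
        {q \<in> topspace amb. \<not> snd q B \<subseteq> H}"
      using B by (auto simp: mem_topspace_amb_iff)
    ultimately show ?thesis by simp
  qed
  have "openin amb ({q \<in> topspace amb. \<forall>H\<in>{H \<in> Hs. \<not> perp B \<subseteq> H}. fst q \<notin> H} \<inter>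
      {q \<in> topspace amb. \<forall>H\<in>{H \<in> Hs. perp B \<subseteq> H}. \<not> snd q B \<subseteq> H})"
    using finite_hyps 1 2 by (intro openin_Int openin_finite_Ball) auto
  moreover have "\<dots> = OB B" unfolding OB_def by blast
  ultimately show ?thesis by simp
qed

text \<open>Incidence determines the coordinates at F inside B from the direction and all the others
  from the base point, and genericity guarantees that each of them is defined by a vector outside
  \<open>perp F\<close>.\<close>

lemma WM_OB_D:
  assumes p: "p \<in> WM" "p \<in> OB B" and B: "B \<in> Irr" and e: "e \<in> snd p B" "e \<notin> perp B"
  shows "dir_generic B e" "p = pt B (fst p) e" "base_generic B (fst p)"
proof -
  have pt: "p \<in> topspace amb" by (rule WM_topspace[OF p(1)])
  have L: "snd p B \<in> proj_points E (perp B)" using pt B by (simp add: mem_topspace_amb_iff)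
  have LE: "snd p B = proj_class (perp B) e"
    by (rule proj_points_eq_proj_class[OF subspace_perp L e])
  show bg: "base_generic B (fst p)"
    using p pt unfolding OB_def base_generic_def mem_topspace_amb_iff by blast
  show dg: "dir_generic B e"
    unfolding dir_generic_def
  proof (intro conjI ballI impI notI)
    show "e \<in> E" using e L by (auto simp: proj_points_def)
    fix H assume H: "H \<in> Hs" "perp B \<subseteq> H" "e \<in> H"
    then have "snd p B \<subseteq> H" unfolding LE proj_class_def using hyp_subspace by (intro vec.span_minimal) auto
    then show False using H p by (auto simp: OB_def)
  qed
  show "p = pt B (fst p) e"
  proof (rule WM_eqI[OF p(1)])
    fix F assume F: "F \<in> Irr"
    show "snd p F = snd (pt B (fst p) e) F"
      using snd_eq_dir[OF p(1) F B _ e(1)] dir_generic_not_perp[OF dg F]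
        snd_eq_fst[OF p(1) F] base_generic_not_perp[OF B bg F] by (simp add: snd_pt[OF F])
  qed (simp_all add: pt_def)
qed

text \<open>Modulo \<open>perp B\<close> the base point is t times e. For nonzero t the recorded
  direction is therefore the one that the base point has anyway, and v avoids the hyperplanes
  containing \<open>perp B\<close> because e does.\<close>

lemma pt_eq_embed:
  assumes B: "B \<in> Irr" and v: "base_generic B v" and e: "dir_generic B e"
    and t: "v - t *s e \<in> perp B" "t \<noteq> 0"
  shows "v \<in> X" "pt B v e = emb v"
proof -
  have "v \<notin> H" if H: "H \<in> Hs" for H
  proof (cases "perp B \<subseteq> H")
    case True
    show ?thesis
    proof
      assume "v \<in> H"
      moreover have "v - t *s e \<in> H" using t True by blast
      ultimately have "v - (v - t *s e) \<in> H" by (rule vec.subspace_diff[OF hyp_subspace[OF H]])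
      then have "t *s e \<in> H" by simp
      then have "(1 / t) *s (t *s e) \<in> H" by (rule vec.subspace_scale[OF hyp_subspace[OF H]])
      then show False using t e True H by (simp add: dir_generic_def)
    qed
  qed (use v H in \<open>auto simp: base_generic_def\<close>)
  then show "v \<in> X" using v by (auto simp: mem_X_iff base_generic_def)
  have "proj_class (perp F) v = proj_class (perp F) e" if "F \<subseteq> B" for F
    using t orth_antimono[OF that] by (intro proj_class_cong[OF subspace_perp]) auto
  then show "pt B v e = emb v"
    unfolding pt_def wm_embed_def by (intro arg_cong[where f = "Pair v"] restrict_ext) simp
qed

lemma continuous_map_pt_generic:
  assumes B: "B \<in> Irr"
    and f: "continuous_map T euclidean f" "\<And>x. x \<in> topspace T \<Longrightarrow> base_generic B (f x)"
    and g: "continuous_map T euclidean g" "\<And>x. x \<in> topspace T \<Longrightarrow> dir_generic B (g x)"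
  shows "continuous_map T amb (\<lambda>x. pt B (f x) (g x))"
proof (rule continuous_map_pt[OF f(1) _ g(1)])
  show "f x \<in> E" "g x \<in> E" if "x \<in> topspace T" for x
    using f(2)[OF that] g(2)[OF that] by (auto simp: base_generic_def dir_generic_def)
qed (use f g base_generic_not_perp[OF B] dir_generic_not_perp in blast)+

lemma open_base_generic: "openin (top_of_set E) {v. base_generic B v}"
proof -
  have "openin (top_of_set E) {v \<in> topspace (top_of_set E). \<forall>H\<in>{H \<in> Hs. \<not> perp B \<subseteq> H}. v \<notin> H}"
  proof (rule openin_finite_Ball)
    fix H assume "H \<in> {H \<in> Hs. \<not> perp B \<subseteq> H}"
    then have "open (- H)" using closed_vec_subspace hyp_subspace by (auto simp: open_Compl)
    then have "openin (top_of_set E) (E \<inter> - H)" by (rule openin_open_Int)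
    then show "openin (top_of_set E) {v \<in> topspace (top_of_set E). v \<notin> H}" by (simp add: Compl_eq Int_def)
  qed (use finite_hyps in simp)
  moreover have "{v \<in> topspace (top_of_set E). \<forall>H\<in>{H \<in> Hs. \<not> perp B \<subseteq> H}. v \<notin> H} = {v. base_generic B v}"
    by (auto simp: base_generic_def)
  ultimately show ?thesis by simp
qed

lemma open_dir_generic: "openin (top_of_set E) {v. dir_generic B v}"
proof -
  have "openin (top_of_set E) {v \<in> topspace (top_of_set E). \<forall>H\<in>{H \<in> Hs. perp B \<subseteq> H}. v \<notin> H}"
  proof (rule openin_finite_Ball)
    fix H assume "H \<in> {H \<in> Hs. perp B \<subseteq> H}"
    then have "open (- H)" using closed_vec_subspace hyp_subspace by (auto simp: open_Compl)
    then have "openin (top_of_set E) (E \<inter> - H)" by (rule openin_open_Int)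
    then show "openin (top_of_set E) {v \<in> topspace (top_of_set E). v \<notin> H}" by (simp add: Compl_eq Int_def)
  qed (use finite_hyps in simp)
  moreover have "{v \<in> topspace (top_of_set E). \<forall>H\<in>{H \<in> Hs. perp B \<subseteq> H}. v \<notin> H} = {v. dir_generic B v}"
    by (auto simp: dir_generic_def)
  ultimately show ?thesis by simp
qed

lemma open_base_generic_line:
  assumes "y \<in> E" "d \<in> E"
  shows "open {s::real. base_generic B (y + of_real s *s d)}"
proof -
  let ?f = "\<lambda>s::real. y + of_real s *s d"
  obtain T where T: "open T" "{v. base_generic B v} = E \<inter> T"
    using open_base_generic[of B] unfolding openin_open by blast
  have "?f s \<in> E" for s using assms subspace_E by (simp add: vec.subspace_add vec.subspace_scale)
  then have "{s. base_generic B (?f s)} = ?f -` T" using T(2) by blast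
  moreover have "continuous_on UNIV ?f" by (intro continuous_intros)
  ultimately show ?thesis using open_vimage[OF T(1)] by simp
qed

lemma pt_in_WM:
  assumes B: "B \<in> Irr" and v: "base_generic B v" and e: "dir_generic B e"
    and t: "v - t *s e \<in> perp B"
  shows "pt B v e \<in> WM"
proof (cases "t = 0")
  case False
  then show ?thesis using pt_eq_embed[OF B v e t] embed_WM by simp
next
  case True
  \<comment> \<open>For t = 0 the point is the limit at s = 0 of \<open>pt B (v + s e) e\<close>,
    which for nonzero s comes from X by \<open>pt_eq_embed\<close>.\<close>
  let ?f = "\<lambda>s::real. v + of_real s *s e"
  let ?S = "{s. base_generic B (?f s)}"
  have vE: "v \<in> E" "e \<in> E" using v e by (auto simp: base_generic_def dir_generic_def)
  have "pt B (?f 0) e \<in> amb closure_of (emb ` X)"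
  proof (rule curve_in_closure)
    show "continuous_map (top_of_set ?S) amb (\<lambda>s. pt B (?f s) e)"
      by (rule continuous_map_pt_generic[OF B]) (auto simp: e intro!: continuous_intros)
    show "open ?S" by (rule open_base_generic_line[OF vE])
    show "0 \<in> ?S" using v by simp
    show "finite {0::real}" by simp
    fix s assume "s \<in> ?S" "s \<notin> {0::real}"
    then show "pt B (?f s) e \<in> emb ` X"
      using pt_eq_embed[OF B, of "?f s" e "of_real s"] e t True by auto
  qed
  then show ?thesis by (simp add: wm_set_def)
qed

lemma D0_subset_OB:
  assumes B: "B \<in> Irr"
  shows "D0 B \<subseteq> OB B"
proof
  fix p assume "p \<in> D0 B"
  then obtain y e where p: "p = pt B y e" "y \<in> perp B" "base_generic B y" "dir_generic B e"
    by (auto simp: D0_def)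
  have "p \<in> WM" unfolding p(1) using p by (intro pt_in_WM[OF B, of _ _ 0]) auto
  then have "p \<in> topspace amb" by (rule WM_topspace)
  moreover have "\<not> snd p B \<subseteq> H" if "H \<in> Hs" "perp B \<subseteq> H" for H
    using p that mem_proj_class[of e] by (auto simp: snd_pt[OF B] dir_generic_def)
  ultimately show "p \<in> OB B" using p by (auto simp: OB_def base_generic_def)
qed

text \<open>Incidence writes the base point as c times e modulo \<open>perp B\<close>. A nonzero c
  would put it into X, so on the boundary c = 0 and the base point lies in
  \<open>perp B\<close>.\<close>

lemma D0_eq: 
  assumes B: "B \<in> Irr"
  shows "D0 B = bd \<inter> OB B"
proof
  show "D0 B \<subseteq> bd \<inter> OB B"
  proof
    fix p assume pD: "p \<in> D0 B"
    then obtain y e where p: "p = pt B y e" "y \<in> perp B" "base_generic B y" "dir_generic B e"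
      by (auto simp: D0_def)
    have "p \<in> WM" unfolding p(1) using p by (intro pt_in_WM[OF B, of _ _ 0]) auto
    moreover have "y \<notin> X" using X_not_perp[OF _ B] p by blast
    ultimately show "p \<in> bd \<inter> OB B" using D0_subset_OB[OF B] pD p by (auto simp: mem_bd_iff)
  qed
  show "bd \<inter> OB B \<subseteq> D0 B"
  proof
    fix p assume "p \<in> bd \<inter> OB B"
    then have p: "p \<in> WM" "fst p \<notin> X" "p \<in> OB B" by (auto simp: mem_bd_iff)
    then have top: "p \<in> topspace amb" "fst p \<in> E" using WM_topspace by (auto simp: mem_topspace_amb_iff)
    obtain e b where e: "e \<in> E" "e \<notin> perp B" "snd p B = proj_class (perp B) e"
      using snd_WM_chart[OF top(1) B] by metis
    have es: "e \<in> snd p B" using e mem_proj_class by simp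
    note D = WM_OB_D[OF p(1,3) B es e(2)]
    obtain H where H: "H \<in> Hs" "fst p \<in> H" using p(2) top(2) by (auto simp: mem_X_iff)
    then have PH: "perp B \<subseteq> H" using D(3) by (auto simp: base_generic_def)
    obtain c where c: "fst p - c *s e \<in> perp B"
      using fst_mem_snd[OF p(1) B] mem_proj_class_iff[OF subspace_perp] e by auto
    have "c = 0"
    proof (rule ccontr)
      assume "c \<noteq> 0"
      then show False using pt_eq_embed[OF B D(3) D(1) c] p by simp
    qed
    then have "fst p \<in> perp B" using c by simp
    then show "p \<in> D0 B" unfolding D0_def using D by blast
  qed
qed

section \<open>Connectedness, projection and density of the generic strata\<close>

lemma connectedin_D0:
  assumes B: "B \<in> Irr"
  shows "connectedin amb (D0 B)"
proof -
  let ?S = "{y \<in> perp B. base_generic B y}" and ?T = "{e. dir_generic B e}"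
  have "?S = perp B - \<Union>{H \<in> Hs. \<not> perp B \<subseteq> H}" "?T = E - \<Union>{H \<in> Hs. perp B \<subseteq> H}"
    using perp_subset by (auto simp: base_generic_def dir_generic_def)
  moreover have "path_connected (perp B - \<Union>{H \<in> Hs. \<not> perp B \<subseteq> H})"
    "path_connected (E - \<Union>{H \<in> Hs. perp B \<subseteq> H})"
    by (rule path_connected_subspace_complement; use subspace_E finite_hyps hyp_subspace in simp)+
  ultimately have "connected ?S" "connected ?T"
    by (simp_all add: path_connected_imp_connected)
  then have c: "connectedin (top_of_set (?S \<times> ?T)) (?S \<times> ?T)"
    by (simp add: connectedin_subtopology connected_Times)
  have "continuous_map (top_of_set (?S \<times> ?T)) amb (\<lambda>x. pt B (fst x) (snd x))"
    by (rule continuous_map_pt_generic[OF B]) (auto intro!: continuous_intros)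
  from connectedin_continuous_map_image[OF this c]
  have "connectedin amb ((\<lambda>x. pt B (fst x) (snd x)) ` (?S \<times> ?T))" .
  moreover have "(\<lambda>x. pt B (fst x) (snd x)) ` (?S \<times> ?T) = D0 B"
    unfolding D0_def image_def by (auto 0 3)
  ultimately show ?thesis by simp
qed

text \<open>The delicate inclusion is the surjectivity onto \<open>perp B\<close>, also over points
  y that are not generic. Such a y is approached along a real line towards a generic
  \<open>y0\<close>, and a limit point of the model is written down explicitly.\<close>

lemma fst_closure_D0:
  assumes B: "B \<in> Irr" and ne: "D0 B \<noteq> {}"
  shows "fst ` (amb closure_of D0 B) = perp B"
proof
  show "fst ` (amb closure_of D0 B) \<subseteq> perp B"
  proof (rule image_subsetI, rule ccontr)
    fix p assume p: "p \<in> amb closure_of D0 B" "fst p \<notin> perp B"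
    have "open (- perp B)" by (rule open_Compl_vec_subspace[OF subspace_perp])
    then have "openin amb {q \<in> topspace amb. fst q \<in> - perp B}"
      by (intro openin_continuous_map_preimage[OF continuous_map_fst_amb]) simp
    moreover have "p \<in> {q \<in> topspace amb. fst q \<in> - perp B}" using p closure_of_subset_topspace[of amb "D0 B"] by blast
    ultimately obtain q where "q \<in> D0 B" "fst q \<in> - perp B"
      using p(1) unfolding in_closure_of by (metis (no_types, lifting) mem_Collect_eq)
    then show False by (auto simp: D0_def)
  qed
  show "perp B \<subseteq> fst ` (amb closure_of D0 B)"
  proof
    fix y assume y: "y \<in> perp B"
    obtain y0 e0 where y0: "y0 \<in> perp B" "base_generic B y0" and e0: "dir_generic B e0"
      using ne by (auto simp: D0_def)
    have yE: "y \<in> E" "y0 \<in> E" "e0 \<in> E"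
      using y y0 e0 perp_subset by (auto simp: base_generic_def dir_generic_def)
    define f where "f s = y + of_real s *s y0" for s :: real
    \<comment> \<open>If y lies in \<open>perp F\<close>, the class of \<open>f s\<close> modulo
      \<open>perp F\<close> is that of \<open>y0\<close> for every nonzero s. Taking
      \<open>y0\<close> there extends this coordinate continuously through s = 0.\<close>
    define g where "g s = (f s, \<lambda>F\<in>Irr. if F \<subseteq> B then proj_class (perp F) e0
        else if y \<in> perp F then proj_class (perp F) y0 else proj_class (perp F) (f s))" for s
    define S where "S = {s. \<forall>F\<in>{F \<in> Irr. y \<notin> perp F}. f s \<notin> perp F}"
    have fE: "f s \<in> E" for s unfolding f_def using yE subspace_E by (simp add: vec.subspace_add vec.subspace_scale)
    have fB: "f s \<in> perp B" for s unfolding f_def using y y0 subspace_perp by (simp add: vec.subspace_add vec.subspace_scale)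
    have cf: "continuous_on T f" for T unfolding f_def by (intro continuous_intros)
    have "open {s. f s \<notin> perp F}" for F
    proof -
      have "open (- perp F)" by (rule open_Compl_vec_subspace[OF subspace_perp])
      then have "open (f -` (- perp F))" using cf by (rule open_vimage)
      then show ?thesis by (simp add: vimage_def)
    qed
    then have opS: "open S" unfolding S_def
      using openin_finite_Ball[of "{F \<in> Irr. y \<notin> perp F}" euclidean "\<lambda>F s. f s \<notin> perp F"] finite_Irr by simp
    have pc: "continuous_map (top_of_set S) (proj_topology E (perp F)) (\<lambda>s. proj_class (perp F) (k s))"
      if "continuous_on S k" "\<And>s. s \<in> S \<Longrightarrow> k s \<in> E - perp F" for k F
      using that by (intro continuous_map_proj_class subspace_E subspace_perp perp_subset)
        (auto simp: continuous_map_in_subtopology)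
    have cg: "continuous_map (top_of_set S) amb g"
    proof (rule continuous_map_ambI)
      fix F assume F: "F \<in> Irr"
      consider "F \<subseteq> B" | "\<not> F \<subseteq> B" "y \<in> perp F" | "\<not> F \<subseteq> B" "y \<notin> perp F" by blast
      then show "continuous_map (top_of_set S) (proj_topology E (perp F)) (\<lambda>s. snd (g s) F)"
      proof cases
        case 1
        then show ?thesis
          using pc[of "\<lambda>_. e0" F] dir_generic_not_perp[OF e0 F] yE F by (simp add: g_def)
      next
        case 2
        then show ?thesis
          using pc[of "\<lambda>_. y0" F] base_generic_not_perp[OF B y0(2) F] yE F by (simp add: g_def)
      next
        case 3
        then show ?thesis
          using pc[OF cf, of F] fE F by (simp add: g_def S_def)
      qed
    qed (simp_all add: g_def cf fE)
    \<comment> \<open>Finiteness is available for complex parameters of the line; real parts keep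
      the set finite and still contain every bad real parameter. The parameter 0 is added because
      \<open>g\<close> agrees with \<open>pt\<close> only away from it.\<close>
    define bad where "bad = {0} \<union> Re ` {\<zeta>. y + \<zeta> *s y0 \<in> \<Union>{H \<in> Hs. \<not> perp B \<subseteq> H}}"
    have "finite {\<zeta>. y + \<zeta> *s y0 \<in> \<Union>{H \<in> Hs. \<not> perp B \<subseteq> H}}"
      using finite_hyps hyp_subspace y0(2)
      by (intro finite_line_in_subspaces) (auto simp: base_generic_def)
    then have fin: "finite bad" by (simp add: bad_def)
    have "g 0 \<in> amb closure_of D0 B"
    proof (rule curve_in_closure[OF cg opS _ fin])
      show "0 \<in> S" by (simp add: S_def f_def)
      fix s assume s: "s \<in> S" "s \<notin> bad"
      have gen: "base_generic B (f s)"
      proof -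
        have "f s \<notin> H" if "H \<in> Hs" "\<not> perp B \<subseteq> H" for H
        proof
          assume "f s \<in> H"
          then have "Re (of_real s) \<in> bad"
            unfolding bad_def f_def using that by (intro UnI2 imageI) blast
          then show False using s by simp
        qed
        then show ?thesis using fE by (auto simp: base_generic_def)
      qed
      have s0: "s \<noteq> 0" using s by (auto simp: bad_def)
      have "proj_class (perp F) (f s) = proj_class (perp F) y0" if "y \<in> perp F" for F
        using that s0 by (intro proj_class_cong[OF subspace_perp, of _ "of_real s"]) (auto simp: f_def)
      then have "g s = pt B (f s) e0"
        unfolding g_def pt_def by (auto simp: fun_eq_iff restrict_def)
      then show "g s \<in> D0 B" unfolding D0_def using gen fB e0 by blast
    qed
    moreover have "fst (g 0) = y" by (simp add: g_def f_def)
    ultimately show "y \<in> fst ` (amb closure_of D0 B)" by force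
  qed
qed

text \<open>Split the span \<open>C\<close> of the lines \<open>H\<^sup>\<bottom>\<close> with \<open>H \<ni> fst p\<close> as \<open>B \<oplus> B'\<close> with \<open>B\<close> irreducible.
  Approximating \<open>p\<close> by \<open>w \<in> X\<close> and moving the base point of \<open>w\<close> into \<open>B\<^sup>\<bottom>\<close> by the oblique
  projection changes none of the projective coordinates indexed by subspaces of \<open>C\<close>.\<close>

lemma boundary_in_closure_D0:
  assumes p: "p \<in> bd"
  shows "\<exists>B\<in>Irr. p \<in> amb closure_of D0 B"
proof -
  have pWM: "p \<in> WM" and pX: "fst p \<notin> X" using p by (auto simp: mem_bd_iff)
  have top: "p \<in> topspace amb" by (rule WM_topspace[OF pWM])
  then have vE: "fst p \<in> E" by (simp add: mem_topspace_amb_iff)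
  define S where "S = {H \<in> Hs. fst p \<in> H}"
  define C where "C = vec.span (\<Union>H\<in>S. perp H)"
  have C: "C \<in> line_sums h E G" 
    unfolding line_sums_def C_def S_def by (rule CollectI, rule exI, rule conjI[OF _ refl]) blast
  have lineC: "perp H \<subseteq> C" if "H \<in> S" for H unfolding C_def using that by (auto intro: vec.span_base)
  have vC: "fst p \<in> perp C"
  proof -
    have "fst p \<in> perp (perp H)" if "H \<in> S" for H using that perp_perp_hyp by (auto simp: S_def)
    then show ?thesis unfolding C_def orth_span using vE by (auto simp: orth_def)
  qed
  \<comment> \<open>\<open>perp C\<close> is the smallest flat through the base point: a hyperplane
    containing \<open>perp F\<close> passes through \<open>fst p\<close>, so its normal line is
    among those spanning C.\<close>
  have FC: "F \<subseteq> C" if F: "F \<in> Irr" "fst p \<in> perp F" for F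
  proof -
    have "x \<in> perp F" if x: "x \<in> perp C" for x
    proof (rule ccontr)
      assume "x \<notin> perp F"
      then obtain H where H: "H \<in> Hs" "perp F \<subseteq> H" "x \<notin> H"
        using not_mem_perp[OF Irr_line_sums[OF F(1)]] x perp_subset by blast
      then have "H \<in> S" using F by (auto simp: S_def)
      then have "perp C \<subseteq> H" using lineC hyp_perp_subset_iff[OF H(1) C] by blast
      then show False using x H by blast
    qed
    then show ?thesis using perp_subset_iff[OF C Irr_line_sums[OF F(1)]] by blast
  qed
  obtain H0 where H0: "H0 \<in> S" using pX vE by (auto simp: S_def mem_X_iff)
  have "C \<noteq> {0}"
    using lineC[OF H0] Irr_nonzero[OF line_in_Irr, of H0] vec.subspace_0[OF subspace_perp[of H0]] H0
    by (auto simp: S_def)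
  then obtain B B' where B: "B \<in> Irr" "B \<subseteq> C" and B': "vec.subspace B'" "B' \<subseteq> C" "B \<inter> B' = {0}"
    and split: "\<And>F. F \<in> Irr \<Longrightarrow> F \<subseteq> C \<Longrightarrow> F \<subseteq> B \<or> F \<subseteq> B'"
    using irreducible_splitting[OF C] by metis
  obtain P where P: "Vector_Spaces.linear (*s) (*s) P" and PB': "\<And>w. P w \<in> perp B'"
    and PB: "\<And>w. w \<in> E \<Longrightarrow> w - P w \<in> perp B" and PC: "\<And>w. w \<in> perp C \<Longrightarrow> P w = 0"
    using oblique_projection[OF subspace_E Irr_subspace[OF B(1)] B(2) B'(1,2)
        line_sums_subspace[OF C] line_sums_subset[OF C] B'(3)] by metis
  define r where "r w = w - P w" for w
  have rE: "r w \<in> E" if "w \<in> E" for w using PB[OF that] perp_subset by (auto simp: r_def)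
  have PE: "P w \<in> E" for w using PB' perp_subset by blast
  have rp: "r (fst p) = fst p" using PC[OF vC] by (simp add: r_def)
  have cr: "continuous_on T r" for T
    unfolding r_def by (intro continuous_intros bounded_linear.continuous_on[OF complex_linear_imp_bounded_linear[OF P]])
  let ?U = "{q \<in> topspace amb. \<forall>F\<in>{F \<in> Irr. \<not> F \<subseteq> C}. r (fst q) \<notin> perp F}"
  \<comment> \<open>Keeps the coordinates inside C and recomputes the others from the moved base
    point. The map is continuous on \<open>?U\<close>, fixes p and sends \<open>emb w\<close> into
    \<open>D0 B\<close>, so points of X near p give points of \<open>D0 B\<close> near p.\<close>
  define \<Phi> where "\<Phi> q = (r (fst q), \<lambda>F\<in>Irr. if F \<subseteq> C then snd q F else proj_class (perp F) (r (fst q)))" for q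
  have crf: "continuous_map amb euclidean (\<lambda>q. r (fst q))"
    using continuous_map_compose[OF continuous_map_fst_amb, of euclidean r] cr by (simp add: o_def)
  have opU: "openin amb ?U"
  proof (rule openin_finite_Ball)
    fix F
    have "open (- perp F)" by (rule open_Compl_vec_subspace[OF subspace_perp])
    then show "openin amb {q \<in> topspace amb. r (fst q) \<notin> perp F}"
      using openin_continuous_map_preimage[OF crf, of "- perp F"] by simp
  qed (use finite_Irr in simp)
  have pU: "p \<in> ?U" using top rp FC by auto
  have tU: "topspace (subtopology amb ?U) = ?U" by auto
  have cPhi: "continuous_map (subtopology amb ?U) amb \<Phi>"
  proof (rule continuous_map_ambI)
    show "continuous_map (subtopology amb ?U) euclidean (\<lambda>x. fst (\<Phi> x))"
      unfolding \<Phi>_def fst_conv by (rule continuous_map_from_subtopology[OF crf])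
    fix F assume F: "F \<in> Irr"
    show "continuous_map (subtopology amb ?U) (proj_topology E (perp F)) (\<lambda>x. snd (\<Phi> x) F)"
    proof (cases "F \<subseteq> C")
      case True
      then show ?thesis using continuous_map_from_subtopology[OF continuous_map_snd_amb[OF F]] F
        by (simp add: \<Phi>_def)
    next
      case False
      have "continuous_map (subtopology amb ?U) (top_of_set (E - perp F)) (\<lambda>q. r (fst q))"
        using continuous_map_from_subtopology[OF crf] False F rE
        by (auto simp: continuous_map_in_subtopology mem_topspace_amb_iff)
      then show ?thesis
        using continuous_map_proj_class[OF subspace_E subspace_perp perp_subset] False F
        by (simp add: \<Phi>_def)
    qed
  qed (use rE in \<open>auto simp: \<Phi>_def mem_topspace_amb_iff\<close>)
  have "\<Phi> p = p"
  proof (rule sym, rule WM_eqI[OF pWM])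
    show "snd p F = snd (\<Phi> p) F" if "F \<in> Irr" for F
      using snd_eq_fst[OF pWM that] FC[OF that] that rp by (auto simp: \<Phi>_def)
  qed (simp_all add: \<Phi>_def rp)
  have PhiD0: "\<Phi> (emb w) \<in> D0 B" if w: "w \<in> X" "emb w \<in> ?U" for w
  proof -
    have wE: "w \<in> E" using w by (simp add: mem_X_iff)
    have r: "r w \<in> perp B" using PB[OF wE] by (simp add: r_def)
    have w_eq: "w = r w + P w" by (simp add: r_def)
    have dir: "dir_generic B (P w)"
      unfolding dir_generic_def
    proof (intro conjI ballI impI notI)
      fix H assume H: "H \<in> Hs" "perp B \<subseteq> H" "P w \<in> H"
      then have "r w + P w \<in> H" using r hyp_subspace by (intro vec.subspace_add) auto
      then show False using w H w_eq by (auto simp: mem_X_iff)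
    qed (rule PE)
    have base: "base_generic B (r w)"
      unfolding base_generic_def
    proof (intro conjI ballI impI notI)
      show "r w \<in> E" by (rule rE[OF wE])
      fix H assume H: "H \<in> Hs" "\<not> perp B \<subseteq> H" "r w \<in> H"
      \<comment> \<open>If the normal line of H lies in C, the splitting forces it into B', so
        \<open>P w\<close> lies in H and \<open>w = r w + P w\<close> would too. Otherwise H is one
        of the flats that the choice of \<open>?U\<close> keeps away from
        \<open>r w\<close>.\<close>
      show False
      proof (cases "perp H \<subseteq> C")
        case True
        then have "perp H \<subseteq> B'"
          using split[OF line_in_Irr[OF H(1)]] H hyp_perp_subset_iff[OF H(1) Irr_line_sums[OF B(1)]] by blast
        then have "P w \<in> perp (perp H)" using PB'[of w] orth_antimono by blast
        then have "r w + P w \<in> H"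
          using H perp_perp_hyp[OF H(1)] hyp_subspace by (intro vec.subspace_add) auto
        then show False using w H w_eq by (auto simp: mem_X_iff)
      next
        case False
        then have "r w \<notin> perp (perp H)" using w line_in_Irr[OF H(1)] by auto
        then show False using H perp_perp_hyp by simp
      qed
    qed
    have F_eq: "snd (\<Phi> (emb w)) F = snd (pt B (r w) (P w)) F" if F: "F \<in> Irr" for F
    proof -
      consider "\<not> F \<subseteq> C" | "F \<subseteq> C" "F \<subseteq> B" | "F \<subseteq> C" "\<not> F \<subseteq> B" "F \<subseteq> B'"
        using split[OF F] by blast
      then show ?thesis
      proof cases
        case 1
        then show ?thesis using F B by (auto simp: \<Phi>_def snd_pt)
      next
        case 2
        have "w - 1 *s P w \<in> perp F" using r orth_antimono[OF 2(2)] by (auto simp: r_def)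
        then have "proj_class (perp F) w = proj_class (perp F) (P w)"
          by (intro proj_class_cong[OF subspace_perp, of _ 1]) auto
        then show ?thesis using F 2 by (simp add: \<Phi>_def snd_pt snd_embed)
      next
        case 3
        have "w - 1 *s r w \<in> perp F" using PB'[of w] orth_antimono[OF 3(3)] by (auto simp: r_def)
        then have "proj_class (perp F) w = proj_class (perp F) (r w)"
          by (intro proj_class_cong[OF subspace_perp, of _ 1]) auto
        then show ?thesis using F 3 by (simp add: \<Phi>_def snd_pt snd_embed)
      qed
    qed
    have "snd (\<Phi> (emb w)) = snd (pt B (r w) (P w))"
      by (rule extensionalityI[of _ Irr]) (auto simp: F_eq, simp_all add: \<Phi>_def pt_def)
    then have "\<Phi> (emb w) = pt B (r w) (P w)"
      by (intro prod_eqI) (simp_all add: \<Phi>_def)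
    then show ?thesis unfolding D0_def using r base dir by blast
  qed
  have "p \<in> amb closure_of D0 B"
    unfolding in_closure_of
  proof (intro conjI allI impI)
    show "p \<in> topspace amb" by (rule top)
    fix V assume V: "p \<in> V \<and> openin amb V"
    have "openin (subtopology amb ?U) {q \<in> topspace (subtopology amb ?U). \<Phi> q \<in> V}"
      using V by (intro openin_continuous_map_preimage[OF cPhi]) blast
    then have "openin amb {q \<in> ?U. \<Phi> q \<in> V}"
      unfolding tU openin_open_subtopology[OF opU] by blast
    moreover have "p \<in> {q \<in> ?U. \<Phi> q \<in> V}" using pU V \<open>\<Phi> p = p\<close> by simp
    ultimately obtain w where "w \<in> X" "emb w \<in> {q \<in> ?U. \<Phi> q \<in> V}"
      using WM_approx[OF pWM] by blast
    then show "\<exists>y. y \<in> D0 B \<and> y \<in> V" using PhiD0 by blast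
  qed
  then show ?thesis using B(1) by blast
qed

end

section \<open>Holomorphic charts at generic points\<close>

lemma holo_derivative:
  fixes f :: "complex ^ 'n::finite \<Rightarrow> complex ^ 'n"
  assumes "(f has_derivative f') F" "Vector_Spaces.linear (*s) (*s) f'"
  shows "\<exists>M. (f has_derivative (*v) M) F"
proof -
  have "(*v) (matrix f') = f'" using matrix_works[OF assms(2)] by (rule ext)
  then show ?thesis using assms(1) by metis
qed

lemma holo_on_subset: "holo_on T f \<Longrightarrow> S \<subseteq> T \<Longrightarrow> holo_on S f"
  unfolding holo_on_def by (meson has_derivative_subset subset_iff)

lemma holo_on_imp_continuous_on: "holo_on S f \<Longrightarrow> continuous_on S f"
  unfolding holo_on_def continuous_on_eq_continuous_within
  using has_derivative_continuous by blast

text \<open>Within a relatively open part of E a derivative is determined only on E, not as a matrix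
  on the whole space. Restriction to real lines in E reduces uniqueness questions to one real
  variable.\<close>

lemma has_vector_derivative_line:
  fixes f :: "complex ^ 'n::finite \<Rightarrow> 'b::real_normed_vector"
  assumes f: "(f has_derivative f') (at z within \<Omega>)" and op: "openin (top_of_set E) \<Omega>"
    and E: "vec.subspace E" and z: "z \<in> \<Omega>" and u: "u \<in> E"
  shows "((\<lambda>r::real. f (z + r *\<^sub>R u)) has_vector_derivative f' u) (at 0)"
    and "\<forall>\<^sub>F r::real in nhds 0. z + r *\<^sub>R u \<in> \<Omega>"
proof -
  obtain T where T: "open T" "\<Omega> = E \<inter> T" using op unfolding openin_open by blast
  let ?l = "\<lambda>r::real. z + r *\<^sub>R u"
  have lE: "?l r \<in> E" for r
    using z T u E by (auto simp: scaleR_vec_complex intro!: vec.subspace_add vec.subspace_scale)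
  define S where "S = ?l -` T"
  have "open S" unfolding S_def by (intro open_vimage T continuous_intros)
  moreover have S0: "0 \<in> S" using z T by (simp add: S_def)
  ultimately show "\<forall>\<^sub>F r::real in nhds 0. ?l r \<in> \<Omega>"
    unfolding eventually_nhds using lE T by (intro exI[of _ S]) (auto simp: S_def)
  have S_sub: "?l ` S \<subseteq> \<Omega>" using lE T by (auto simp: S_def)
  have l: "(?l has_derivative (\<lambda>r. r *\<^sub>R u)) (at 0 within S)"
    by (auto intro!: derivative_eq_intros)
  have "(f has_derivative f') (at (?l 0) within ?l ` S)"
    using has_derivative_subset[OF f S_sub] by simp
  from has_derivative_in_compose[OF l this]
  have "((\<lambda>r. f (?l r)) has_derivative (\<lambda>r. f' (r *\<^sub>R u))) (at 0 within S)" .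
  moreover have "f' (r *\<^sub>R u) = r *\<^sub>R f' u" for r
    using has_derivative_linear[OF f] by (simp add: linear_scale)
  ultimately show "((\<lambda>r. f (?l r)) has_vector_derivative f' u) (at 0)"
    using at_within_open[OF S0 \<open>open S\<close>] by (simp add: has_vector_derivative_def)
qed

lemma has_vector_derivative_unique_eventually:
  fixes f g :: "real \<Rightarrow> 'b::real_normed_vector"
  assumes "(f has_vector_derivative a) (at 0)" "(g has_vector_derivative b) (at 0)"
    and "\<forall>\<^sub>F r in nhds 0. f r = g r"
  shows "a = b"
proof -
  obtain S where "open S" "0 \<in> S" "\<And>r. r \<in> S \<Longrightarrow> f r = g r"
    using assms(3) unfolding eventually_nhds by blast
  then have "(g has_vector_derivative a) (at 0)"
    using has_vector_derivative_transform_within_open[OF assms(1)] by blast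
  then show ?thesis using assms(2) vector_derivative_unique_at by blast
qed

context arrangement
begin

text \<open>The chart at direction \<open>e \<in> B\<close>: a vector of \<open>E\<close> is written \<open>y + w + t e\<close> with
  \<open>y \<in> B\<^sup>\<bottom>\<close> and \<open>w \<in> B\<close> orthogonal to \<open>e\<close>, and is sent to base point \<open>y + t (e + w)\<close>
  and direction \<open>e + w\<close>. The divisor is \<open>t = 0\<close>.\<close>

context
  fixes B :: "(complex ^ 'n) set" and e :: "complex ^ 'n"
  assumes B: "B \<in> Irr" and e: "e \<in> B" "e \<noteq> 0"
begin

definition "ct z = h z e / h e e"
definition "cdir z = e + oproj h B z - ct z *s e"
definition "cbase z = (z - oproj h B z) + ct z *s cdir z"
definition "cdom = {z \<in> E. base_generic B (cbase z) \<and> dir_generic B (cdir z)}"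
definition "chart z = pt B (cbase z) (cdir z)"
text \<open>The multiple of e for which \<open>h z cfun\<close> is \<open>ct z\<close>. In the
  affine chart that it defines on the projective space, the normalised section of
  \<open>chart z\<close> is exactly \<open>cdir z\<close>.\<close>

definition "cfun = (1 / h e e) *s e"

lemma sB: "vec.subspace B" and BE: "B \<subseteq> E" and eE: "e \<in> E" and hee: "h e e \<noteq> 0"
  using Irr_subspace[OF B] Irr_subset[OF B] e by auto

lemma h_cfun: "h z cfun = ct z"
  using cnj_swap[of e e] by (simp add: cfun_def ct_def scale_right)

lemma cfun_mem: "cfun \<in> B"
  unfolding cfun_def by (rule vec.subspace_scale[OF sB e(1)])

lemma cfun_perp_perp: "cfun \<in> perp (perp B)"
  using cfun_mem perp_perp[OF Irr_line_sums[OF B]] by simp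

lemma ct_linear: "ct (x + y) = ct x + ct y" "ct (c *s x) = c * ct x" "ct (x - y) = ct x - ct y"
  by (simp_all add: ct_def add_left scale_left diff_left add_divide_distrib diff_divide_distrib)

lemma ct_e [simp]: "ct e = 1"
  using hee by (simp add: ct_def)

lemma ct_oproj [simp]: "ct (oproj h B z) = ct z"
  using h_oproj[OF sB e(1)] by (simp add: ct_def)

lemma cdir_mem: "cdir z \<in> B"
  unfolding cdir_def
  by (intro vec.subspace_diff vec.subspace_add vec.subspace_scale sB e oproj_mem)

lemma ct_cdir [simp]: "ct (cdir z) = 1"
  by (simp add: cdir_def ct_linear)

lemma oproj_cdir [simp]: "oproj h B (cdir z) = cdir z"
  by (rule oproj_eq[OF sB cdir_mem])

lemma oproj_class_cdir:
  assumes "v \<in> proj_class (perp B) (cdir z)"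
  shows "oproj h B v = ct v *s cdir z"
proof -
  obtain c where c: "oproj h B v = c *s cdir z" using oproj_proj_class[OF B assms] by auto
  then have "ct v = c" using ct_oproj[of v] by (simp add: ct_linear)
  then show ?thesis using c by simp
qed

lemma oproj_cbase: "oproj h B (cbase z) = ct z *s cdir z"
  unfolding cbase_def by (simp add: oproj_add[OF sB] oproj_diff[OF sB] oproj_scale[OF sB]
      oproj_eq[OF sB oproj_mem[OF sB]])

lemma cbase_minus: "z \<in> E \<Longrightarrow> cbase z - ct z *s cdir z \<in> perp B"
  using diff_oproj_mem_orth[OF subspace_E sB BE] by (simp add: cbase_def)

lemma cbase_mem: "z \<in> E \<Longrightarrow> cbase z \<in> E"
  unfolding cbase_def using oproj_mem[OF sB, of z] cdir_mem[of z] BE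
  by (intro vec.subspace_diff vec.subspace_add vec.subspace_scale subspace_E) auto

lemma continuous_on_ct: "continuous_on S ct"
  unfolding ct_def using hee by (intro continuous_intros) auto

lemma continuous_on_cdir: "continuous_on S cdir"
  unfolding cdir_def by (intro continuous_intros continuous_on_ct sB)

lemma continuous_on_cbase: "continuous_on S cbase"
  unfolding cbase_def by (intro continuous_intros continuous_on_ct continuous_on_cdir sB)

lemma linear_oproj_add: "oproj h B (x + y) = oproj h B x + oproj h B y"
    "oproj h B (c *s x) = c *s oproj h B x"
  by (simp_all add: oproj_add[OF sB] oproj_scale[OF sB])

lemma has_derivative_cdir:
  "(cdir has_derivative (\<lambda>u. oproj h B u - ct u *s e)) (at z within S)"
proof -
  let ?f = "\<lambda>u. oproj h B u - ct u *s e"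
  have "Vector_Spaces.linear (*s) (*s) ?f"
    by unfold_locales (simp_all add: linear_oproj_add ct_linear vec.scale_right_diff_distrib
        vec.scale_left_distrib)
  then have bl: "bounded_linear ?f" by (rule complex_linear_imp_bounded_linear)
  have "((\<lambda>z. e + ?f z) has_derivative (\<lambda>u. 0 + ?f u)) (at z within S)"
    by (intro has_derivative_add has_derivative_const bounded_linear_imp_has_derivative bl)
  then have "((\<lambda>z. e + ?f z) has_derivative ?f) (at z within S)" by simp
  then show ?thesis unfolding cdir_def by (simp add: add_diff_eq)
qed

lemma has_derivative_cbase:
  "(cbase has_derivative (\<lambda>u. (u - oproj h B u) + (ct z *s (oproj h B u - ct u *s e) + ct u *s cdir z)))
     (at z within S)"
proof -
  have bl: "bounded_linear ct"
    unfolding ct_def divide_inverse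
    by (intro bounded_linear_mult_const bounded_linear_h_left)
  have "((\<lambda>z. ct z *s cdir z) has_derivative (\<lambda>u. ct z *s (oproj h B u - ct u *s e) + ct u *s cdir z))
      (at z within S)"
    by (rule bounded_bilinear.FDERIV[OF bounded_bilinear_vector_scalar_mult
        bounded_linear_imp_has_derivative[OF bl] has_derivative_cdir])
  moreover have "((\<lambda>z. z - oproj h B z) has_derivative (\<lambda>u. u - oproj h B u)) (at z within S)"
    by (intro has_derivative_diff has_derivative_ident
        bounded_linear_imp_has_derivative bounded_linear_oproj sB)
  ultimately show ?thesis unfolding cbase_def by (rule has_derivative_add[rotated])
qed

lemma holo_on_cdir: "holo_on S cdir"
  unfolding holo_on_def
proof
  fix z
  show "\<exists>M. (cdir has_derivative (*v) M) (at z within S)"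
    by (rule holo_derivative[OF has_derivative_cdir], unfold_locales)
      (simp_all add: linear_oproj_add ct_linear vec.scale_right_diff_distrib vec.scale_left_distrib)
qed

lemma holo_on_cbase: "holo_on S cbase"
  unfolding holo_on_def
proof
  fix z
  show "\<exists>M. (cbase has_derivative (*v) M) (at z within S)"
    by (rule holo_derivative[OF has_derivative_cbase], unfold_locales)
      (simp_all add: linear_oproj_add ct_linear vec_eq_iff algebra_simps)
qed

lemma openin_cdom: "openin (top_of_set E) cdom"
proof -
  have "cdir z \<in> E" for z using cdir_mem BE by blast
  then have 1: "continuous_map (top_of_set E) (top_of_set E) cdir"
    "continuous_map (top_of_set E) (top_of_set E) cbase"
    using continuous_on_cdir continuous_on_cbase cbase_mem by auto
  have "openin (top_of_set E) ({z \<in> topspace (top_of_set E). cbase z \<in> {v. base_generic B v}} \<inter>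
      {z \<in> topspace (top_of_set E). cdir z \<in> {v. dir_generic B v}})"
    by (intro openin_Int openin_continuous_map_preimage[OF 1(2) open_base_generic]
        openin_continuous_map_preimage[OF 1(1) open_dir_generic])
  moreover have "\<dots> = cdom" by (auto simp: cdom_def)
  ultimately show ?thesis by simp
qed

text \<open>An intrinsic description of the image of the chart, which makes its openness in the
  model visible. \<open>csect\<close> recovers the direction continuously, and \<open>cinv\<close>
  reassembles the three components.\<close>

definition "cimg = WM \<inter> (OB B \<inter> {q \<in> topspace amb. snd q B \<in> pchart E (perp B) cfun})"
definition "csect p = sect h E (perp B) cfun (snd p B)"
definition "cinv p = (fst p - oproj h B (fst p)) + (csect p - e) + ct (fst p) *s e"

lemma chart_WM: "z \<in> cdom \<Longrightarrow> chart z \<in> WM"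
  unfolding chart_def cdom_def using cbase_minus by (auto intro: pt_in_WM[OF B])

lemma chart_mem: 
  assumes z: "z \<in> cdom"
  shows "chart z \<in> cimg"
proof -
  have top: "chart z \<in> topspace amb" using WM_topspace chart_WM[OF z] by blast
  have dg: "dir_generic B (cdir z)" "base_generic B (cbase z)" using z by (auto simp: cdom_def)
  have "\<not> snd (chart z) B \<subseteq> H" if "H \<in> Hs" "perp B \<subseteq> H" for H
    using that mem_proj_class[of "cdir z"] dg by (auto simp: chart_def snd_pt[OF B] dir_generic_def)
  then have "chart z \<in> OB B" using top dg by (auto simp: OB_def base_generic_def chart_def)
  moreover have "snd (chart z) B \<in> pchart E (perp B) cfun"
    using proj_class_mem_pchart_iff[OF subspace_E subspace_perp perp_subset cfun_perp_perp, of "cdir z"]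
      cdir_mem[of z] BE by (auto simp: chart_def snd_pt[OF B] h_cfun)
  ultimately show ?thesis using chart_WM[OF z] top by (simp add: cimg_def)
qed

lemma csect_chart: "csect (chart z) = cdir z"
  using sect_perp[OF B cfun_mem, of "cdir z"] cdir_mem[of z] BE
  by (auto simp: csect_def chart_def snd_pt[OF B] h_cfun)

lemma cinv_chart: "z \<in> cdom \<Longrightarrow> cinv (chart z) = z"
proof -
  have "ct (cbase z) = ct z"
    using ct_oproj[of "cbase z"] by (simp add: oproj_cbase ct_linear)
  then show ?thesis
    unfolding cinv_def csect_chart by (simp add: chart_def oproj_cbase) (simp add: cbase_def cdir_def)
qed

text \<open>The normalised direction s satisfies \<open>ct s = 1\<close>, and incidence makes the
  part of the base point in B a multiple \<open>c *s s\<close> with \<open>c = ct (fst p)\<close>.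
  These are precisely the data from which \<open>cinv\<close> builds its vector.\<close>

lemma chart_cinv:
  assumes p: "p \<in> cimg"
  shows "cinv p \<in> cdom" "chart (cinv p) = p"
proof -
  have pW: "p \<in> WM" "p \<in> OB B" and pc: "snd p B \<in> pchart E (perp B) cfun"
    using p by (auto simp: cimg_def)
  have top: "p \<in> topspace amb" "fst p \<in> E" using WM_topspace[OF pW(1)] by (auto simp: mem_topspace_amb_iff)
  obtain e1 where e1: "e1 \<in> E - perp B" "snd p B = proj_class (perp B) e1"
    using proj_points_cases[OF subspace_perp] top B unfolding mem_topspace_amb_iff by metis
  have n1: "ct e1 \<noteq> 0"
    using proj_class_mem_pchart_iff[OF subspace_E subspace_perp perp_subset cfun_perp_perp, of e1]
      pc e1 by (simp add: h_cfun)
  define s where "s = csect p"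
  have s_eq: "s = (1 / ct e1) *s oproj h B e1"
    using sect_perp[OF B cfun_mem, of e1] e1 n1 by (simp add: s_def csect_def h_cfun)
  have sB': "s \<in> B" unfolding s_eq by (intro vec.subspace_scale sB oproj_mem)
  have cts: "ct s = 1" using n1 by (simp add: s_eq ct_linear)
  have sperp: "s \<notin> perp B"
    using not_mem_if_nonzero[OF cfun_perp_perp, of s] cts by (simp add: h_cfun)
  have "s \<in> snd p B"
    unfolding e1(2)
  proof (rule mem_proj_class_perp[OF B])
    show "oproj h B s = (1 / ct e1) *s oproj h B e1"
      using oproj_eq[OF sB sB'] s_eq by simp
  qed (use sB' BE e1 in auto)
  note D = WM_OB_D[OF pW B this sperp]
  have "snd p B \<in> proj_points E (perp B)" using top B by (simp add: mem_topspace_amb_iff)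
  then have "snd p B = proj_class (perp B) s"
    using proj_points_eq_proj_class[OF subspace_perp _ \<open>s \<in> snd p B\<close> sperp] by blast
  then obtain c where Qf: "oproj h B (fst p) = c *s s"
    using fst_mem_snd[OF pW(1) B] oproj_proj_class[OF B] oproj_eq[OF sB sB'] by metis
  have "ct (fst p) = c" using ct_oproj[of "fst p"] Qf cts by (simp add: ct_linear)
  then have z: "cinv p = (fst p - c *s s) + (s - e) + c *s e"
    by (simp add: cinv_def Qf s_def)
  have Qe: "oproj h B e = e" "oproj h B s = s" using oproj_eq[OF sB] e sB' by auto
  have Qz: "oproj h B (cinv p) = (s - e) + c *s e"
    unfolding z by (simp add: oproj_add[OF sB] oproj_diff[OF sB] oproj_scale[OF sB] Qe Qf)
  have tz: "ct (cinv p) = c" using ct_oproj[of "cinv p"] unfolding Qz by (simp add: ct_linear cts)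
  have dz: "cdir (cinv p) = s" by (simp add: cdir_def Qz tz)
  have bz: "cbase (cinv p) = fst p" by (simp add: cbase_def Qz tz dz) (simp add: z)
  have "cinv p \<in> E"
    unfolding z using top sB' BE eE by (intro vec.subspace_add vec.subspace_diff vec.subspace_scale subspace_E) auto
  then show "cinv p \<in> cdom" using D by (simp add: cdom_def dz bz)
  show "chart (cinv p) = p" using D by (simp add: chart_def dz bz)
qed

lemma chart_image: "chart ` cdom = cimg"
  using chart_mem chart_cinv by (force intro!: image_eqI[of _ chart "cinv _"])

lemma openin_cimg: "openin (wm h E G) cimg"
  unfolding wm_def cimg_def
  using openin_subtopology_Int2[OF openin_Int[OF openin_OB[OF B] openin_sect_domain[OF B cfun_mem]]] .

lemma subtopology_cimg: "subtopology (wm h E G) cimg = subtopology amb cimg"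
  unfolding wm_def subtopology_subtopology by (rule arg_cong[of _ _ "subtopology amb"]) (auto simp: cimg_def)

lemma homeomorphic_map_chart:
  "homeomorphic_map (top_of_set cdom) (subtopology (wm h E G) cimg) chart"
  unfolding homeomorphic_map_maps subtopology_cimg
proof (intro exI[of _ cinv])
  have top: "topspace (subtopology amb cimg) = cimg" by (auto simp: cimg_def)
  have "continuous_map (top_of_set cdom) amb chart"
    unfolding chart_def
    using continuous_on_cbase continuous_on_cdir
    by (intro continuous_map_pt_generic[OF B]) (auto simp: cdom_def)
  then have 1: "continuous_map (top_of_set cdom) (subtopology amb cimg) chart"
    using chart_mem by (simp add: continuous_map_in_subtopology image_subset_iff)
  have cf: "continuous_map (subtopology amb cimg) euclidean fst"
    by (rule continuous_map_from_subtopology[OF continuous_map_fst_amb])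
  have cs: "continuous_map (subtopology amb cimg) euclidean csect"
  proof -
    have "continuous_map (subtopology (subtopology amb {q \<in> topspace amb. snd q B \<in> pchart E (perp B) cfun}) cimg)
        euclidean csect"
      using continuous_map_from_subtopology[OF continuous_map_sect_amb[OF B cfun_mem]]
      by (simp add: csect_def[abs_def])
    moreover have "{q \<in> topspace amb. snd q B \<in> pchart E (perp B) cfun} \<inter> cimg = cimg"
      by (auto simp: cimg_def)
    ultimately show ?thesis by (simp add: subtopology_subtopology)
  qed
  let ?k = "\<lambda>(x, y). (x - oproj h B x) + (y - e) + ct x *s e"
  have "continuous_on UNIV ?k"
    unfolding case_prod_beta
    by (intro continuous_intros continuous_on_compose2[OF continuous_on_ct[of UNIV]] sB) auto
  then have "continuous_map (prod_topology euclidean euclidean) euclidean ?k"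
    by (simp add: euclidean_product_topology)
  moreover have "continuous_map (subtopology amb cimg) (prod_topology euclidean euclidean) (\<lambda>p. (fst p, csect p))"
    using cf cs unfolding continuous_map_paired by blast
  ultimately have "continuous_map (subtopology amb cimg) euclidean (?k \<circ> (\<lambda>p. (fst p, csect p)))"
    by (rule continuous_map_compose[rotated])
  then have "continuous_map (subtopology amb cimg) euclidean cinv"
    by (simp add: o_def cinv_def[abs_def])
  then have 2: "continuous_map (subtopology amb cimg) (top_of_set cdom) cinv"
    using chart_cinv top by (simp add: continuous_map_in_subtopology image_subset_iff)
  show "homeomorphic_maps (top_of_set cdom) (subtopology amb cimg) chart cinv"
    unfolding homeomorphic_maps_def top using 1 2 cinv_chart chart_cinv by simp
qed

lemma holo_map_chart: "holo_map h E G cdom chart"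
  unfolding holo_map_def
proof (intro conjI ballI)
  show "holo_on cdom (\<lambda>y. fst (chart y))" using holo_on_cbase by (simp add: chart_def)
  fix F z assume F: "F \<in> Irr" and z: "z \<in> cdom"
  have op: "openin (top_of_set cdom) cdom" by simp
  show "\<exists>U s. openin (top_of_set cdom) U \<and> z \<in> U \<and> holo_lift E (perp F) U (\<lambda>y. snd (chart y) F) s"
  proof (cases "F \<subseteq> B")
    case True
    have "holo_lift E (perp F) cdom (\<lambda>y. snd (chart y) F) cdir"
      unfolding holo_lift_def using holo_on_cdir True F dir_generic_not_perp[OF _ F True]
      by (auto simp: chart_def snd_pt cdom_def dir_generic_def)
    then show ?thesis using op z by blast
  next
    case False
    have "holo_lift E (perp F) cdom (\<lambda>y. snd (chart y) F) cbase"
      unfolding holo_lift_def using holo_on_cbase False F base_generic_not_perp[OF B _ F False]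
      by (auto simp: chart_def snd_pt cdom_def base_generic_def)
    then show ?thesis using op z by blast
  qed
qed

text \<open>The coordinate at B shows that the derivative d of \<open>cdir\<close> in direction u
  vanishes. The derivative of the base point then reduces to the component of u in
  \<open>perp B\<close> plus \<open>ct u\<close> times \<open>cdir z\<close>; applying
  \<open>ct\<close> isolates \<open>ct u\<close>, and every component of u is 0.\<close>

lemma immersion_chart:
  assumes z: "z \<in> cdom" and u: "u \<in> E" and k: "killed_direction h E G cdom chart z u"
  shows "u = 0"
proof -
  obtain M where M: "((\<lambda>y. fst (chart y)) has_derivative (*v) M) (at z within cdom)" "M *v u = 0"
    using k unfolding killed_direction_def by blast
  have M': "(cbase has_derivative (*v) M) (at z within cdom)" using M(1) by (simp add: chart_def)
  obtain U s N where U: "openin (top_of_set cdom) U" "z \<in> U"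
    and s: "holo_lift E (perp B) U (\<lambda>y. snd (chart y) B) s"
    and N: "(s has_derivative (*v) N) (at z within U)" "N *v u \<in> snd (chart z) B"
    using k B unfolding killed_direction_def by blast
  have opU: "openin (top_of_set E) U" using openin_trans[OF U(1) openin_cdom] .
  \<comment> \<open>An arbitrary lift is, after projection to B, a scalar function times the
    normalised lift \<open>cdir\<close>. Its derivative stays in the line only if that of
    \<open>cdir\<close> vanishes, because \<open>ct\<close> is constantly 1 on
    \<open>cdir\<close>.\<close>
  have s_eq: "oproj h B (s y) = ct (s y) *s cdir y" if "y \<in> U" for y
  proof -
    have "s y \<in> snd (chart y) B" using s that mem_proj_class by (simp add: holo_lift_def)
    then have "s y \<in> proj_class (perp B) (cdir y)" by (simp add: chart_def snd_pt[OF B])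
    then show ?thesis by (rule oproj_class_cdir)
  qed
  define d where "d = oproj h B u - ct u *s e"
  let ?l = "\<lambda>r::real. z + r *\<^sub>R u"
  note L = has_vector_derivative_line[OF _ opU subspace_E U(2) u]
  have blt: "bounded_linear ct"
    unfolding ct_def divide_inverse by (intro bounded_linear_mult_const bounded_linear_h_left)
  have d1: "((\<lambda>r. oproj h B (s (?l r))) has_vector_derivative oproj h B (N *v u)) (at 0)"
    by (rule bounded_linear.has_vector_derivative[OF bounded_linear_oproj[OF sB] L(1)[OF N(1)]])
  have d2: "((\<lambda>r. ct (s (?l r)) *s cdir (?l r)) has_vector_derivative
      (ct (s (?l 0)) *s d + ct (N *v u) *s cdir (?l 0))) (at 0)"
    unfolding d_def
    by (rule bounded_bilinear.has_vector_derivative[OF bounded_bilinear_vector_scalar_mult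
        bounded_linear.has_vector_derivative[OF blt L(1)[OF N(1)]] L(1)[OF has_derivative_cdir]])
  have "oproj h B (N *v u) = ct (s (?l 0)) *s d + ct (N *v u) *s cdir (?l 0)"
  proof (rule has_vector_derivative_unique_eventually[OF d1 d2])
    show "\<forall>\<^sub>F r in nhds 0. oproj h B (s (?l r)) = ct (s (?l r)) *s cdir (?l r)"
      using L(2)[OF N(1)] by (rule eventually_mono) (rule s_eq)
  qed
  moreover have "oproj h B (N *v u) = ct (N *v u) *s cdir z"
    using N(2) by (intro oproj_class_cdir) (simp add: chart_def snd_pt[OF B])
  ultimately have "ct (s z) *s d = 0" by simp
  moreover have "ct (s z) \<noteq> 0"
  proof
    assume "ct (s z) = 0"
    then have "oproj h B (s z) = 0" using s_eq[OF U(2)] by simp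
    moreover have "s z \<in> E - perp B" using s U(2) by (simp add: holo_lift_def)
    ultimately show False using oproj_eq_0_iff[OF sB] by blast
  qed
  ultimately have d0: "d = 0" by simp
  have "M *v u = (u - oproj h B u) + (ct z *s d + ct u *s cdir z)"
    unfolding d_def
    using vector_derivative_unique_at[OF has_vector_derivative_line(1)[OF M' openin_cdom subspace_E z u]
        has_vector_derivative_line(1)[OF has_derivative_cbase openin_cdom subspace_E z u]] .
  then have *: "(u - oproj h B u) + ct u *s cdir z = 0" using M d0 by simp
  then have "ct ((u - oproj h B u) + ct u *s cdir z) = 0" by (simp add: ct_def)
  then have "ct u = 0" by (simp add: ct_linear)
  then show "u = 0" using * d0 by (simp add: d_def)
qed

lemma adapted_chart_chart: "adapted_chart h E G cdom chart {z \<in> E. h z e = 0}"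
  unfolding adapted_chart_def wm_chart_def
proof (intro conjI ballI impI)
  show "vec.subspace {z \<in> E. h z e = 0}" using subspace_orth[OF subspace_E, of "{e}"] by (simp add: orth_sing)
  show "vec.dim {z \<in> E. h z e = 0} + 1 = vec.dim E" by (rule dim_hyperplane[OF subspace_E eE e(2)])
  fix z assume z: "z \<in> cdom"
  then have zE: "z \<in> E" and g: "base_generic B (cbase z)" "dir_generic B (cdir z)" by (auto simp: cdom_def)
  have "fst (chart z) \<in> X \<longleftrightarrow> ct z \<noteq> 0"
  proof
    assume "ct z \<noteq> 0"
    then show "fst (chart z) \<in> X"
      using pt_eq_embed(1)[OF B g cbase_minus[OF zE]] by (simp add: chart_def)
  next
    assume "fst (chart z) \<in> X"
    then have "cbase z \<notin> perp B" using X_not_perp[OF _ B] by (simp add: chart_def)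
    then show "ct z \<noteq> 0" using cbase_minus[OF zE] by auto
  qed
  then show "chart z \<in> bd \<longleftrightarrow> z \<in> {z \<in> E. h z e = 0}"
    using chart_WM[OF z] hee zE by (simp add: mem_bd_iff ct_def)
qed (use openin_cdom openin_cimg homeomorphic_map_chart chart_image holo_map_chart immersion_chart in auto)

text \<open>On the line through y in direction e the chart leaves the base point unchanged, so a
  round disc in this direction projects to the same round disc in E.\<close>

lemma chart_at_base:
  assumes y: "y \<in> perp B"
  shows "chart (y + \<zeta> *s e) = pt B (y + \<zeta> *s e) e"
proof -
  have "h y e = 0" using y e by (simp add: orth_def)
  then have "ct y = 0" by (simp add: ct_def)
  then have t: "ct (y + \<zeta> *s e) = \<zeta>" by (simp add: ct_linear)
  have "oproj h B y = 0" using oproj_eq_0_iff[OF sB] y perp_subset by blast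
  then have Q: "oproj h B (y + \<zeta> *s e) = \<zeta> *s e" by (simp add: linear_oproj_add oproj_eq[OF sB e(1)])
  have "cdir (y + \<zeta> *s e) = e" by (simp add: cdir_def t Q)
  then show ?thesis by (simp add: chart_def cbase_def t Q)
qed

lemma base_mem_cdom:
  assumes y: "y \<in> perp B" "base_generic B y" and dg: "dir_generic B e"
  shows "y \<in> cdom"
proof -
  have "h y e = 0" using y e by (simp add: orth_def)
  then have t: "ct y = 0" by (simp add: ct_def)
  have Q: "oproj h B y = 0" using oproj_eq_0_iff[OF sB] y perp_subset by blast
  show ?thesis using y dg by (simp add: cdom_def cdir_def cbase_def t Q base_generic_def)
qed

end

end

section \<open>The components of the boundary\<close>

lemma norm_vector_scalar_mult: "norm (c *s x) = cmod c * norm (x :: complex ^ 'n::finite)"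
proof -
  have "(\<Sum>i\<in>UNIV. (norm ((c *s x) $ i))\<^sup>2) = (cmod c)\<^sup>2 * (\<Sum>i\<in>UNIV. (norm (x $ i))\<^sup>2)"
    by (simp add: norm_mult power_mult_distrib sum_distrib_left)
  then show ?thesis by (simp add: norm_vec_def L2_set_def real_sqrt_mult)
qed

context arrangement
begin

abbreviation "reg \<equiv> boundary_regular h E G"

lemma adapted_chartD:
  assumes "adapted_chart h E G \<Omega> \<phi> K"
  shows "openin (top_of_set E) \<Omega>" "openin (wm h E G) (\<phi> ` \<Omega>)"
    "homeomorphic_map (top_of_set \<Omega>) (subtopology (wm h E G) (\<phi> ` \<Omega>)) \<phi>"
    "holo_map h E G \<Omega> \<phi>" "vec.subspace K" "K \<subseteq> E" "vec.dim K + 1 = vec.dim E"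
    "\<And>z. z \<in> \<Omega> \<Longrightarrow> \<phi> z \<in> bd \<longleftrightarrow> z \<in> K"
    "\<And>z u. z \<in> \<Omega> \<Longrightarrow> u \<in> E \<Longrightarrow> killed_direction h E G \<Omega> \<phi> z u \<Longrightarrow> u = 0"
    "\<Omega> \<subseteq> E" "\<And>z. z \<in> \<Omega> \<Longrightarrow> \<phi> z \<in> WM"
proof -
  show op: "openin (top_of_set E) \<Omega>" "openin (wm h E G) (\<phi> ` \<Omega>)"
    "homeomorphic_map (top_of_set \<Omega>) (subtopology (wm h E G) (\<phi> ` \<Omega>)) \<phi>"
    "holo_map h E G \<Omega> \<phi>" "vec.subspace K" "K \<subseteq> E" "vec.dim K + 1 = vec.dim E"
    "\<And>z. z \<in> \<Omega> \<Longrightarrow> \<phi> z \<in> bd \<longleftrightarrow> z \<in> K"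
    "\<And>z u. z \<in> \<Omega> \<Longrightarrow> u \<in> E \<Longrightarrow> killed_direction h E G \<Omega> \<phi> z u \<Longrightarrow> u = 0"
    using assms unfolding adapted_chart_def wm_chart_def by blast+
  show "\<Omega> \<subseteq> E" using openin_imp_subset[OF op(1)] .
  show "\<And>z. z \<in> \<Omega> \<Longrightarrow> \<phi> z \<in> WM" using openin_subset[OF op(2)] by (auto simp: wm_def)
qed

lemma reg_subset_bd: "reg \<subseteq> bd"
  unfolding boundary_regular_def using adapted_chartD(8) by auto

lemma bd_subset_WM: "bd \<subseteq> WM"
  by (auto simp: mem_bd_iff)

lemma closedin_WM: "closedin amb WM"
  by (simp add: wm_set_def)

lemma closure_of_wm:
  assumes "S \<subseteq> WM"
  shows "wm h E G closure_of S = amb closure_of S"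
proof -
  have "amb closure_of S \<subseteq> WM" using closure_of_minimal[OF assms closedin_WM] .
  then show ?thesis unfolding wm_def closure_of_subtopology using assms by (simp add: inf_absorb2)
qed

lemma D0_subset_bd: "B \<in> Irr \<Longrightarrow> D0 B \<subseteq> bd"
  using D0_eq by blast

lemma D0_dir_in:
  assumes B: "B \<in> Irr" and p: "p \<in> D0 B"
  obtains y e where "y \<in> perp B" "base_generic B y" "dir_generic B e" "e \<in> B" "e \<noteq> 0" "p = pt B y e"
proof -
  obtain y e where p': "p = pt B y e" "y \<in> perp B" "base_generic B y" "dir_generic B e"
    using p by (auto simp: D0_def)
  define e' where "e' = oproj h B e"
  have eE: "e \<in> E" using p' by (simp add: dir_generic_def)
  have d: "e - e' \<in> perp B"
    unfolding e'_def by (rule diff_oproj_mem_orth[OF subspace_E Irr_subspace[OF B] Irr_subset[OF B] eE])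
  have e'B: "e' \<in> B" unfolding e'_def by (rule oproj_mem[OF Irr_subspace[OF B]])
  have "e \<notin> perp B" using dir_generic_not_perp[OF p'(4) B] by simp
  then have "e' \<noteq> 0" using d by auto
  have "dir_generic B e'"
    unfolding dir_generic_def
  proof (intro conjI ballI impI notI)
    show "e' \<in> E" using e'B Irr_subset[OF B] by blast
    fix H assume H: "H \<in> Hs" "perp B \<subseteq> H" "e' \<in> H"
    then have "(e - e') + e' \<in> H" using d hyp_subspace by (intro vec.subspace_add) auto
    then show False using p' H by (simp add: dir_generic_def)
  qed
  moreover have "pt B y e = pt B y e'"
  proof -
    have "proj_class (perp F) e = proj_class (perp F) e'" if "F \<subseteq> B" for F
      using d orth_antimono[OF that] by (intro proj_class_cong[OF subspace_perp, of _ 1]) auto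
    then show ?thesis unfolding pt_def by (intro arg_cong[where f = "Pair y"] restrict_ext) simp
  qed
  ultimately show ?thesis using that p' e'B \<open>e' \<noteq> 0\<close> by simp
qed

lemma D0_subset_reg:
  assumes B: "B \<in> Irr"
  shows "D0 B \<subseteq> reg"
proof
  fix p assume "p \<in> D0 B"
  then obtain y e where y: "y \<in> perp B" "base_generic B y" and e: "dir_generic B e" "e \<in> B" "e \<noteq> 0"
    and p: "p = pt B y e" using D0_dir_in[OF B] by metis
  have "y + 0 *s e = y" by simp
  then have "chart B e y = p" using chart_at_base[OF B e(2,3) y(1), of 0] p by simp
  moreover have "y \<in> cdom B e \<inter> {z \<in> E. h z e = 0}"
    using base_mem_cdom[OF B e(2,3) y e(1)] y e perp_subset by (auto simp: orth_def)
  ultimately show "p \<in> reg"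
    unfolding boundary_regular_def using adapted_chart_chart[OF B e(2,3)] by blast
qed

section \<open>Closures of the generic strata inside an adapted chart\<close>

lemma chart_openin_image:
  assumes c: "adapted_chart h E G \<Omega> \<phi> K" and U: "openin (top_of_set \<Omega>) U"
  obtains V where "openin amb V" "\<phi> ` U = V \<inter> WM"
proof -
  note D = adapted_chartD[OF c]
  have "openin (subtopology (wm h E G) (\<phi> ` \<Omega>)) (\<phi> ` U)"
    using D(3) U unfolding homeomorphic_eq_everything_map open_map_def by blast
  then have "openin (wm h E G) (\<phi> ` U)" using openin_trans_full[OF _ D(2)] by blast
  then show ?thesis using that unfolding wm_def openin_subtopology by blast
qed

text \<open>The image of U is open in the model and so meets \<open>D0 B\<close>; the points found
  are boundary points, and the chart places these in K.\<close>

lemma chart_reflects_closure: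
  assumes c: "adapted_chart h E G \<Omega> \<phi> K" and U: "openin (top_of_set \<Omega>) U" "z \<in> U"
    and B: "B \<in> Irr" and z: "\<phi> z \<in> amb closure_of D0 B"
  shows "\<exists>w\<in>U \<inter> K. \<phi> w \<in> D0 B"
proof -
  obtain V where V: "openin amb V" "\<phi> ` U = V \<inter> WM" using chart_openin_image[OF c U(1)] .
  have "\<phi> z \<in> V" using V U by blast
  then obtain q where q: "q \<in> D0 B" "q \<in> V" using z V(1) unfolding in_closure_of by blast
  then have qb: "q \<in> bd" using D0_subset_bd[OF B] by blast
  then obtain w where w: "w \<in> U" "q = \<phi> w" using V(2) q bd_subset_WM by blast
  then have "w \<in> K" using adapted_chartD(8)[OF c, of w] qb openin_imp_subset[OF U(1)] by blast
  then show ?thesis using w q by blast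
qed

lemma fst_chart_derivative:
  assumes c: "adapted_chart h E G \<Omega> \<phi> K" and z: "z \<in> \<Omega>"
  obtains M where "((\<lambda>y. fst (\<phi> y)) has_derivative (*v) M) (at z within \<Omega>)"
  using adapted_chartD(4)[OF c] z unfolding holo_map_def holo_on_def by blast

lemma continuous_on_fst_chart:
  assumes c: "adapted_chart h E G \<Omega> \<phi> K"
  shows "continuous_on \<Omega> (\<lambda>y. fst (\<phi> y))"
  using adapted_chartD(4)[OF c] unfolding holo_map_def by (intro holo_on_imp_continuous_on) blast

lemma openin_chart_OB:
  assumes c: "adapted_chart h E G \<Omega> \<phi> K" and B: "B \<in> Irr"
  shows "openin (top_of_set \<Omega>) {z \<in> \<Omega>. \<phi> z \<in> OB B}"
proof -
  have "continuous_map (top_of_set \<Omega>) (subtopology (wm h E G) (\<phi> ` \<Omega>)) \<phi>"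
    using adapted_chartD(3)[OF c] by (rule homeomorphic_imp_continuous_map)
  then have "continuous_map (top_of_set \<Omega>) amb \<phi>"
    by (simp add: wm_def continuous_map_in_subtopology)
  from openin_continuous_map_preimage[OF this openin_OB[OF B]] show ?thesis by simp
qed

text \<open>Identity theorem along the complex lines in the linear boundary \<open>K\<close>.\<close>

lemma fst_chart_in_perp:
  assumes c: "adapted_chart h E G \<Omega> \<phi> K" and W: "E \<inter> ball z0 \<delta> \<subseteq> \<Omega>"
    and B: "B \<in> Irr" and z1: "z1 \<in> K \<inter> ball z0 \<delta>" "\<phi> z1 \<in> D0 B" and z2: "z2 \<in> K \<inter> ball z0 \<delta>"
  shows "fst (\<phi> z2) \<in> perp B"
proof -
  note D = adapted_chartD[OF c]
  let ?f = "\<lambda>y. fst (\<phi> y)" and ?l = "\<lambda>\<zeta>. z1 + \<zeta> *s (z2 - z1)"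
  define S where "S = ?l -` ball z0 \<delta>"
  have lK: "?l \<zeta> \<in> K" for \<zeta>
    using z1 z2 D(5) by (auto intro!: vec.subspace_add vec.subspace_scale vec.subspace_diff)
  have l\<Omega>: "?l \<zeta> \<in> \<Omega>" if "\<zeta> \<in> S" for \<zeta>
  proof -
    have "?l \<zeta> \<in> E \<inter> ball z0 \<delta>" using lK D(6) that unfolding S_def by blast
    then show ?thesis using W by blast
  qed
  have opS: "open S" unfolding S_def by (intro open_vimage continuous_intros open_ball)
  have l0: "?l 0 = z1" and l1: "?l 1 = z2" by simp_all
  have convS: "convex S"
    unfolding convex_alt
  proof (intro ballI allI impI)
    fix x y :: complex and t :: real assume xy: "x \<in> S" "y \<in> S" and t: "0 \<le> t \<and> t \<le> 1"
    have "?l ((1 - t) *\<^sub>R x + t *\<^sub>R y) = (1 - t) *\<^sub>R ?l x + t *\<^sub>R ?l y"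
      unfolding scaleR_vec_complex scaleR_conv_of_real by (simp add: vec_eq_iff algebra_simps)
    moreover have "(1 - t) *\<^sub>R ?l x + t *\<^sub>R ?l y \<in> ball z0 \<delta>"
      using convex_ball[of z0 \<delta>] xy t unfolding convex_alt S_def by blast
    ultimately show "(1 - t) *\<^sub>R x + t *\<^sub>R y \<in> S" by (simp add: S_def)
  qed
  have "z1 \<in> \<Omega>" using l\<Omega>[of 0] z1 l0 by (simp add: S_def)
  obtain T where T: "open T" "{z \<in> \<Omega>. \<phi> z \<in> OB B} = \<Omega> \<inter> T"
    using openin_chart_OB[OF c B] unfolding openin_open by blast
  have z1T: "z1 \<in> T" using T(2) z1 D0_subset_OB[OF B] \<open>z1 \<in> \<Omega>\<close> by blast
  \<comment> \<open>Near \<open>z1\<close> the chart stays in \<open>OB B\<close>, where the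
    boundary consists of \<open>D0 B\<close> alone. This is the open set from which the identity
    theorem propagates.\<close>
  have zero: "?f (?l \<zeta>) \<in> perp B" if "\<zeta> \<in> S \<inter> ?l -` T" for \<zeta>
  proof -
    have "\<phi> (?l \<zeta>) \<in> OB B" using l\<Omega> T(2) that by blast
    moreover have "\<phi> (?l \<zeta>) \<in> bd" using D(8) l\<Omega> lK that by blast
    ultimately have "\<phi> (?l \<zeta>) \<in> D0 B" using D0_eq[OF B] by blast
    then show ?thesis by (auto simp: D0_def)
  qed
  have fE: "?f z2 \<in> E" 
    using l\<Omega>[of 1] l1 z2 D(11) WM_topspace by (auto simp: S_def mem_topspace_amb_iff)
  \<comment> \<open>Each linear equation of \<open>perp B\<close> is treated separately: h is
    complex linear in its left slot, so the pairing with b along the line is a holomorphic function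
    of one variable.\<close>
  have "h (?f z2) b = 0" if b: "b \<in> B" for b
  proof -
    let ?g = "\<lambda>\<zeta>. h (?f (?l \<zeta>)) b"
    have hol: "?g holomorphic_on S"
    proof (rule holomorphic_onI)
      fix \<zeta> assume \<zeta>: "\<zeta> \<in> S"
      obtain M where M: "(?f has_derivative (*v) M) (at (?l \<zeta>) within \<Omega>)"
        using fst_chart_derivative[OF c l\<Omega>[OF \<zeta>]] .
      have sub: "?l ` S \<subseteq> \<Omega>" using l\<Omega> by blast
      have "(?l has_derivative (\<lambda>\<eta>. 0 + \<eta> *s (z2 - z1))) (at \<zeta> within S)"
        by (intro has_derivative_add has_derivative_const bounded_linear_imp_has_derivative
            bounded_bilinear.bounded_linear_left[OF bounded_bilinear_vector_scalar_mult])
      then have dl: "(?l has_derivative (\<lambda>\<eta>. \<eta> *s (z2 - z1))) (at \<zeta> within S)" by (simp only: add_0)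
      from has_derivative_in_compose[OF dl has_derivative_subset[OF M sub]]
      have "((\<lambda>\<zeta>. ?f (?l \<zeta>)) has_derivative (\<lambda>\<eta>. M *v (\<eta> *s (z2 - z1)))) (at \<zeta> within S)" .
      from bounded_linear.has_derivative[OF bounded_linear_h_left this, of b]
      have "(?g has_derivative (\<lambda>\<eta>. h (M *v (\<eta> *s (z2 - z1))) b)) (at \<zeta> within S)" .
      moreover have "(\<lambda>\<eta>. h (M *v (\<eta> *s (z2 - z1))) b) = (*) (h (M *v (z2 - z1)) b)"
        by (rule ext) (simp only: vec.scale scale_left mult.commute)
      ultimately have "(?g has_field_derivative h (M *v (z2 - z1)) b) (at \<zeta> within S)"
        by (simp add: has_field_derivative_def)
      then show "?g field_differentiable at \<zeta> within S"
        unfolding field_differentiable_def by blast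
    qed
    have "?g 1 = 0"
    proof (rule analytic_continuation_open[where s = "S \<inter> ?l -` T" and s' = S
          and f = ?g and g = "\<lambda>_. 0" and z = 1])
      show "open (S \<inter> ?l -` T)" by (intro open_Int opS open_vimage T continuous_intros)
      have "0 \<in> S \<inter> ?l -` T" using z1 z1T l0 unfolding S_def by auto
      then show "S \<inter> ?l -` T \<noteq> {}" by blast
      show "1 \<in> S" using z2 l1 by (simp add: S_def)
      show "?g \<zeta> = 0" if "\<zeta> \<in> S \<inter> ?l -` T" for \<zeta> using zero[OF that] b by (simp add: orth_def)
    qed (use opS convS hol convex_connected in auto)
    then show ?thesis using l1 by simp
  qed
  then show ?thesis using fE by (simp add: orth_def)
qed

lemma chart_ball:
  assumes c: "adapted_chart h E G \<Omega> \<phi> K" and z: "z \<in> \<Omega>"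
  obtains \<delta> where "0 < \<delta>" "E \<inter> ball z \<delta> \<subseteq> \<Omega>" "openin (top_of_set \<Omega>) (E \<inter> ball z \<delta>)"
    "z \<in> E \<inter> ball z \<delta>"
proof -
  note D = adapted_chartD[OF c]
  obtain T where T: "open T" "\<Omega> = E \<inter> T" using D(1) unfolding openin_open by blast
  then obtain \<delta> where "0 < \<delta>" "ball z \<delta> \<subseteq> T" using z openE by (metis IntE)
  moreover have "openin (top_of_set \<Omega>) (\<Omega> \<inter> ball z \<delta>)" by (rule openin_open_Int) simp
  moreover have "\<Omega> \<inter> ball z \<delta> = E \<inter> ball z \<delta>" using \<open>ball z \<delta> \<subseteq> T\<close> T by blast
  moreover have "z \<in> E \<inter> ball z \<delta>" using z D(10) \<open>0 < \<delta>\<close> by auto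
  ultimately show ?thesis using that T by auto
qed

text \<open>By the identity theorem the whole piece of the boundary near p projects into
  \<open>perp B\<close>. That piece contains a point of \<open>D0 B'\<close>, whose base point can
  be moved slightly in any direction d of \<open>perp B'\<close>; hence d lies in
  \<open>perp B\<close>.\<close>

lemma closures_perp_subset:
  assumes p: "p \<in> reg" and B: "B \<in> Irr" "p \<in> amb closure_of D0 B" and B': "B' \<in> Irr" "p \<in> amb closure_of D0 B'"
  shows "perp B' \<subseteq> perp B"
proof
  fix d assume d: "d \<in> perp B'"
  obtain \<Omega> \<phi> K z where c: "adapted_chart h E G \<Omega> \<phi> K" and z: "z \<in> \<Omega> \<inter> K" "p = \<phi> z"
    using p unfolding boundary_regular_def by blast
  note D = adapted_chartD[OF c]
  obtain \<delta> where \<delta>: "E \<inter> ball z \<delta> \<subseteq> \<Omega>" "openin (top_of_set \<Omega>) (E \<inter> ball z \<delta>)" "z \<in> E \<inter> ball z \<delta>"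
    using chart_ball[OF c] z by blast
  obtain z1 where z1: "z1 \<in> (E \<inter> ball z \<delta>) \<inter> K" "\<phi> z1 \<in> D0 B"
    using chart_reflects_closure[OF c \<delta>(2,3) B(1)] B(2) z(2) by auto
  obtain z2 where z2: "z2 \<in> (E \<inter> ball z \<delta>) \<inter> K" "\<phi> z2 \<in> D0 B'"
    using chart_reflects_closure[OF c \<delta>(2,3) B'(1)] B'(2) z(2) by auto
  have in_perp: "fst (\<phi> w) \<in> perp B" if "w \<in> (E \<inter> ball z \<delta>) \<inter> K" for w
    using fst_chart_in_perp[OF c \<delta>(1) B(1), of z1 w] z1 that by blast
  obtain y e where ye: "\<phi> z2 = pt B' y e" "y \<in> perp B'" "base_generic B' y" "dir_generic B' e"
    using z2(2) by (auto simp: D0_def)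
  have yB: "y \<in> perp B" using in_perp[OF z2(1)] ye by simp
  obtain V where V: "openin amb V" "\<phi> ` (E \<inter> ball z \<delta>) = V \<inter> WM"
    using chart_openin_image[OF c \<delta>(2)] .
  \<comment> \<open>Moving the base point along d with fixed direction e remains in
    \<open>D0 B'\<close> while generic, and for small s inside the image of the ball. A single
    nonzero s suffices.\<close>
  let ?f = "\<lambda>s::real. y + of_real s *s d"
  let ?S = "{s. base_generic B' (?f s)}"
  have "open ?S" using open_base_generic_line ye(2) d perp_subset by blast
  have cf: "continuous_map (top_of_set ?S) amb (\<lambda>s. pt B' (?f s) e)"
    by (rule continuous_map_pt_generic[OF B'(1)]) (auto simp: ye(4) intro!: continuous_intros)
  have "openin (top_of_set ?S) {s \<in> topspace (top_of_set ?S). pt B' (?f s) e \<in> V}"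
    by (rule openin_continuous_map_preimage[OF cf V(1)])
  then have op: "open {s \<in> ?S. pt B' (?f s) e \<in> V}"
    using \<open>open ?S\<close> by (simp add: openin_open_eq)
  have "\<phi> z2 \<in> V" using V(2) z2(1) by blast
  then have "pt B' (?f 0) e \<in> V" using ye(1) by simp
  then have "0 \<in> {s \<in> ?S. pt B' (?f s) e \<in> V}" using ye by simp
  then have "{s \<in> ?S. pt B' (?f s) e \<in> V} \<noteq> {}" by blast
  from open_minus_countable[OF _ this op, of "{0}"]
  have "\<exists>s\<in>{s \<in> ?S. pt B' (?f s) e \<in> V}. s \<notin> {0}" by simp
  then obtain s where s: "base_generic B' (?f s)" "pt B' (?f s) e \<in> V" "s \<noteq> 0"
    by blast
  have "?f s \<in> perp B'" using ye(2) d by (intro vec.subspace_add vec.subspace_scale subspace_perp)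
  then have "pt B' (?f s) e \<in> D0 B'" unfolding D0_def using s(1) ye(4) by blast
  then have qb: "pt B' (?f s) e \<in> bd" using D0_subset_bd[OF B'(1)] by blast
  then obtain w where w: "w \<in> E \<inter> ball z \<delta>" "pt B' (?f s) e = \<phi> w"
    using V(2) s(2) bd_subset_WM by blast
  then have "w \<in> K" using D(8)[of w] qb \<delta>(1) by auto
  then have "?f s \<in> perp B" using in_perp[of w] w by (metis IntI fst_pt)
  then have "?f s - y \<in> perp B" using yB by (rule vec.subspace_diff[OF subspace_perp])
  then have "of_real s *s d \<in> perp B" by simp
  then have "(1 / of_real s) *s (of_real s *s d) \<in> perp B" by (rule vec.subspace_scale[OF subspace_perp])
  then show "d \<in> perp B" using s(3) by simp
qed

lemma closures_disjoint:
  assumes "p \<in> reg" "B \<in> Irr" "p \<in> amb closure_of D0 B" "B' \<in> Irr" "p \<in> amb closure_of D0 B'"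
  shows "B = B'"
  using closures_perp_subset[OF assms] closures_perp_subset[OF assms(1,4,5,2,3)] perp_perp Irr_line_sums assms
  by (metis subset_antisym)

text \<open>The component C is covered by finitely many closed sets, the closures of the strata, and
  these are pairwise disjoint at regular points. Connectedness confines C to one of them, and
  conversely the connected set \<open>D0 B\<close> is regular and attached to C at p.\<close>

lemma closure_component:
  assumes C: "C \<in> connected_components_of (subtopology (wm h E G) reg)"
    and p: "p \<in> C" and B: "B \<in> Irr" "p \<in> amb closure_of D0 B"
  shows "wm h E G closure_of C = amb closure_of D0 B"
proof -
  have cC: "connectedin (subtopology (wm h E G) reg) C" by (rule connectedin_connected_components_of[OF C])
  then have C_reg: "C \<subseteq> reg" and "connectedin (wm h E G) C"
    by (auto simp: connectedin_subtopology)
  then have conn: "connectedin amb C" by (simp add: wm_def connectedin_subtopology)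
  have C_WM: "C \<subseteq> WM" using C_reg reg_subset_bd bd_subset_WM by blast
  define T where "T = (\<Union>B'\<in>Irr - {B}. amb closure_of D0 B')"
  have "closedin amb T" unfolding T_def using finite_Irr by (intro closedin_Union) auto
  moreover have "C \<subseteq> amb closure_of D0 B \<union> T"
    using C_reg reg_subset_bd boundary_in_closure_D0 unfolding T_def by blast
  moreover have "amb closure_of D0 B \<inter> T \<inter> C = {}"
    using closures_disjoint[OF _ B(1)] C_reg unfolding T_def by blast
  ultimately have "T \<inter> C = {}"
    using conn p B(2) unfolding connectedin_closedin by (metis IntI closedin_closure_of empty_iff)
  then have 1: "C \<subseteq> amb closure_of D0 B" using \<open>C \<subseteq> _ \<union> T\<close> by blast
  \<comment> \<open>The point p need not lie in \<open>D0 B\<close>. Adding a point of the closure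
    preserves connectedness and yields a set that meets C.\<close>
  have "connectedin amb (insert p (D0 B))"
  proof (rule connectedin_intermediate_closure_of[OF connectedin_D0[OF B(1)]])
    have "D0 B \<subseteq> amb closure_of D0 B"
      using D0_subset_bd[OF B(1)] bd_subset_WM WM_topspace by (intro closure_of_subset) blast
    then show "insert p (D0 B) \<subseteq> amb closure_of D0 B" using B by blast
  qed auto
  moreover have "insert p (D0 B) \<subseteq> reg" using D0_subset_reg[OF B(1)] p C_reg by blast
  ultimately have "connectedin (subtopology (wm h E G) reg) (insert p (D0 B))"
    using reg_subset_bd bd_subset_WM unfolding wm_def connectedin_subtopology by blast
  then have "insert p (D0 B) \<subseteq> C"
    using connected_components_of_maximal[OF C] p by (auto simp: disjnt_def)
  then have 2: "D0 B \<subseteq> C" by blast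
  have "amb closure_of C = amb closure_of D0 B"
    using closure_of_mono[OF 2, of amb] closure_of_minimal[OF 1 closedin_closure_of] by blast
  then show ?thesis using closure_of_wm[OF C_WM] by simp
qed

text \<open>Every boundary component is the closure of some \<open>D0 B'\<close>, and its projection
  \<open>perp B'\<close> determines B'. So the definite description has exactly one
  candidate.\<close>

lemma wm_divisor_eq:
  assumes B: "B \<in> Irr" "D0 B \<noteq> {}"
  shows "wm_divisor h E G B = amb closure_of D0 B"
  unfolding wm_divisor_def
proof (rule the_equality)
  let ?T = "subtopology (wm h E G) reg"
  have reg_top: "reg \<subseteq> topspace (wm h E G)"
    using reg_subset_bd bd_subset_WM WM_topspace by (auto simp: wm_def)
  obtain p where p: "p \<in> D0 B" using B(2) by blast
  then have pr: "p \<in> reg" using D0_subset_reg[OF B(1)] by blast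
  then have "p \<in> topspace ?T" using reg_top by auto
  then obtain C where C: "C \<in> connected_components_of ?T" "p \<in> C"
    using Union_connected_components_of[of ?T] by blast
  have "p \<in> amb closure_of D0 B"
    using p D0_subset_bd[OF B(1)] bd_subset_WM WM_topspace closure_of_subset[of "D0 B" amb] by blast
  then have "amb closure_of D0 B \<in> boundary_components h E G"
    using closure_component[OF C B(1)] C(1) unfolding boundary_components_def by blast
  then show "amb closure_of D0 B \<in> boundary_components h E G \<and> fst ` (amb closure_of D0 B) = perp B"
    using fst_closure_D0[OF B] by simp
  fix D assume D: "D \<in> boundary_components h E G \<and> fst ` D = perp B"
  then obtain C' where C': "C' \<in> connected_components_of ?T" "D = wm h E G closure_of C'"
    unfolding boundary_components_def by blast
  obtain q where q: "q \<in> C'" using nonempty_connected_components_of[OF C'(1)] by blast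
  then have "q \<in> bd" using connectedin_connected_components_of[OF C'(1)] reg_subset_bd
    by (auto simp: connectedin_subtopology)
  then obtain B' where B': "B' \<in> Irr" "q \<in> amb closure_of D0 B'" using boundary_in_closure_D0 by blast
  have D_eq: "D = amb closure_of D0 B'" using closure_component[OF C'(1) q B'] C'(2) by simp
  have "D0 B' \<noteq> {}" using B'(2) by auto
  then have "perp B' = perp B" using fst_closure_D0[OF B'(1)] D D_eq by simp
  then have "B' = B" using perp_perp Irr_line_sums B B' by metis
  then show "D = amb closure_of D0 B" using D_eq by simp
qed

section \<open>Meridians\<close>

lemma mem_D0: "y \<in> perp B \<Longrightarrow> base_generic B y \<Longrightarrow> dir_generic B e \<Longrightarrow> pt B y e \<in> D0 B"
  unfolding D0_def by blast

text \<open>In the chart at direction e the disc around y projects to itself, so the meridian is a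
  round circle. The only bound on the radius is that the closed disc fits into the chart
  domain.\<close>

lemma explicit_meridian:
  assumes B: "B \<in> Irr" and y: "y \<in> perp B" "base_generic B y" and e: "dir_generic B e" "e \<in> B"
  obtains \<epsilon>0 where "0 < \<epsilon>0"
    "\<And>\<epsilon>. 0 < \<epsilon> \<Longrightarrow> \<epsilon> \<le> \<epsilon>0 \<Longrightarrow>
      (\<lambda>t. y + (of_real \<epsilon> * exp (2 * of_real pi * \<i> * of_real t)) *s e) \<in> meridians h E G B"
proof -
  have e0: "e \<noteq> 0" using dir_generic_not_perp[OF e(1) B] vec.subspace_0[OF subspace_perp] by auto
  let ?\<Omega> = "cdom B e" and ?\<phi> = "chart B e" and ?K = "{z \<in> E. h z e = 0}"
  have c: "adapted_chart h E G ?\<Omega> ?\<phi> ?K" by (rule adapted_chart_chart[OF B e(2) e0])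
  have y\<Omega>: "y \<in> ?\<Omega>" by (rule base_mem_cdom[OF B e(2) e0 y e(1)])
  have yK: "y \<in> ?K" using y e perp_subset by (auto simp: orth_def)
  have eE: "e \<in> E" using e Irr_subset[OF B] by blast
  obtain T where T: "open T" "?\<Omega> = E \<inter> T" using adapted_chartD(1)[OF c] unfolding openin_open by blast
  have "open ((\<lambda>\<zeta>. y + \<zeta> *s e) -` T)" by (intro open_vimage T continuous_intros)
  moreover have "0 \<in> (\<lambda>\<zeta>. y + \<zeta> *s e) -` T" using y\<Omega> T by simp
  ultimately obtain \<epsilon>0 where \<epsilon>0: "0 < \<epsilon>0" "cball 0 \<epsilon>0 \<subseteq> (\<lambda>\<zeta>. y + \<zeta> *s e) -` T"
    using open_contains_cball by metis
  have disc: "y + \<zeta> *s e \<in> ?\<Omega>" if "cmod \<zeta> \<le> \<epsilon>0" for \<zeta>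
  proof -
    have "\<zeta> \<in> cball 0 \<epsilon>0" using that by simp
    then have "y + \<zeta> *s e \<in> T" using \<epsilon>0(2) by blast
    moreover have "y + \<zeta> *s e \<in> E" using yK eE by (intro vec.subspace_add vec.subspace_scale subspace_E) auto
    ultimately show ?thesis using T by blast
  qed
  have "?\<phi> y = pt B y e" using chart_at_base[OF B e(2) e0 y(1), of 0] by simp
  then have pD: "?\<phi> y \<in> D0 B" using mem_D0[OF y e(1)] by simp
  then have "?\<phi> y \<in> wm_divisor h E G B"
    using wm_divisor_eq[OF B] closure_of_subset[of "D0 B" amb] D0_subset_bd[OF B] bd_subset_WM WM_topspace
    by blast
  moreover have "fst (?\<phi> (y + \<zeta> *s e)) = y + \<zeta> *s e" for \<zeta>
    using chart_at_base[OF B e(2) e0 y(1)] by simp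
  ultimately have "(\<lambda>t. y + (of_real \<epsilon> * exp (2 * of_real pi * \<i> * of_real t)) *s e) \<in> meridians h E G B"
    if "0 < \<epsilon>" "\<epsilon> \<le> \<epsilon>0" for \<epsilon>
    unfolding meridians_def
    using c y\<Omega> yK eE e0 disc that
    by (intro CollectI exI[of _ ?\<Omega>] exI[of _ ?\<phi>] exI[of _ ?K] exI[of _ y] exI[of _ e] exI[of _ \<epsilon>]) auto
  then show ?thesis using that \<epsilon>0(1) by blast
qed

end

section \<open>Fundamental groups\<close>

text \<open>In the convex unit square the left side can be deformed with fixed endpoints to the path
  along the other three sides. This one fact serves both for changing the base point along a
  homotopy and for commutation on a torus.\<close>

lemma homotopic_paths_square:
  fixes k :: "real \<times> real \<Rightarrow> 'a::topological_space"
  assumes k: "continuous_on ({0..1} \<times> {0..1}) k" "k ` ({0..1} \<times> {0..1}) \<subseteq> X"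
  shows "homotopic_paths X (\<lambda>t. k (0, t))
    ((\<lambda>s. k (s, 0)) +++ (\<lambda>t. k (1, t)) +++ reversepath (\<lambda>s. k (s, 1)))"
proof -
  let ?Q = "{0..1::real} \<times> {0..1::real}"
  let ?p = "\<lambda>t::real. (0::real, t)"
  let ?q = "(\<lambda>s::real. (s, 0::real)) +++ (\<lambda>t. (1, t)) +++ reversepath (\<lambda>s. (s, 1))"
  have pp: "path ?p" and p1: "path (\<lambda>s::real. (s, 0::real))" and p2: "path (\<lambda>t::real. (1::real, t))"
    and p3: "path (\<lambda>s::real. (s, 1::real))"
    unfolding path_def by (intro continuous_intros)+
  have ends: "pathfinish (\<lambda>s::real. (s, 0::real)) = (1, 0)" "pathstart (\<lambda>t::real. (1::real, t)) = (1, 0)"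
    "pathfinish (\<lambda>t::real. (1::real, t)) = (1, 1)" "pathfinish (\<lambda>s::real. (s, 1::real)) = (1, 1)"
    by (simp_all add: pathstart_def pathfinish_def)
  have pq: "path ?q" using p1 p2 p3 ends by (intro path_join_imp) simp_all
  have im: "path_image ?q \<subseteq> ?Q"
    using p1 p2 p3
    by (intro subset_path_image_join) (auto simp: path_image_def reversepath_def)
  have "homotopic_paths ?Q ?p ?q"
  proof (rule homotopic_paths_linear[OF pp pq])
    fix t :: real assume t: "t \<in> {0..1}"
    have "convex ?Q" by (intro convex_Times convex_real_interval)
    moreover have "?p t \<in> ?Q" using t by simp
    moreover have "?q t \<in> ?Q" using im t unfolding path_image_def by blast
    ultimately show "closed_segment (?p t) (?q t) \<subseteq> ?Q" by (rule closed_segment_subset[rotated 2])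
  qed (simp_all add: pathstart_def pathfinish_def reversepath_def joinpaths_def)
  from homotopic_paths_continuous_image[OF this k(1), of X]
  have "homotopic_paths X (k \<circ> ?p) (k \<circ> ?q)" using k(2) by blast
  then show ?thesis
    unfolding path_compose_join path_compose_reversepath by (simp add: o_def)
qed

section \<open>Path classes, induced homomorphisms and radial injectivity\<close>

lemma mem_loops_at_path_class:
  "\<gamma> \<in> loops_at X a \<Longrightarrow> \<gamma> \<in> path_class X \<gamma>"
  by (simp add: loops_at_def path_class_def)

lemma path_class_eqI: "homotopic_paths X \<gamma> \<delta> \<Longrightarrow> path_class X \<gamma> = path_class X \<delta>"
  unfolding path_class_def using homotopic_paths_sym homotopic_paths_trans by blast

lemma path_class_eqD:
  "path_class X \<gamma> = path_class X \<delta> \<Longrightarrow> \<delta> \<in> loops_at X a \<Longrightarrow> homotopic_paths X \<gamma> \<delta>"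
  using mem_loops_at_path_class[of \<delta> X a] by (auto simp: path_class_def)

lemma carrier_pi1: "carrier (pi1 X a) = path_class X ` loops_at X a"
  by (simp add: pi1_def)

lemma pi1_mult:
  assumes "\<gamma> \<in> loops_at X a" "\<delta> \<in> loops_at X a"
  shows "path_class X \<gamma> \<otimes>\<^bsub>pi1 X a\<^esub> path_class X \<delta> = path_class X (\<gamma> +++ \<delta>)"
proof -
  have "path_class X (\<gamma>' +++ \<delta>') = path_class X (\<gamma> +++ \<delta>)"
    if "\<gamma>' \<in> path_class X \<gamma>" "\<delta>' \<in> path_class X \<delta>" for \<gamma>' \<delta>'
  proof (rule path_class_eqI, rule homotopic_paths_sym, rule homotopic_paths_join)
    show "pathfinish \<gamma> = pathstart \<delta>" using assms by (simp add: loops_at_def)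
  qed (use that in \<open>simp_all add: path_class_def\<close>)
  then show ?thesis
    using mem_loops_at_path_class assms unfolding pi1_def by (auto; blast)
qed

lemma loops_at_join: "\<gamma> \<in> loops_at X a \<Longrightarrow> \<delta> \<in> loops_at X a \<Longrightarrow> \<gamma> +++ \<delta> \<in> loops_at X a"
  by (auto simp: loops_at_def path_image_join)

lemma loops_at_compose:
  assumes "continuous_on X f" "f ` X \<subseteq> Y" "\<gamma> \<in> loops_at X a"
  shows "f \<circ> \<gamma> \<in> loops_at Y (f a)"
  using assms unfolding loops_at_def
  by (auto simp: pathstart_compose pathfinish_compose path_image_compose
      intro: path_continuous_image continuous_on_subset)

lemma pi1_map_path_class:
  assumes f: "continuous_on X f" "f ` X \<subseteq> Y" and \<gamma>: "\<gamma> \<in> loops_at X a"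
  shows "pi1_map Y f (path_class X \<gamma>) = path_class Y (f \<circ> \<gamma>)"
proof -
  have "path_class Y (f \<circ> \<delta>) = path_class Y (f \<circ> \<gamma>)" if "\<delta> \<in> path_class X \<gamma>" for \<delta>
  proof (rule path_class_eqI, rule homotopic_paths_sym)
    show "homotopic_paths Y (f \<circ> \<gamma>) (f \<circ> \<delta>)"
      using homotopic_paths_continuous_image[OF _ f(1), of \<gamma> \<delta> Y] f(2) that
      unfolding path_class_def by blast
  qed
  then show ?thesis unfolding pi1_map_def using mem_loops_at_path_class[OF \<gamma>] by blast
qed

lemma pi1_map_hom:
  assumes f: "continuous_on X f" "f ` X \<subseteq> Y"
  shows "pi1_map Y f \<in> hom (pi1 X a) (pi1 Y (f a))"
proof (rule homI)
  show "pi1_map Y f c \<in> carrier (pi1 Y (f a))" if "c \<in> carrier (pi1 X a)" for c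
    using that pi1_map_path_class[OF f] loops_at_compose[OF f] by (auto simp: carrier_pi1)
  fix c d assume "c \<in> carrier (pi1 X a)" "d \<in> carrier (pi1 X a)"
  then obtain \<gamma> \<delta> where cd: "\<gamma> \<in> loops_at X a" "c = path_class X \<gamma>" "\<delta> \<in> loops_at X a" "d = path_class X \<delta>"
    by (auto simp: carrier_pi1)
  then show "pi1_map Y f (c \<otimes>\<^bsub>pi1 X a\<^esub> d) = pi1_map Y f c \<otimes>\<^bsub>pi1 Y (f a)\<^esub> pi1_map Y f d"
    using pi1_mult[OF cd(1,3)] pi1_mult[OF loops_at_compose[OF f cd(1)] loops_at_compose[OF f cd(3)]]
      pi1_map_path_class[OF f cd(1)] pi1_map_path_class[OF f cd(3)]
      pi1_map_path_class[OF f loops_at_join[OF cd(1,3)]]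
    by (simp add: path_compose_join)
qed

text \<open>The base point \<open>a\<close> moves along the ray \<open>\<beta>\<close> during the radial homotopy from \<open>\<gamma>\<close> to
  \<open>p \<circ> f \<circ> \<gamma>\<close>; as \<open>\<beta>\<close> depends only on \<open>a\<close>, conjugation by \<open>\<beta>\<close> inverts the map induced by
  \<open>p \<circ> f\<close>.\<close>

lemma inj_on_pi1_map_radial:
  fixes X :: "'a::real_normed_vector set" and Y :: "'b::real_normed_vector set"
  assumes f: "continuous_on X f" "f ` X \<subseteq> Y" and p: "continuous_on Y p" "p ` Y \<subseteq> X"
    and \<rho>: "continuous_on X \<rho>" "\<And>v. v \<in> X \<Longrightarrow> 0 < \<rho> v"
    and cone: "\<And>c v. v \<in> X \<Longrightarrow> 0 < c \<Longrightarrow> c *\<^sub>R v \<in> X"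
    and pf: "\<And>v. v \<in> X \<Longrightarrow> p (f v) = \<rho> v *\<^sub>R v"
  shows "inj_on (pi1_map Y f) (carrier (pi1 X a))"
proof (rule inj_onI)
  define \<beta> where "\<beta> s = ((1 - s) + s * \<rho> a) *\<^sub>R a" for s :: real
  have conj: "homotopic_paths X \<gamma> (\<beta> +++ (p \<circ> (f \<circ> \<gamma>)) +++ reversepath \<beta>)" if \<gamma>: "\<gamma> \<in> loops_at X a" for \<gamma>
  proof -
    have \<gamma>X: "\<gamma> t \<in> X" if "t \<in> {0..1}" for t
      using \<gamma> that by (auto simp: loops_at_def path_image_def)
    have c\<gamma>: "continuous_on {0..1} \<gamma>" using \<gamma> by (simp add: loops_at_def path_def)
    have ends: "\<gamma> 0 = a" "\<gamma> 1 = a" using \<gamma> by (auto simp: loops_at_def pathstart_def pathfinish_def)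
    have aX: "a \<in> X" using \<gamma>X[of 0] ends by simp
    define k where "k st = ((1 - fst st) + fst st * \<rho> (\<gamma> (snd st))) *\<^sub>R \<gamma> (snd st)" for st :: "real \<times> real"
    have csnd: "continuous_on ({0..1} \<times> {0..1}) (\<lambda>st::real\<times>real. \<gamma> (snd st))"
      by (rule continuous_on_compose2[OF c\<gamma>]) (auto intro: continuous_intros)
    have c\<rho>: "continuous_on ({0..1} \<times> {0..1}) (\<lambda>st::real\<times>real. \<rho> (\<gamma> (snd st)))"
      by (rule continuous_on_compose2[OF \<rho>(1) csnd]) (use \<gamma>X in auto)
    have ck: "continuous_on ({0..1} \<times> {0..1}) k"
      unfolding k_def by (intro continuous_intros csnd c\<rho>)
    have pos: "0 < (1 - s) + s * \<rho> v" if "s \<in> {0..1}" "v \<in> X" for s v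
      using \<rho>(2)[OF that(2)] that(1) by (cases "s = 1") (auto intro: add_pos_nonneg)
    have "k ` ({0..1} \<times> {0..1}) \<subseteq> X"
      unfolding k_def using cone \<gamma>X pos by auto
    \<comment> \<open>The loop starts and ends at a, so the lower and the upper side of the square
      are both \<open>\<beta>\<close>.\<close>
    from homotopic_paths_square[OF ck this]
    have 1: "homotopic_paths X \<gamma> (\<beta> +++ (\<lambda>t. \<rho> (\<gamma> t) *\<^sub>R \<gamma> t) +++ reversepath \<beta>)"
      unfolding k_def fst_conv snd_conv ends by (simp add: \<beta>_def[abs_def])
    have p\<beta>: "path \<beta>" unfolding path_def \<beta>_def by (intro continuous_intros)
    have i\<beta>: "path_image \<beta> \<subseteq> X" unfolding path_image_def \<beta>_def using cone[OF aX] pos[OF _ aX] by auto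
    have l: "p \<circ> (f \<circ> \<gamma>) \<in> loops_at X (p (f a))" 
      by (rule loops_at_compose[OF p loops_at_compose[OF f \<gamma>]])
    have fin: "pathfinish \<beta> = p (f a)" by (simp add: \<beta>_def pathfinish_def pf[OF aX])
    have "homotopic_paths X (p \<circ> (f \<circ> \<gamma>)) (\<lambda>t. \<rho> (\<gamma> t) *\<^sub>R \<gamma> t)"
      using l pf \<gamma>X by (intro homotopic_paths_eq) (auto simp: loops_at_def)
    then have "homotopic_paths X (\<beta> +++ (p \<circ> (f \<circ> \<gamma>)) +++ reversepath \<beta>)
        (\<beta> +++ (\<lambda>t. \<rho> (\<gamma> t) *\<^sub>R \<gamma> t) +++ reversepath \<beta>)"
      using p\<beta> i\<beta> l fin
      by (intro homotopic_paths_join) (auto simp: loops_at_def)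
    then show ?thesis using 1 homotopic_paths_sym homotopic_paths_trans by blast
  qed
  fix c d assume c: "c \<in> carrier (pi1 X a)" and d: "d \<in> carrier (pi1 X a)"
    and eq: "pi1_map Y f c = pi1_map Y f d"
  obtain \<gamma> \<delta> where \<gamma>: "\<gamma> \<in> loops_at X a" "c = path_class X \<gamma>" and \<delta>: "\<delta> \<in> loops_at X a" "d = path_class X \<delta>"
    using c d by (auto simp: carrier_pi1)
  have "path_class Y (f \<circ> \<gamma>) = path_class Y (f \<circ> \<delta>)"
    using eq pi1_map_path_class[OF f] \<gamma> \<delta> by simp
  then have "homotopic_paths Y (f \<circ> \<gamma>) (f \<circ> \<delta>)"
    by (rule path_class_eqD[OF _ loops_at_compose[OF f \<delta>(1)]])
  then have h: "homotopic_paths X (p \<circ> (f \<circ> \<gamma>)) (p \<circ> (f \<circ> \<delta>))"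
    using homotopic_paths_continuous_image[OF _ p(1), of "f \<circ> \<gamma>" "f \<circ> \<delta>" X] p(2) by blast
  have aX: "a \<in> X" using \<gamma>(1) by (auto simp: loops_at_def path_image_def pathstart_def)
  have \<beta>X: "path \<beta>" "path_image \<beta> \<subseteq> X" "pathfinish \<beta> = pathstart (p \<circ> (f \<circ> \<gamma>))"
    "pathfinish (p \<circ> (f \<circ> \<gamma>)) = pathfinish \<beta>"
  proof -
    show "path \<beta>" unfolding path_def \<beta>_def by (intro continuous_intros)
    have "0 < (1 - s) + s * \<rho> a" if "s \<in> {0..1}" for s
      using \<rho>(2)[OF aX] that by (cases "s = 1") (auto intro: add_pos_nonneg)
    then show "path_image \<beta> \<subseteq> X" unfolding path_image_def \<beta>_def using cone[OF aX] by auto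
    show "pathfinish \<beta> = pathstart (p \<circ> (f \<circ> \<gamma>))" "pathfinish (p \<circ> (f \<circ> \<gamma>)) = pathfinish \<beta>"
      using \<gamma>(1) pf[OF aX] by (auto simp: loops_at_def \<beta>_def pathfinish_def pathstart_def)
  qed
  have "homotopic_paths X (\<beta> +++ (p \<circ> (f \<circ> \<gamma>)) +++ reversepath \<beta>) (\<beta> +++ (p \<circ> (f \<circ> \<delta>)) +++ reversepath \<beta>)"
    using \<beta>X by (intro homotopic_paths_join h) auto
  then have "homotopic_paths X \<gamma> \<delta>"
    using conj[OF \<gamma>(1)] conj[OF \<delta>(1)] homotopic_paths_sym homotopic_paths_trans by blast
  then show "c = d" using \<gamma> \<delta> path_class_eqI by blast
qed

section \<open>The inertia class of the maximal irreducible subspace\<close>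

definition expi :: "real \<Rightarrow> complex" where
  "expi t = exp (2 * of_real pi * \<i> * of_real t)"

definition circ :: "complex ^ 'n::finite \<Rightarrow> real \<Rightarrow> complex ^ 'n" where
  "circ w t = expi t *s w"

lemma expi_simps [simp]: "cmod (expi t) = 1" "expi t \<noteq> 0" "expi 0 = 1" "expi 1 = 1"
proof -
  show "cmod (expi t) = 1" unfolding expi_def by (simp add: norm_exp_eq_Re)
  show "expi t \<noteq> 0" "expi 0 = 1" by (simp_all add: expi_def)
  show "expi 1 = 1" unfolding expi_def using exp_two_pi_i by (simp add: mult.commute mult.left_commute)
qed

lemma continuous_on_expi [continuous_intros]:
  "continuous_on S f \<Longrightarrow> continuous_on S (\<lambda>x. expi (f x))"
  unfolding expi_def by (intro continuous_intros)

text \<open>In the straight-line homotopy the centre moves inside K, while the coefficient of u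
  keeps the positive modulus \<open>(1 - s) * r1 + s * r2\<close>. As u is not in K, the circles
  never meet K.\<close>

lemma homotopic_circles:
  fixes u :: "complex ^ 'n::finite"
  assumes K: "vec.subspace K" "z1 \<in> K" "z2 \<in> K" "u \<notin> K" and r: "0 < r1" "0 < r2"
    and disc: "\<And>s \<zeta>. s \<in> {0..1} \<Longrightarrow> cmod \<zeta> \<le> (1 - s) * r1 + s * r2 \<Longrightarrow>
      (1 - s) *\<^sub>R z1 + s *\<^sub>R z2 + \<zeta> *s u \<in> \<Omega>"
  shows "homotopic_loops (\<Omega> - K) (\<lambda>t. z1 + (of_real r1 * expi t) *s u) (\<lambda>t. z2 + (of_real r2 * expi t) *s u)"
proof (rule homotopic_loops_linear)
  show "path (\<lambda>t. z1 + (of_real r1 * expi t) *s u)" "path (\<lambda>t. z2 + (of_real r2 * expi t) *s u)"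
    unfolding path_def by (intro continuous_intros)+
  fix t :: real
  show "closed_segment (z1 + (of_real r1 * expi t) *s u) (z2 + (of_real r2 * expi t) *s u) \<subseteq> \<Omega> - K"
  proof
    fix y assume "y \<in> closed_segment (z1 + (of_real r1 * expi t) *s u) (z2 + (of_real r2 * expi t) *s u)"
    then obtain s where s: "0 \<le> s" "s \<le> 1"
      and y: "y = (1 - s) *\<^sub>R (z1 + (of_real r1 * expi t) *s u) + s *\<^sub>R (z2 + (of_real r2 * expi t) *s u)"
      unfolding closed_segment_def by blast
    let ?r = "(1 - s) * r1 + s * r2"
    let ?z = "(1 - s) *\<^sub>R z1 + s *\<^sub>R z2"
    have rpos: "0 < ?r" using r s by (cases "s = 1") (auto intro: add_pos_nonneg)
    have y_eq: "y = ?z + (of_real ?r * expi t) *s u"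
      unfolding y scaleR_vec_complex by (simp add: vec_eq_iff algebra_simps)
    have "?z \<in> K" unfolding scaleR_vec_complex using K by (intro vec.subspace_add vec.subspace_scale)
    have "y \<notin> K"
    proof
      assume "y \<in> K"
      then have "y - ?z \<in> K" using \<open>?z \<in> K\<close> by (rule vec.subspace_diff[OF K(1)])
      then have "(of_real ?r * expi t) *s u \<in> K" unfolding y_eq by simp
      then have "(1 / (of_real ?r * expi t)) *s ((of_real ?r * expi t) *s u) \<in> K"
        by (rule vec.subspace_scale[OF K(1)])
      moreover have "of_real ?r * expi t \<noteq> 0" using rpos by (metis expi_simps(2) less_irrefl mult_eq_0_iff of_real_eq_0_iff)
      ultimately show False using K(4) by (simp only: vec.scale_scale) simp
    qed
    moreover have "cmod (of_real ?r * expi t) \<le> ?r" using rpos by (simp only: norm_mult norm_of_real expi_simps) simp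
    then have "y \<in> \<Omega>" unfolding y_eq using s by (intro disc) auto
    ultimately show "y \<in> \<Omega> - K" by blast
  qed
qed (simp_all add: pathstart_def pathfinish_def)

context arrangement
begin

section \<open>Scalar circles in the complement and their centrality\<close>

lemma X_scale: "w \<in> X \<Longrightarrow> c \<noteq> 0 \<Longrightarrow> c *s w \<in> X"
proof -
  assume w: "w \<in> X" and c: "c \<noteq> 0"
  have "c *s w \<notin> H" if "H \<in> Hs" for H
  proof
    assume "c *s w \<in> H"
    then have "(1 / c) *s (c *s w) \<in> H" by (rule vec.subspace_scale[OF hyp_subspace[OF that]])
    then show False using w c that by (simp add: mem_X_iff)
  qed
  then show ?thesis using w subspace_E by (simp add: mem_X_iff vec.subspace_scale)
qed

lemma zero_mem_hyp: "H \<in> Hs \<Longrightarrow> 0 \<in> H"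
  using hyp_subspace vec.subspace_0 by blast

lemma openin_X: "openin (top_of_set E) X"
proof -
  have "perp E = {0}" by (rule orth_self[OF subspace_E])
  then have "X = {v. dir_generic E v}"
    using zero_mem_hyp by (auto simp: mem_X_iff dir_generic_def)
  then show ?thesis using open_dir_generic[of E] by simp
qed

lemma path_connected_X: "path_connected X"
  unfolding hyp_compl_def
  by (rule path_connected_subspace_complement[OF subspace_E finite_hyps hyp_subspace])

text \<open>X is path connected and stable under nonzero scalars, so a path from \<open>w1\<close>
  to \<open>w2\<close> carries its circles along inside X.\<close>

lemma homotopic_circ:
  assumes "w1 \<in> X" "w2 \<in> X"
  shows "homotopic_loops X (circ w1) (circ w2)"
proof -
  obtain g where g: "path g" "path_image g \<subseteq> X" "pathstart g = w1" "pathfinish g = w2"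
    using path_connected_X assms unfolding path_connected_def by blast
  have gX: "g s \<in> X" if "s \<in> {0..1}" for s using g(2) that by (auto simp: path_image_def)
  let ?k = "\<lambda>x::real\<times>real. expi (snd x) *s g (fst x)"
  have "continuous_on ({0..1} \<times> {0..1}) (\<lambda>x::real\<times>real. g (fst x))"
    by (rule continuous_on_compose2[OF g(1)[unfolded path_def]]) (auto intro: continuous_intros)
  then have ck: "continuous_on ({0..1} \<times> {0..1}) ?k" by (intro continuous_intros)
  show ?thesis
    unfolding homotopic_loops
  proof (intro exI[of _ ?k] conjI ballI ck)
    show "?k \<in> ({0..1} \<times> {0..1}) \<rightarrow> X" using gX X_scale by auto
  qed (use g in \<open>simp_all add: circ_def pathstart_def pathfinish_def\<close>)
qed

lemma circ_loops_at: "w \<in> X \<Longrightarrow> circ w \<in> loops_at X w"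
  unfolding loops_at_def path_def circ_def path_image_def pathstart_def pathfinish_def
  using X_scale by (auto intro!: continuous_intros)

text \<open>The scalar circle is central: multiplying a loop \<open>\<beta>\<close> by the scalars \<open>expi t\<close> gives a torus on
  which \<open>circ a\<close> and \<open>\<beta>\<close> commute.\<close>

lemma circ_central:
  assumes \<gamma>: "\<gamma> \<in> loops_at X a" and h: "homotopic_loops X \<gamma> (circ a)"
  shows "homotopic_paths X \<gamma> (circ a)"
proof -
  obtain k where k: "continuous_on ({0..1::real} \<times> {0..1::real}) k" "k ` ({0..1} \<times> {0..1}) \<subseteq> X"
    "\<And>t. t \<in> {0..1} \<Longrightarrow> k (0, t) = \<gamma> t" "\<And>t. t \<in> {0..1} \<Longrightarrow> k (1, t) = circ a t"
    "\<And>s. s \<in> {0..1} \<Longrightarrow> k (s, 1) = k (s, 0)"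
    using h unfolding homotopic_loops pathstart_def pathfinish_def o_def image_subset_iff_funcset
    by metis
  \<comment> \<open>The track of the base point under the free homotopy. It is a loop at a, and the
    square exhibits \<open>\<gamma>\<close> as the conjugate of \<open>circ a\<close> by it.\<close>
  define \<beta> where "\<beta> s = k (s, 0)" for s
  have ends: "\<beta> 0 = a" "\<beta> 1 = a"
    using \<gamma> k(3)[of 0] k(4)[of 0] by (simp_all add: \<beta>_def loops_at_def pathstart_def circ_def)
  have \<beta>X: "\<beta> s \<in> X" if "s \<in> {0..1}" for s using k(2) that by (auto simp: \<beta>_def)
  have c\<beta>: "continuous_on {0..1} \<beta>"
    unfolding \<beta>_def by (rule continuous_on_compose2[OF k(1)]) (auto intro!: continuous_intros)
  then have p\<beta>: "path \<beta>" by (simp add: path_def)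
  have i\<beta>: "path_image \<beta> \<subseteq> X" using \<beta>X by (auto simp: path_image_def)
  have aX: "a \<in> X" using \<beta>X[of 0] ends by simp
  have ca: "circ a \<in> loops_at X a" by (rule circ_loops_at[OF aX])
  have eq: "homotopic_paths X (\<beta> +++ circ a +++ reversepath \<beta>)
      (\<beta> +++ (\<lambda>t. k (1, t)) +++ reversepath (\<lambda>s. k (s, 1)))"
  proof (intro homotopic_paths_join)
    show "homotopic_paths X (circ a) (\<lambda>t. k (1, t))"
      using ca k(4) by (intro homotopic_paths_eq) (auto simp: loops_at_def)
    show "homotopic_paths X (reversepath \<beta>) (reversepath (\<lambda>s. k (s, 1)))"
      unfolding homotopic_paths_reversepath
      using p\<beta> i\<beta> k(5) by (intro homotopic_paths_eq) (auto simp: \<beta>_def)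
  qed (use p\<beta> i\<beta> ca ends in \<open>auto simp: loops_at_def pathstart_def pathfinish_def reversepath_def joinpaths_def\<close>)
  have "homotopic_paths X \<gamma> (\<lambda>t. k (0, t))"
    using \<gamma> k(3) by (intro homotopic_paths_eq) (auto simp: loops_at_def)
  from homotopic_paths_trans[OF this homotopic_paths_square[OF k(1,2)]]
  have 1: "homotopic_paths X \<gamma> (\<beta> +++ circ a +++ reversepath \<beta>)"
    using eq homotopic_paths_sym homotopic_paths_trans unfolding \<beta>_def by blast
  \<comment> \<open>The left and right sides of this square are \<open>circ a\<close>, the lower and
    upper sides are \<open>\<beta>\<close>.\<close>
  let ?k = "\<lambda>x::real\<times>real. expi (snd x) *s \<beta> (fst x)"
  have "continuous_on ({0..1} \<times> {0..1}) (\<lambda>x::real\<times>real. \<beta> (fst x))"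
    by (rule continuous_on_compose2[OF c\<beta>]) (auto intro: continuous_intros)
  then have "continuous_on ({0..1} \<times> {0..1}) ?k" by (intro continuous_intros)
  moreover have "?k ` ({0..1} \<times> {0..1}) \<subseteq> X" using \<beta>X X_scale by auto
  ultimately have "homotopic_paths X (\<lambda>t. ?k (0, t))
      ((\<lambda>s. ?k (s, 0)) +++ (\<lambda>t. ?k (1, t)) +++ reversepath (\<lambda>s. ?k (s, 1)))"
    by (rule homotopic_paths_square)
  then have "homotopic_paths X (circ a) (\<beta> +++ circ a +++ reversepath \<beta>)"
    by (simp add: ends circ_def[abs_def])
  with 1 show ?thesis using homotopic_paths_sym homotopic_paths_trans by blast
qed

text \<open>The dimension count behind the transversality of the charts.\<close>

lemma endomorphism_hits_line:
  assumes N: "\<And>v. v \<in> E \<Longrightarrow> N *v v \<in> E" and s: "s \<in> E" "s \<noteq> 0"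
  obtains u c where "u \<in> E" "u \<noteq> 0" "N *v u = c *s s"
proof (cases "inj_on ((*v) N) E")
  case True
  have "inj_on ((*v) N) (vec.span E)" using True unfolding span_vec_subspace[OF subspace_E] .
  then have "vec.dim ((*v) N ` E) = vec.dim E" by (rule vec.dim_image_eq[OF matrix_vector_mul_linear_gen])
  moreover have "vec.subspace ((*v) N ` E)" using vec.subspace_image[OF subspace_E] by blast
  moreover have "(*v) N ` E \<subseteq> E" using N by blast
  ultimately have "(*v) N ` E = E" by (intro vec.subspace_dim_equal subspace_E) auto
  then obtain u where u: "u \<in> E" "N *v u = s" using s(1) by (metis imageE)
  then show ?thesis using that[of u 1] s(2) by (metis matrix_vector_mult_0_right vec.scale_one)
next
  case False
  then obtain v w where vw: "v \<in> E" "w \<in> E" "v \<noteq> w" "N *v v = N *v w" by (auto simp: inj_on_def)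
  have "N *v (v - w) = 0 *s s" using vw by (simp add: matrix_vector_mult_diff_distrib)
  then show ?thesis using that[of "v - w" 0] vw subspace_E by (simp add: vec.subspace_diff)
qed

context
  fixes \<Omega> \<phi> K z
  assumes EI: "E \<in> Irr" and c: "adapted_chart h E G \<Omega> \<phi> K" and z: "z \<in> \<Omega> \<inter> K" "\<phi> z \<in> D0 E"
begin

lemma perp_E: "perp E = {0}"
  by (rule orth_self[OF subspace_E])

lemma dir_generic_X: "dir_generic E v \<longleftrightarrow> v \<in> X"
  using perp_E zero_mem_hyp by (auto simp: mem_X_iff dir_generic_def)

text \<open>The divisor of E lies over \<open>perp E = {0}\<close>, so near a point of
  \<open>D0 E\<close> the whole boundary is contracted to the origin.\<close>

lemma fst_chart_eq_0_near:
  obtains T where "open T" "z \<in> T" "\<And>y. y \<in> \<Omega> \<inter> T \<inter> K \<Longrightarrow> fst (\<phi> y) = 0"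
    "\<And>y. y \<in> \<Omega> \<inter> T \<Longrightarrow> \<phi> y \<in> OB E"
proof -
  obtain T where T: "open T" "{y \<in> \<Omega>. \<phi> y \<in> OB E} = \<Omega> \<inter> T"
    using openin_chart_OB[OF c EI] unfolding openin_open by blast
  have "z \<in> T" using T(2) z D0_subset_OB[OF EI] by blast
  have OBT: "\<phi> y \<in> OB E" if "y \<in> \<Omega> \<inter> T" for y using T(2) that by blast
  have "fst (\<phi> y) = 0" if y: "y \<in> \<Omega> \<inter> T \<inter> K" for y
  proof -
    have "\<phi> y \<in> OB E" using T(2) y by blast
    moreover have "\<phi> y \<in> bd" using adapted_chartD(8)[OF c, of y] y by simp
    ultimately have "\<phi> y \<in> D0 E" unfolding D0_eq[OF EI] by blast
    then obtain v e where "\<phi> y = pt E v e" "v \<in> perp E" unfolding D0_def by blast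
    then show ?thesis unfolding perp_E by simp
  qed
  then show ?thesis by (rule that[OF T(1) \<open>z \<in> T\<close> _ OBT])
qed

text \<open>The derivative of \<open>fst \<circ> \<phi>\<close> along a transverse direction lies on the line encoded by \<open>\<phi> z\<close>.
  If it vanished, \<open>fst \<circ> \<phi>\<close> would have derivative \<open>0\<close> at \<open>z\<close>, and some direction would be killed by
  the differential of \<open>\<phi>\<close>.\<close>

lemma transverse_derivative_mem_X:
  assumes M: "((\<lambda>y. fst (\<phi> y)) has_derivative (*v) M) (at z within \<Omega>)" and u: "u \<in> E - K"
  shows "M *v u \<in> X"
proof -
  note D = adapted_chartD[OF c]
  let ?f = "\<lambda>y. fst (\<phi> y)"
  obtain T where T: "open T" "z \<in> T" "\<And>y. y \<in> \<Omega> \<inter> T \<inter> K \<Longrightarrow> ?f y = 0"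
    "\<And>y. y \<in> \<Omega> \<inter> T \<Longrightarrow> \<phi> y \<in> OB E"
    using fst_chart_eq_0_near by blast
  have f0: "?f z = 0" using T z by blast
  obtain U s where U: "openin (top_of_set \<Omega>) U" "z \<in> U"
    and s: "holo_lift E (perp E) U (\<lambda>y. snd (\<phi> y) E) s"
    using D(4) EI z unfolding holo_map_def by blast
  have opU: "openin (top_of_set E) U" using openin_trans[OF U(1) D(1)] .
  have U\<Omega>: "U \<subseteq> \<Omega>" using openin_imp_subset[OF U(1)] .
  have sU: "s y \<in> E" "s y \<noteq> 0" "snd (\<phi> y) E = proj_class (perp E) (s y)" if "y \<in> U" for y
    using s that perp_E by (auto simp: holo_lift_def)
  obtain N where N: "(s has_derivative (*v) N) (at z within U)"
    using s U(2) unfolding holo_lift_def holo_on_def by blast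
  have M_U: "(?f has_derivative (*v) M) (at z within U)" using M U\<Omega> by (rule has_derivative_subset)
  note L = has_vector_derivative_line[OF _ opU subspace_E U(2)]
  \<comment> \<open>The line recorded at \<open>\<phi> z\<close> is spanned by a vector of X, so it
    is enough to show that the derivative is a nonzero multiple of \<open>s z\<close>.\<close>
  have sz: "dir_generic E (s z)"
  proof (rule WM_OB_D(1)[OF D(11)])
    show "\<phi> z \<in> OB E" using T z by blast
    show "s z \<in> snd (\<phi> z) E" using sU(3)[OF U(2)] mem_proj_class by simp
    show "s z \<notin> perp E" using sU(2)[OF U(2)] perp_E by simp
  qed (use z EI in auto)
  \<comment> \<open>The lift takes values in E, so its derivative along E does as well. This is
    tested against the orthogonal of E, since only one-variable derivatives are compared.\<close>
  have N_E: "N *v v \<in> E" if v: "v \<in> E" for v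
  proof -
    have "h (N *v v) b = 0" if b: "b \<in> orth h UNIV E" for b
    proof -
      have "((\<lambda>r. h (s (z + r *\<^sub>R v)) b) has_vector_derivative h (N *v v) b) (at 0)"
        by (rule bounded_linear.has_vector_derivative[OF bounded_linear_h_left L(1)[OF N v]])
      moreover have "((\<lambda>r::real. 0::complex) has_vector_derivative 0) (at 0)" by (rule has_vector_derivative_const)
      moreover have "\<forall>\<^sub>F r in nhds 0. h (s (z + r *\<^sub>R v)) b = 0"
        using L(2)[OF N v]
      proof (rule eventually_mono)
        fix r assume "z + r *\<^sub>R v \<in> U"
        then have "s (z + r *\<^sub>R v) \<in> E" by (rule sU)
        then show "h (s (z + r *\<^sub>R v)) b = 0" using b eq_0_swap by (auto simp: orth_def)
      qed
      ultimately show ?thesis by (rule has_vector_derivative_unique_eventually)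
    qed
    then have "N *v v \<in> orth h UNIV (orth h UNIV E)" by (simp add: orth_def)
    then show ?thesis using orth_orth[OF vec.subspace_UNIV subspace_E] by simp
  qed
  \<comment> \<open>Incidence makes the base point proportional to the lift \<open>s\<close>. The
    proportionality is written without division, by pairing with \<open>s z\<close>, and
    differentiated at z; there the base point is 0, so the terms containing the derivative of
    \<open>s\<close> drop out.\<close>
  have line: "h (s z) (s z) *s (M *v u) = h (M *v u) (s z) *s s z"
  proof -
    have uE: "u \<in> E" using u by blast
    let ?l = "\<lambda>r::real. z + r *\<^sub>R u"
    have 1: "((\<lambda>r. h (s (?l r)) (s z) *s ?f (?l r)) has_vector_derivative
        (h (s (?l 0)) (s z) *s (M *v u) + h (N *v u) (s z) *s ?f (?l 0))) (at 0)"
      by (rule bounded_bilinear.has_vector_derivative[OF bounded_bilinear_vector_scalar_mult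
          bounded_linear.has_vector_derivative[OF bounded_linear_h_left L(1)[OF N uE]] L(1)[OF M_U uE]])
    have 2: "((\<lambda>r. h (?f (?l r)) (s z) *s s (?l r)) has_vector_derivative
        (h (?f (?l 0)) (s z) *s (N *v u) + h (M *v u) (s z) *s s (?l 0))) (at 0)"
      by (rule bounded_bilinear.has_vector_derivative[OF bounded_bilinear_vector_scalar_mult
          bounded_linear.has_vector_derivative[OF bounded_linear_h_left L(1)[OF M_U uE]] L(1)[OF N uE]])
    have "\<forall>\<^sub>F r in nhds 0. h (s (?l r)) (s z) *s ?f (?l r) = h (?f (?l r)) (s z) *s s (?l r)"
      using L(2)[OF N uE]
    proof (rule eventually_mono)
      fix r assume r: "?l r \<in> U"
      have "?f (?l r) \<in> snd (\<phi> (?l r)) E" using fst_mem_snd[OF D(11) EI] r U\<Omega> by blast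
      then obtain k where "?f (?l r) - k *s s (?l r) \<in> perp E"
        using sU(3)[OF r] mem_proj_class_iff[OF subspace_perp] by auto
      then have "?f (?l r) = k *s s (?l r)" using perp_E by simp
      then show "h (s (?l r)) (s z) *s ?f (?l r) = h (?f (?l r)) (s z) *s s (?l r)"
        by (simp add: scale_left mult.commute)
    qed
    from has_vector_derivative_unique_eventually[OF 1 2 this] show ?thesis using f0 by simp
  qed
  have hs: "h (s z) (s z) \<noteq> 0" using sU(2)[OF U(2)] by simp
  have "M *v u = (1 / h (s z) (s z)) *s (h (s z) (s z) *s (M *v u))" using hs by simp
  then have Mu: "M *v u = (h (M *v u) (s z) / h (s z) (s z)) *s s z" unfolding line by simp
  have nz: "M *v u \<noteq> 0"
  proof
    assume Mu0: "M *v u = 0"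
    \<comment> \<open>Along K the base point is constantly 0 near z. If the transverse derivative
      vanished too, the derivative would be 0 on all of E.\<close>
    have MK: "M *v k = 0" if k: "k \<in> K" for k
    proof -
      have kE: "k \<in> E" using k D(6) by blast
      note Lk = has_vector_derivative_line[OF M D(1) subspace_E _ kE]
      have "(\<lambda>r::real. z + r *\<^sub>R k) -` T \<in> {S. open S}" 
        by (simp, intro open_vimage T continuous_intros)
      then have evT: "\<forall>\<^sub>F r in nhds 0. z + r *\<^sub>R k \<in> T"
        unfolding eventually_nhds using T(2) by (intro exI[of _ "(\<lambda>r::real. z + r *\<^sub>R k) -` T"]) auto
      have "((\<lambda>r. ?f (z + r *\<^sub>R k)) has_vector_derivative M *v k) (at 0)" using Lk(1) z by blast
      moreover have "((\<lambda>r::real. 0::complex ^ 'n) has_vector_derivative 0) (at 0)"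
        by (rule has_vector_derivative_const)
      moreover have "\<forall>\<^sub>F r in nhds 0. ?f (z + r *\<^sub>R k) = 0"
        using eventually_conj[OF evT Lk(2)]
      proof (rule eventually_mono)
        show "z \<in> \<Omega>" using z by blast
        fix r assume "z + r *\<^sub>R k \<in> T \<and> z + r *\<^sub>R k \<in> \<Omega>"
        moreover have "z + r *\<^sub>R k \<in> K"
          unfolding scaleR_vec_complex using z k D(5) by (intro vec.subspace_add vec.subspace_scale) auto
        ultimately show "?f (z + r *\<^sub>R k) = 0" using T(3) by blast
      qed
      ultimately show ?thesis by (rule has_vector_derivative_unique_eventually)
    qed
    have "u \<notin> vec.span K" using u unfolding span_vec_subspace[OF D(5)] by blast
    then have "vec.dim (insert u K) = vec.dim E" using D(7) by (simp add: vec.dim_insert)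
    moreover have "vec.span (insert u K) \<subseteq> E" using u D(6) subspace_E by (intro vec.span_minimal) auto
    ultimately have spanE: "vec.span (insert u K) = E"
      by (intro vec.subspace_dim_equal subspace_E vec.subspace_span) (auto simp: vec.dim_span)
    have M0: "M *v v = 0" if vE: "v \<in> E" for v
    proof -
      obtain k where "v - k *s u \<in> K"
        using vE unfolding spanE[symmetric] vec.span_breakdown_eq span_vec_subspace[OF D(5)] by blast
      then have "M *v (v - k *s u) = 0" by (rule MK)
      then show ?thesis using Mu0 by (simp add: matrix_vector_mult_diff_distrib vec.scale)
    qed
    \<comment> \<open>With the derivative of the base point zero, only the projective coordinates
      could detect v. Some nonzero v is sent by N into the line of \<open>s z\<close>, so they do
      not move to first order either.\<close>
    obtain v k where v: "v \<in> E" "v \<noteq> 0" "N *v v = k *s s z"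
      using endomorphism_hits_line[OF N_E sU(1,2)[OF U(2)]] by blast
    have "killed_direction h E G \<Omega> \<phi> z v"
      unfolding killed_direction_def
    proof (intro conjI ballI)
      show "\<exists>M. (?f has_derivative (*v) M) (at z within \<Omega>) \<and> M *v v = 0" using M M0[OF v(1)] by blast
      fix F assume F: "F \<in> Irr"
      have FE: "F \<subseteq> E" by (rule Irr_subset[OF F])
      \<comment> \<open>The lift for the coordinate at E also lifts the coordinate at F, wherever it
        avoids \<open>perp F\<close>. Hence one v is killed in all coordinates.\<close>
      let ?U = "{y \<in> U. s y \<notin> perp F}"
      have "continuous_on U s" using s holo_on_imp_continuous_on by (auto simp: holo_lift_def)
      moreover have "open (- perp F)" by (rule open_Compl_vec_subspace[OF subspace_perp])
      ultimately have "openin (top_of_set U) (U \<inter> s -` (- perp F))" by (rule continuous_openin_preimage_gen)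
      then have 1: "openin (top_of_set \<Omega>) ?U"
        using openin_trans[OF _ U(1)] by (simp add: vimage_def Int_def)
      have 2: "z \<in> ?U" using U(2) dir_generic_not_perp[OF sz F FE] by blast
      have sub: "?U \<subseteq> U" by blast
      have 3: "holo_lift E (perp F) ?U (\<lambda>y. snd (\<phi> y) F) s"
        unfolding holo_lift_def
      proof (intro conjI ballI)
        show "holo_on ?U s" using s holo_on_subset[OF _ sub] by (simp add: holo_lift_def)
        fix y assume y: "y \<in> ?U"
        show "s y \<in> E - perp F" using y sU by blast
        have "s y \<in> snd (\<phi> y) E" using sU(3) y mem_proj_class by simp
        then show "snd (\<phi> y) F = proj_class (perp F) (s y)"
          using snd_eq_dir[OF D(11) F EI FE] y U\<Omega> by blast
      qed
      have 4: "(s has_derivative (*v) N) (at z within ?U)" using N sub by (rule has_derivative_subset)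
      have "s z \<in> snd (\<phi> z) F" using 3 2 mem_proj_class by (simp add: holo_lift_def)
      moreover have "vec.subspace (snd (\<phi> z) F)"
        using 3 2 subspace_proj_class by (simp add: holo_lift_def)
      ultimately have "N *v v \<in> snd (\<phi> z) F" unfolding v(3) by (intro vec.subspace_scale)
      then show "\<exists>U s M. openin (top_of_set \<Omega>) U \<and> z \<in> U \<and> holo_lift E (perp F) U (\<lambda>y. snd (\<phi> y) F) s \<and>
          (s has_derivative (*v) M) (at z within U) \<and> M *v v \<in> snd (\<phi> z) F"
        using 1 2 3 4 by blast
    qed
    then show False using D(9) z v by blast
  qed
  have "h (M *v u) (s z) / h (s z) (s z) \<noteq> 0" using nz Mu by (metis vec.scale_zero_left)
  moreover have "s z \<in> X" using sz dir_generic_X by blast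
  ultimately show ?thesis using X_scale Mu by metis
qed

text \<open>On small circles \<open>fst \<circ> \<phi>\<close> is close to its derivative, and the segments between the two stay in
  the cone \<open>X\<close>.\<close>

lemma small_meridian_homotopic:
  assumes u: "u \<in> E - K"
  obtains \<delta> w where "0 < \<delta>" "w \<in> X"
    "\<And>r. 0 < r \<Longrightarrow> r < \<delta> \<Longrightarrow> (\<And>t. z + (of_real r * expi t) *s u \<in> \<Omega>) \<Longrightarrow>
      homotopic_loops X (\<lambda>t. fst (\<phi> (z + (of_real r * expi t) *s u))) (circ (of_real r *s w))"
proof -
  note D = adapted_chartD[OF c]
  let ?f = "\<lambda>y. fst (\<phi> y)"
  obtain M where M: "(?f has_derivative (*v) M) (at z within \<Omega>)"
    using fst_chart_derivative[OF c] z by blast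
  define w where "w = M *v u"
  have w: "w \<in> X" unfolding w_def by (rule transverse_derivative_mem_X[OF M u])
  obtain T where T: "open T" "X = E \<inter> T" using openin_X unfolding openin_open by blast
  obtain \<rho> where \<rho>: "0 < \<rho>" "ball w \<rho> \<subseteq> T" using T w openE by (metis IntE)
  have u0: "u \<noteq> 0" using u vec.subspace_0[OF D(5)] by auto
  \<comment> \<open>On the circle of radius r the error is at most
    \<open>\<eta> * (r * norm u)\<close>, which is half of \<open>r * \<rho>\<close>. Divided by a
    scalar of modulus r it is smaller than \<open>\<rho>\<close>.\<close>
  define \<eta> where "\<eta> = \<rho> / (2 * norm u)"
  have \<eta>: "0 < \<eta>" using \<rho> u0 by (simp add: \<eta>_def)
  have f0: "?f z = 0" using fst_chart_eq_0_near z by (metis IntI IntD1 IntD2)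
  obtain d where d: "0 < d"
    "\<And>y. y \<in> \<Omega> \<Longrightarrow> norm (y - z) < d \<Longrightarrow> norm (?f y - ?f z - M *v (y - z)) \<le> \<eta> * norm (y - z)"
    using M \<eta> unfolding has_derivative_within_alt by blast
  show ?thesis
  proof (rule that[of "d / norm u" w])
    show "0 < d / norm u" using d u0 by simp
    show "w \<in> X" by (rule w)
    fix r assume r: "0 < r" "r < d / norm u" and in\<Omega>: "\<And>t. z + (of_real r * expi t) *s u \<in> \<Omega>"
    let ?l = "\<lambda>t. z + (of_real r * expi t) *s u"
    show "homotopic_loops X (\<lambda>t. ?f (?l t)) (circ (of_real r *s w))"
    proof (rule homotopic_loops_linear)
      show "path (\<lambda>t. ?f (?l t))"
        unfolding path_def
        by (rule continuous_on_compose2[OF continuous_on_fst_chart[OF c]]) (auto intro!: continuous_intros in\<Omega>)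
      show "path (circ (of_real r *s w))" unfolding path_def circ_def by (intro continuous_intros)
      fix t :: real
      define \<zeta> where "\<zeta> = of_real r * expi t"
      have \<zeta>: "cmod \<zeta> = r" "\<zeta> \<noteq> 0" using r by (auto simp: \<zeta>_def norm_mult)
      \<comment> \<open>Factoring out \<open>\<zeta>\<close> turns the error into a perturbation of
        the fixed vector w, and X is stable under multiplication by \<open>\<zeta>\<close>. The
        estimate is thereby uniform in t and r.\<close>
      define e where "e = (1 / \<zeta>) *s (?f (?l t) - \<zeta> *s w)"
      have fe: "?f (?l t) = \<zeta> *s (w + e)" using \<zeta> by (simp add: e_def vec_eq_iff)
      have lz: "?l t - z = \<zeta> *s u" "norm (\<zeta> *s u) = r * norm u"
        using \<zeta> by (simp_all add: \<zeta>_def norm_vector_scalar_mult)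
      have "norm (?l t - z) < d" unfolding lz using r u0 by (simp add: field_simps)
      from d(2)[OF in\<Omega> this] have "norm (?f (?l t) - \<zeta> *s w) \<le> \<eta> * (r * norm u)"
        unfolding lz f0 w_def vec.scale by simp
      moreover have "norm e = norm (?f (?l t) - \<zeta> *s w) / r"
        unfolding e_def norm_vector_scalar_mult using \<zeta> by (simp add: norm_divide)
      ultimately have "norm e \<le> \<eta> * norm u"
        using r(1) by (simp only: pos_divide_le_eq mult.assoc mult.commute[of r])
      also have "\<dots> < \<rho>" using \<rho> u0 by (simp add: \<eta>_def)
      finally have ne: "norm e < \<rho>" .
      have "?f (?l t) \<in> E" using D(11)[OF in\<Omega>] WM_topspace by (simp add: mem_topspace_amb_iff)
      then have eE: "e \<in> E"
        unfolding e_def using w by (intro vec.subspace_scale vec.subspace_diff subspace_E) (auto simp: mem_X_iff)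
      show "closed_segment (?f (?l t)) (circ (of_real r *s w) t) \<subseteq> X"
      proof
        fix y assume "y \<in> closed_segment (?f (?l t)) (circ (of_real r *s w) t)"
        then obtain s where s: "0 \<le> s" "s \<le> 1" and y: "y = (1 - s) *\<^sub>R ?f (?l t) + s *\<^sub>R circ (of_real r *s w) t"
          unfolding closed_segment_def by blast
        have circ_eq: "circ (of_real r *s w) t = \<zeta> *s w" by (simp add: circ_def \<zeta>_def mult.commute)
        have y_eq: "y = \<zeta> *s (w + of_real (1 - s) *s e)"
          unfolding y fe circ_eq scaleR_vec_complex by (simp add: vec_eq_iff algebra_simps)
        have "norm (of_real (1 - s) *s e) \<le> norm e"
          using s by (simp add: norm_vector_scalar_mult mult_left_le_one_le del: of_real_diff)
        moreover have "dist w (w + x) = norm x" for x by (simp add: dist_norm)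
        ultimately have "w + of_real (1 - s) *s e \<in> ball w \<rho>" using ne unfolding mem_ball by simp
        moreover have "w + of_real (1 - s) *s e \<in> E"
          using w eE by (intro vec.subspace_add vec.subspace_scale subspace_E) (auto simp: mem_X_iff)
        ultimately have "w + of_real (1 - s) *s e \<in> X" using T \<rho> by blast
        then show "y \<in> X" unfolding y_eq using \<zeta> by (intro X_scale)
      qed
    qed (simp_all add: pathstart_def pathfinish_def circ_def)
  qed
qed

end

text \<open>The centre of a meridian is known only to lie in the closure of \<open>D0 E\<close>.
  Inside the chart the circle is shrunk and its centre moved within the linear boundary K to a point
  of \<open>D0 E\<close>, always with the same u; there the comparison with a scalar circle
  applies.\<close>

lemma meridian_circ:
  assumes EI: "E \<in> Irr" and a: "a \<in> X" and \<mu>: "\<mu> \<in> meridians h E G E"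
  shows "homotopic_loops X \<mu> (circ a)"
proof -
  obtain \<Omega> \<phi> K z u \<epsilon> where c: "adapted_chart h E G \<Omega> \<phi> K" and z: "z \<in> \<Omega> \<inter> K"
    and zD: "\<phi> z \<in> wm_divisor h E G E" and u: "u \<in> E - K" and \<epsilon>: "0 < \<epsilon>"
    and disc: "\<And>\<zeta>. cmod \<zeta> \<le> \<epsilon> \<Longrightarrow> z + \<zeta> *s u \<in> \<Omega>"
    and \<mu>_eq: "\<mu> = (\<lambda>t. fst (\<phi> (z + (of_real \<epsilon> * expi t) *s u)))"
    using \<mu> unfolding meridians_def expi_def by blast
  note D = adapted_chartD[OF c]
  have pE: "perp E = {0}" by (rule orth_self[OF subspace_E])
  have ne: "D0 E \<noteq> {}"
  proof -
    have "0 \<in> E" by (rule vec.subspace_0[OF subspace_E])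
    then have "pt E 0 a \<in> D0 E"
      using a pE \<open>0 \<in> E\<close> zero_mem_hyp by (intro mem_D0) (auto simp: base_generic_def dir_generic_def mem_X_iff)
    then show ?thesis by blast
  qed
  have zcl: "\<phi> z \<in> amb closure_of D0 E" using zD wm_divisor_eq[OF EI ne] by simp
  obtain \<delta> where \<delta>: "0 < \<delta>" "E \<inter> ball z \<delta> \<subseteq> \<Omega>" "openin (top_of_set \<Omega>) (E \<inter> ball z \<delta>)" "z \<in> E \<inter> ball z \<delta>"
    using chart_ball[OF c] z by blast
  obtain z1 where z1: "z1 \<in> (E \<inter> ball z \<delta>) \<inter> K" "\<phi> z1 \<in> D0 E"
    using chart_reflects_closure[OF c \<delta>(3,4) EI zcl] by blast
  have z1\<Omega>: "z1 \<in> \<Omega> \<inter> K" using z1 \<delta> by blast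
  obtain \<delta>1 w where \<delta>1: "0 < \<delta>1" and w: "w \<in> X"
    and small: "\<And>r. 0 < r \<Longrightarrow> r < \<delta>1 \<Longrightarrow> (\<And>t. z1 + (of_real r * expi t) *s u \<in> \<Omega>) \<Longrightarrow>
      homotopic_loops X (\<lambda>t. fst (\<phi> (z1 + (of_real r * expi t) *s u))) (circ (of_real r *s w))"
    using small_meridian_homotopic[OF EI c z1\<Omega> z1(2) u] by blast
  have u0: "0 < norm u" using u vec.subspace_0[OF D(5)] by auto
  define gap where "gap = \<delta> - dist z z1"
  have gap: "0 < gap" using z1 by (simp add: gap_def)
  \<comment> \<open>The bound \<open>\<epsilon>\<close> keeps the discs inside the original one,
    \<open>\<delta>1\<close> makes the comparison at \<open>z1\<close> available, and
    \<open>gap\<close> keeps the discs around the segment from z to \<open>z1\<close> inside the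
    ball.\<close>
  define r where "r = Min {\<epsilon>, \<delta>1 / 2, gap / (2 * norm u)}"
  have r: "0 < r" "r \<le> \<epsilon>" "r < \<delta>1" "r * norm u < gap"
  proof -
    show "0 < r" using \<epsilon> \<delta>1 gap u0 by (simp add: r_def)
    show "r \<le> \<epsilon>" by (simp add: r_def)
    have "r \<le> \<delta>1 / 2" "r \<le> gap / (2 * norm u)" by (simp_all add: r_def)
    then show "r < \<delta>1" "r * norm u < gap" using \<delta>1 gap u0 by (simp_all add: field_simps)
  qed
  have "homotopic_loops (\<Omega> - K) (\<lambda>t. z + (of_real \<epsilon> * expi t) *s u) (\<lambda>t. z + (of_real r * expi t) *s u)"
  proof (rule homotopic_circles)
    fix s \<zeta> assume s: "s \<in> {0..1::real}" and \<zeta>: "cmod \<zeta> \<le> (1 - s) * \<epsilon> + s * r"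
    have "(1 - s) *\<^sub>R z + s *\<^sub>R z = z" by (simp add: algebra_simps)
    moreover have "s * r \<le> s * \<epsilon>" using s r by (intro mult_left_mono) auto
    then have "cmod \<zeta> \<le> \<epsilon>" using \<zeta> by (simp add: algebra_simps)
    ultimately show "(1 - s) *\<^sub>R z + s *\<^sub>R z + \<zeta> *s u \<in> \<Omega>" using disc by simp
  qed (use D z u \<epsilon> r in auto)
  moreover have "homotopic_loops (\<Omega> - K) (\<lambda>t. z + (of_real r * expi t) *s u) (\<lambda>t. z1 + (of_real r * expi t) *s u)"
  proof (rule homotopic_circles)
    fix s \<zeta> assume s: "s \<in> {0..1::real}" and \<zeta>: "cmod \<zeta> \<le> (1 - s) * r + s * r"
    let ?y = "(1 - s) *\<^sub>R z + s *\<^sub>R z1 + \<zeta> *s u"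
    have "?y \<in> E"
      unfolding scaleR_vec_complex using z z1 u D(10)
      by (intro vec.subspace_add vec.subspace_scale subspace_E) auto
    moreover have "dist z ?y < \<delta>"
    proof -
      have "z - ?y = s *\<^sub>R (z - z1) - \<zeta> *s u" by (simp add: algebra_simps)
      then have "dist z ?y \<le> norm (s *\<^sub>R (z - z1)) + norm (\<zeta> *s u)"
        unfolding dist_norm by (metis norm_triangle_ineq4)
      also have "norm (s *\<^sub>R (z - z1)) \<le> dist z z1"
        using s by (simp add: dist_norm mult_left_le_one_le)
      also have "norm (\<zeta> *s u) \<le> r * norm u"
        using \<zeta> by (simp add: norm_vector_scalar_mult algebra_simps mult_right_mono)
      finally show ?thesis using r(4) by (simp add: gap_def)
    qed
    ultimately show "?y \<in> \<Omega>" using \<delta>(2) by auto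
  qed (use D z z1 u r in auto)
  ultimately have hl: "homotopic_loops (\<Omega> - K) (\<lambda>t. z + (of_real \<epsilon> * expi t) *s u) (\<lambda>t. z1 + (of_real r * expi t) *s u)"
    by (rule homotopic_loops_trans)
  have cf: "continuous_on (\<Omega> - K) (\<lambda>y. fst (\<phi> y))"
    by (rule continuous_on_subset[OF continuous_on_fst_chart[OF c]]) blast
  have "fst (\<phi> y) \<in> X" if "y \<in> \<Omega> - K" for y
    using D(8,11)[of y] that by (auto simp: mem_bd_iff)
  then have "(\<lambda>y. fst (\<phi> y)) \<in> (\<Omega> - K) \<rightarrow> X" by blast
  from homotopic_loops_continuous_image[OF hl cf this]
  have 1: "homotopic_loops X \<mu> (\<lambda>t. fst (\<phi> (z1 + (of_real r * expi t) *s u)))"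
    by (simp add: \<mu>_eq o_def)
  have in\<Omega>: "z1 + (of_real r * expi t) *s u \<in> \<Omega>" for t
  proof -
    have "z1 + (of_real r * expi t) *s u \<in> E"
      using z1 u by (intro vec.subspace_add vec.subspace_scale subspace_E) auto
    moreover have "dist z (z1 + (of_real r * expi t) *s u) < \<delta>"
    proof -
      have "dist z (z1 + (of_real r * expi t) *s u) \<le> dist z z1 + dist z1 (z1 + (of_real r * expi t) *s u)"
        by (rule dist_triangle)
      also have "dist z1 (z1 + (of_real r * expi t) *s u) = r * norm u"
        using r by (simp add: dist_norm norm_vector_scalar_mult norm_mult)
      finally show ?thesis using r(4) by (simp add: gap_def)
    qed
    ultimately show ?thesis using \<delta>(2) by auto
  qed
  have "of_real r *s w \<in> X" using w r by (intro X_scale) auto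
  then have "homotopic_loops X (circ (of_real r *s w)) (circ a)" using a by (rule homotopic_circ)
  then show ?thesis using 1 small[OF r(1,3) in\<Omega>] homotopic_loops_trans by blast
qed

text \<open>All meridians are freely homotopic to \<open>circ a\<close>, and centrality upgrades
  this to a homotopy with fixed base point. The class is nonempty because small circles around the
  origin in direction a are meridians.\<close>

lemma inertia_class_maximal:
  assumes EI: "E \<in> Irr" and a: "a \<in> X"
  shows "inertia_class h E G E a = {path_class X (circ a)}"
proof
  have ca: "circ a \<in> loops_at X a" by (rule circ_loops_at[OF a])
  show "inertia_class h E G E a \<subseteq> {path_class X (circ a)}"
  proof
    fix c assume "c \<in> inertia_class h E G E a"
    then obtain \<gamma>0 \<gamma> \<mu> where \<gamma>0: "\<gamma>0 \<in> loops_at X a" "c = path_class X \<gamma>0" and \<gamma>: "\<gamma> \<in> c"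
      and \<mu>: "\<mu> \<in> meridians h E G E" "homotopic_loops X \<gamma> \<mu>"
      by (auto simp: inertia_class_def carrier_pi1)
    have h0: "homotopic_paths X \<gamma>0 \<gamma>" using \<gamma> \<gamma>0 by (simp add: path_class_def)
    then have \<gamma>l: "\<gamma> \<in> loops_at X a"
      using \<gamma>0 homotopic_paths_imp_path[OF h0] homotopic_paths_imp_subset[OF h0]
        homotopic_paths_imp_pathstart[OF h0] homotopic_paths_imp_pathfinish[OF h0]
      by (simp add: loops_at_def)
    have "homotopic_loops X \<gamma> (circ a)"
      using \<mu>(2) meridian_circ[OF EI a \<mu>(1)] by (rule homotopic_loops_trans)
    then have "homotopic_paths X \<gamma> (circ a)" by (rule circ_central[OF \<gamma>l])
    then show "c \<in> {path_class X (circ a)}"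
      using \<gamma>0(2) path_class_eqI[OF homotopic_paths_trans[OF h0]] by simp
  qed
  have "a \<in> E" using a by (simp add: mem_X_iff)
  have pE: "perp E = {0}" by (rule orth_self[OF subspace_E])
  have gen: "base_generic E 0" "dir_generic E a"
    using a pE zero_mem_hyp vec.subspace_0[OF subspace_E]
    by (auto simp: base_generic_def dir_generic_def mem_X_iff)
  obtain \<epsilon> where "0 < \<epsilon>"
    "(\<lambda>t. 0 + (of_real \<epsilon> * exp (2 * of_real pi * \<i> * of_real t)) *s a) \<in> meridians h E G E"
    using explicit_meridian[OF EI _ gen \<open>a \<in> E\<close>] pE by (metis insertI1 order_refl)
  then obtain \<mu> where \<mu>: "\<mu> \<in> meridians h E G E" by blast
  have "homotopic_loops X (circ a) \<mu>" using meridian_circ[OF EI a \<mu>] by (rule homotopic_loops_sym)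
  then show "{path_class X (circ a)} \<subseteq> inertia_class h E G E a"
    using \<mu> ca mem_loops_at_path_class[OF ca] by (auto simp: inertia_class_def carrier_pi1)
qed

lemma central_inertia_eq:
  "E \<in> Irr \<Longrightarrow> a \<in> X \<Longrightarrow> central_inertia h E G a = path_class X (circ a)"
  unfolding central_inertia_def by (simp add: inertia_class_maximal)

end

section \<open>Parabolic subgroups\<close>

lemma finite_refl_hyps:
  assumes "finite G"
  shows "finite (refl_hyps E G)"
proof (rule finite_subset)
  show "refl_hyps E G \<subseteq> fix_space E ` G" by (auto simp: refl_hyps_def)
qed (use assms in simp)

lemma subspace_fix_space: "vec.subspace E \<Longrightarrow> vec.subspace (fix_space E g)"
  unfolding fix_space_def vec.subspace_def
  by (auto simp: matrix_vector_right_distrib vec.scale)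

context hermitian
begin

text \<open>A hyperplane of A and the corresponding hyperplane of the whole space have the same
  normal b in A. Containing the orthogonal of A is the condition for the normal to lie in A, and
  also for the element fixing the hyperplane to belong to the parabolic subgroup.\<close>

lemma refl_hyps_parabolic:
  assumes A: "vec.subspace A"
  shows "refl_hyps A (parabolic h W A) =
    (\<lambda>H. H \<inter> A) ` {H \<in> refl_hyps UNIV W. orth h UNIV A \<subseteq> H}"
proof
  show "refl_hyps A (parabolic h W A) \<subseteq> (\<lambda>H. H \<inter> A) ` {H \<in> refl_hyps UNIV W. orth h UNIV A \<subseteq> H}"
  proof
    fix K assume "K \<in> refl_hyps A (parabolic h W A)"
    then obtain g where g: "g \<in> W" "\<And>v. v \<in> orth h UNIV A \<Longrightarrow> g *v v = v"
      and K: "K = fix_space A g" "vec.dim K + 1 = vec.dim A"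
      by (auto simp: refl_hyps_def parabolic_def)
    have "vec.subspace K" "K \<subseteq> A" using subspace_fix_space[OF A] K by (auto simp: fix_space_def)
    then obtain b where b: "b \<in> A" "b \<noteq> 0" "K = {v \<in> A. h v b = 0}"
      using hyperplane_normal[OF A _ _ K(2)] by metis
    \<comment> \<open>The element g fixes the component of v orthogonal to A, so whether v is fixed
      depends only on its projection to A.\<close>
    have fix_iff: "g *v v = v \<longleftrightarrow> h v b = 0" for v
    proof -
      have "v - oproj h A v \<in> orth h UNIV A"
        by (rule diff_oproj_mem_orth[OF vec.subspace_UNIV A]) auto
      from g(2)[OF this] have "g *v v - g *v oproj h A v = v - oproj h A v"
        by (simp add: matrix_vector_mult_diff_distrib)
      then have "g *v v = v \<longleftrightarrow> g *v oproj h A v = oproj h A v" by (auto simp: algebra_simps)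
      also have "\<dots> \<longleftrightarrow> oproj h A v \<in> K" using oproj_mem[OF A] K by (simp add: fix_space_def)
      also have "\<dots> \<longleftrightarrow> h v b = 0" using oproj_mem[OF A] b h_oproj[OF A b(1)] by simp
      finally show ?thesis .
    qed
    let ?H = "fix_space UNIV g"
    have H: "?H = {v \<in> UNIV. h v b = 0}" using fix_iff by (simp add: fix_space_def)
    have "vec.dim ?H + 1 = vec.dim (UNIV :: (complex ^ 'n) set)"
      unfolding H by (rule dim_hyperplane[OF vec.subspace_UNIV _ b(2)]) simp
    then have "?H \<in> refl_hyps UNIV W" using g(1) by (auto simp: refl_hyps_def)
    moreover have "orth h UNIV A \<subseteq> ?H" using b(1) by (auto simp: H orth_def)
    moreover have "K = ?H \<inter> A" using b(3) H by auto
    ultimately show "K \<in> (\<lambda>H. H \<inter> A) ` {H \<in> refl_hyps UNIV W. orth h UNIV A \<subseteq> H}" by blast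
  qed
  show "(\<lambda>H. H \<inter> A) ` {H \<in> refl_hyps UNIV W. orth h UNIV A \<subseteq> H} \<subseteq> refl_hyps A (parabolic h W A)"
  proof (rule image_subsetI)
    fix H assume "H \<in> {H \<in> refl_hyps UNIV W. orth h UNIV A \<subseteq> H}"
    then obtain g where g: "g \<in> W" "H = fix_space UNIV g"
      and H: "vec.dim H + 1 = vec.dim (UNIV :: (complex ^ 'n) set)" "orth h UNIV A \<subseteq> H"
      by (auto simp: refl_hyps_def)
    have "vec.subspace H" using subspace_fix_space[OF vec.subspace_UNIV] g by simp
    then obtain b where b: "b \<noteq> 0" "H = {v \<in> UNIV. h v b = 0}"
      using hyperplane_normal[OF vec.subspace_UNIV _ _ H(1)] by (metis subset_UNIV)
    have "b \<in> orth h UNIV (orth h UNIV A)" using H(2) b(2) eq_0_swap by (auto simp: orth_def)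
    then have bA: "b \<in> A" using orth_orth[OF vec.subspace_UNIV A] by simp
    have "g \<in> parabolic h W A" using g H(2) by (auto simp: parabolic_def fix_space_def)
    moreover have "H \<inter> A = fix_space A g" using g by (auto simp: fix_space_def)
    moreover have "H \<inter> A = {v \<in> A. h v b = 0}" using b by auto
    then have "vec.dim (H \<inter> A) + 1 = vec.dim A" using dim_hyperplane[OF A bA b(1)] by simp
    ultimately show "H \<inter> A \<in> refl_hyps A (parabolic h W A)" unfolding refl_hyps_def by blast
  qed
qed

end

section \<open>Restriction of line sums and irreducibility to A\<close>

lemma (in arrangement) orth_restrict:
  assumes EU: "E = UNIV" and A: "vec.subspace A" and H: "H \<in> Hs" "perp A \<subseteq> H"
  shows "orth h A (H \<inter> A) = perp H"
proof -
  obtain b where b: "b \<noteq> 0" "H = {v \<in> E. h v b = 0}" using hyp_normal[OF H(1)] by blast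
  have "b \<in> perp (perp A)" using H(2) b(2) eq_0_swap EU by (auto simp: orth_def)
  then have bA: "b \<in> A" using orth_orth[OF subspace_E A] EU by simp
  have "H \<inter> A = {v \<in> A. h v b = 0}" using b EU by auto
  then show ?thesis
    using orth_orth_sing[OF A bA] orth_orth_sing[OF subspace_E, of b] b(2) EU by simp
qed

lemma (in arrangement) line_sums_parabolic:
  assumes EU: "E = UNIV" and A: "vec.subspace A"
  shows "line_sums h A (parabolic h G A) = {U \<in> line_sums h E G. U \<subseteq> A}"
proof -
  have hyps: "refl_hyps A (parabolic h G A) = (\<lambda>H. H \<inter> A) ` {H \<in> Hs. perp A \<subseteq> H}"
    using refl_hyps_parabolic[OF A, of G] EU by simp
  have UN: "(\<Union>K\<in>(\<lambda>H. H \<inter> A) ` S. orth h A K) = (\<Union>H\<in>S. perp H)" if "S \<subseteq> {H \<in> Hs. perp A \<subseteq> H}" for S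
    using orth_restrict[OF EU A] that by (simp add: image_image subset_iff)
  show ?thesis
  proof
    show "line_sums h A (parabolic h G A) \<subseteq> {U \<in> line_sums h E G. U \<subseteq> A}"
    proof
      fix U assume "U \<in> line_sums h A (parabolic h G A)"
      then obtain T where T: "T \<subseteq> refl_hyps A (parabolic h G A)" "U = vec.span (\<Union>K\<in>T. orth h A K)"
        unfolding line_sums_def by blast
      obtain S where S: "S \<subseteq> {H \<in> Hs. perp A \<subseteq> H}" "T = (\<lambda>H. H \<inter> A) ` S"
        using T(1) unfolding hyps by (meson subset_imageE)
      have "U = vec.span (\<Union>H\<in>S. perp H)" using T(2) UN[OF S(1)] S(2) by simp
      moreover have "S \<subseteq> Hs" using S(1) by blast
      ultimately have "U \<in> line_sums h E G" unfolding line_sums_def by (intro CollectI exI conjI)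
      moreover have "U \<subseteq> A" unfolding T(2) by (rule vec.span_minimal[OF _ A]) (auto simp: orth_def)
      ultimately show "U \<in> {U \<in> line_sums h E G. U \<subseteq> A}" by blast
    qed
    show "{U \<in> line_sums h E G. U \<subseteq> A} \<subseteq> line_sums h A (parabolic h G A)"
    proof
      fix U assume U: "U \<in> {U \<in> line_sums h E G. U \<subseteq> A}"
      then obtain S where S: "S \<subseteq> Hs" "U = vec.span (\<Union>H\<in>S. perp H)" unfolding line_sums_def by blast
      have "perp A \<subseteq> H" if "H \<in> S" for H
      proof -
        have "perp H \<subseteq> A" using U S(2) that by (auto intro: vec.span_base)
        then show ?thesis using orth_antimono[of "perp H" A E] perp_perp_hyp S(1) that by blast
      qed
      then have S': "S \<subseteq> {H \<in> Hs. perp A \<subseteq> H}" using S(1) by blast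
      then have "(\<lambda>H. H \<inter> A) ` S \<subseteq> refl_hyps A (parabolic h G A)" unfolding hyps by (rule image_mono)
      moreover have "U = vec.span (\<Union>K\<in>(\<lambda>H. H \<inter> A) ` S. orth h A K)" unfolding UN[OF S'] by (rule S(2))
      ultimately show "U \<in> line_sums h A (parabolic h G A)"
        unfolding line_sums_def by (intro CollectI exI conjI)
    qed
  qed
qed

text \<open>The definition of a decomposition of A mentions only line sums contained in A, and these
  are the same for both arrangements.\<close>

lemma (in arrangement) irreducible_parabolic:
  assumes EU: "E = UNIV" and A: "A \<in> Irr"
  shows "A \<in> irred_subspaces h A (parabolic h G A)"
proof -
  note ls = line_sums_parabolic[OF EU Irr_subspace[OF A]]
  have "is_decomposition h E G A D" if "is_decomposition h A (parabolic h G A) A D" for D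
    using that unfolding is_decomposition_def ls by blast
  then show ?thesis
    using A Irr_line_sums[OF A] by (auto simp: irred_subspaces_def ls)
qed

theorem theorem5p1:
  fixes h :: "complex ^ 'n \<Rightarrow> complex ^ 'n \<Rightarrow> complex"
    and W :: "(complex ^ 'n ^ 'n) set"
    and A :: "(complex ^ 'n) set"
    and x a :: "complex ^ 'n"
    and r :: real
  assumes "hermitian_inner h"
    and "finite_reflection_group W"
    and "irreducible_action W"
    and "invariant_form h W"
    and "\<Inter>(refl_hyps UNIV W) = {0}"
    and "A \<in> irred_subspaces h UNIV W"
    and "x \<in> orth h UNIV A"
    and "\<forall>H \<in> refl_hyps UNIV W. \<not> orth h UNIV A \<subseteq> H \<longrightarrow> x \<notin> H"
    and "0 < r"
    and "\<forall>H \<in> refl_hyps UNIV W. x \<notin> H \<longrightarrow> H \<inter> {v. hnorm h (v - x) < r} = {}"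
    and "a \<in> hyp_compl A (parabolic h W A)"
  shows "pi1_map (hyp_compl UNIV W) (incl_map h x r)
           \<in> mon (pi1 (hyp_compl A (parabolic h W A)) a)
                 (pi1 (hyp_compl UNIV W) (incl_map h x r a))
       \<and> pi1_map (hyp_compl UNIV W) (incl_map h x r)
             (central_inertia h A (parabolic h W A) a)
           \<in> inertia_class h UNIV W A (incl_map h x r a)"
proof -
  interpret hermitian h by unfold_locales (rule assms(1))
  have finW: "finite W" using assms(2) by (simp add: finite_reflection_group_def)
  interpret V: arrangement h UNIV W
    by unfold_locales (simp_all add: finite_refl_hyps finW)
  note AI = assms(6)
  have sA: "vec.subspace A" by (rule V.Irr_subspace[OF AI])
  have "finite (parabolic h W A)" using finW by (simp add: parabolic_def)
  then interpret P: arrangement h A "parabolic h W A"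
    by unfold_locales (simp_all add: finite_refl_hyps sA)
  have AP: "A \<in> P.Irr" by (rule V.irreducible_parabolic[OF refl AI])
  let ?f = "incl_map h x r"
  have hyps: "refl_hyps A (parabolic h W A) = (\<lambda>H. H \<inter> A) ` {H \<in> V.Hs. V.perp A \<subseteq> H}"
    by (rule refl_hyps_parabolic[OF sA])
  have XP: "v \<in> P.X \<longleftrightarrow> v \<in> A \<and> (\<forall>H\<in>V.Hs. V.perp A \<subseteq> H \<longrightarrow> v \<notin> H)" for v
    unfolding P.mem_X_iff hyps by auto
  \<comment> \<open>A hyperplane through x contains the orthogonal of A by the genericity of x, so
    it would have to contain v. A hyperplane not through x misses the ball of radius r.\<close>
  have tube: "x + c *\<^sub>R v \<in> V.X" if v: "v \<in> P.X" and c: "0 < c" "c * hnorm h v < r" for c v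
    unfolding V.mem_X_iff
  proof (intro conjI ballI notI)
    fix H assume H: "H \<in> V.Hs" and mem: "x + c *\<^sub>R v \<in> H"
    show False
    proof (cases "x \<in> H")
      case True
      then have "V.perp A \<subseteq> H" using assms(8) H by blast
      then have vH: "v \<notin> H" using v H by (simp add: XP)
      have "(x + c *\<^sub>R v) - x \<in> H" by (rule vec.subspace_diff[OF V.hyp_subspace[OF H] mem True])
      then have "of_real c *s v \<in> H" by (simp add: scaleR_vec_complex)
      then have "of_real (1 / c) *s (of_real c *s v) \<in> H"
        by (rule vec.subspace_scale[OF V.hyp_subspace[OF H]])
      then show False using vH c by simp
    next
      case False
      have "hnorm h ((x + c *\<^sub>R v) - x) < r" using c by (simp add: scaleR_vec_complex hnorm_scale)
      then show False using assms(10) H False mem by blast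
    qed
  qed simp
  \<comment> \<open>The factor of the radial contraction; its product with the norm of v stays below
    r, which is the bound required by \<open>tube\<close>.\<close>
  define \<rho> where "\<rho> v = r / (1 + hnorm h v)" for v
  have den: "0 < 1 + hnorm h v" for v using hnorm_nonneg[of v] by linarith
  have \<rho>: "0 < \<rho> v" "\<rho> v * hnorm h v < r" for v
    using assms(9) den[of v] by (simp_all add: \<rho>_def field_simps)
  have f_eq: "?f v = x + \<rho> v *\<^sub>R v" for v by (simp add: incl_map_def \<rho>_def)
  have c\<rho>: "continuous_on S \<rho>" for S
    unfolding \<rho>_def using den by (intro continuous_intros) (metis less_irrefl)
  have cf: "continuous_on P.X ?f" unfolding f_eq[abs_def] by (intro continuous_intros c\<rho>)
  have fX: "?f ` P.X \<subseteq> V.X" using tube \<rho> by (auto simp: f_eq)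
  \<comment> \<open>As x is orthogonal to A, projecting to A removes the translation and leaves the
    multiple \<open>\<rho> v\<close> of v, which is the situation of
    \<open>inj_on_pi1_map_radial\<close>.\<close>
  have px: "oproj h A x = 0" using oproj_eq_0_iff[OF sA, of x UNIV] assms(7) by blast
  have inj: "inj_on (pi1_map V.X ?f) (carrier (pi1 P.X a))"
  proof (rule inj_on_pi1_map_radial[where p = "oproj h A" and \<rho> = \<rho>])
    show "continuous_on V.X (oproj h A)" by (rule continuous_on_oproj[OF sA continuous_on_id])
    show "oproj h A ` V.X \<subseteq> P.X"
    proof (rule image_subsetI)
      fix v assume v: "v \<in> V.X"
      have "oproj h A v \<notin> H" if H: "H \<in> V.Hs" "V.perp A \<subseteq> H" for H
      proof
        assume "oproj h A v \<in> H"
        moreover have "v - oproj h A v \<in> H"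
          using diff_oproj_mem_orth[OF vec.subspace_UNIV sA] H(2) by blast
        ultimately have "oproj h A v + (v - oproj h A v) \<in> H"
          by (rule vec.subspace_add[OF V.hyp_subspace[OF H(1)]])
        then show False using v H(1) by (simp add: V.mem_X_iff)
      qed
      then show "oproj h A v \<in> P.X" using oproj_mem[OF sA] by (simp add: XP)
    qed
    show "c *\<^sub>R v \<in> P.X" if "v \<in> P.X" "0 < c" for c v
      using P.X_scale[OF that(1), of "of_real c"] that(2) by (simp add: scaleR_vec_complex)
    show "oproj h A (?f v) = \<rho> v *\<^sub>R v" if "v \<in> P.X" for v
    proof -
      have "v \<in> A" using that by (simp add: XP)
      then show ?thesis
        using px by (simp add: f_eq scaleR_vec_complex oproj_add[OF sA] oproj_scale[OF sA] oproj_eq[OF sA])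
    qed
  qed (use cf fX c\<rho> \<rho> in auto)
  have ca: "circ a \<in> loops_at P.X a" by (rule P.circ_loops_at[OF assms(11)])
  define c where "c = \<rho> a"
  \<comment> \<open>The norm is constant along \<open>circ a\<close>, hence so is the contraction
    factor: the image is a round circle around x with coefficient \<open>c\<close>.\<close>
  have f_circ: "?f \<circ> circ a = (\<lambda>t. x + (of_real c * expi t) *s a)"
    by (rule ext) (simp add: f_eq \<rho>_def c_def circ_def hnorm_scale scaleR_vec_complex)
  have gen: "V.base_generic A x" "V.dir_generic A a"
    using assms(8,11) by (auto simp: V.base_generic_def V.dir_generic_def XP)
  have aA: "a \<in> A" using assms(11) by (simp add: XP)
  obtain \<epsilon>0 where \<epsilon>0: "0 < \<epsilon>0" "\<And>\<epsilon>. 0 < \<epsilon> \<Longrightarrow> \<epsilon> \<le> \<epsilon>0 \<Longrightarrow>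
      (\<lambda>t. x + (of_real \<epsilon> * expi t) *s a) \<in> meridians h UNIV W A"
    using V.explicit_meridian[OF AI assms(7) gen aA] unfolding expi_def by blast
  \<comment> \<open>The coefficient \<open>c\<close> may exceed the size \<open>\<epsilon>0\<close>
    up to which round circles are known to be meridians. The circle is therefore shrunk inside the
    tube, where coefficients between \<open>\<epsilon>\<close> and c stay admissible.\<close>
  define \<epsilon> where "\<epsilon> = min \<epsilon>0 c"
  have cpos: "0 < c" "c * hnorm h a < r" using \<rho> by (simp_all add: c_def)
  have \<epsilon>: "0 < \<epsilon>" "\<epsilon> \<le> c" "\<epsilon> \<le> \<epsilon>0" using \<epsilon>0(1) cpos by (auto simp: \<epsilon>_def)
  have "homotopic_loops V.X (?f \<circ> circ a) (\<lambda>t. x + (of_real \<epsilon> * expi t) *s a)"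
    unfolding f_circ
  proof (rule homotopic_loops_linear)
    show "path (\<lambda>t. x + (of_real c * expi t) *s a)" "path (\<lambda>t. x + (of_real \<epsilon> * expi t) *s a)"
      unfolding path_def by (intro continuous_intros)+
    fix t :: real
    show "closed_segment (x + (of_real c * expi t) *s a) (x + (of_real \<epsilon> * expi t) *s a) \<subseteq> V.X"
    proof
      fix y assume "y \<in> closed_segment (x + (of_real c * expi t) *s a) (x + (of_real \<epsilon> * expi t) *s a)"
      then obtain s where s: "0 \<le> s" "s \<le> 1"
        and y: "y = (1 - s) *\<^sub>R (x + (of_real c * expi t) *s a) + s *\<^sub>R (x + (of_real \<epsilon> * expi t) *s a)"
        unfolding closed_segment_def by blast
      let ?c = "(1 - s) * c + s * \<epsilon>"
      have "y = x + ?c *\<^sub>R circ a t"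
        unfolding y circ_def scaleR_vec_complex by (simp add: vec_eq_iff algebra_simps)
      moreover have "circ a t \<in> P.X" unfolding circ_def using assms(11) by (intro P.X_scale) simp_all
      moreover have "0 < ?c" using s cpos \<epsilon> by (cases "s = 1") (auto intro: add_pos_nonneg)
      moreover have "?c * hnorm h (circ a t) < r"
      proof -
        have "?c \<le> c" using s \<epsilon>(2) mult_left_mono[of \<epsilon> c s] by (simp add: algebra_simps)
        then have "?c * hnorm h a \<le> c * hnorm h a" by (intro mult_right_mono hnorm_nonneg)
        then show ?thesis using cpos by (simp add: circ_def hnorm_scale)
      qed
      ultimately show "y \<in> V.X" using tube by simp
    qed
  qed (simp_all add: pathstart_def pathfinish_def)
  then have "path_class V.X (?f \<circ> circ a) \<in> inertia_class h UNIV W A (?f a)"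
    using \<epsilon>0(2)[OF \<epsilon>(1,3)] loops_at_compose[OF cf fX ca]
      mem_loops_at_path_class[OF loops_at_compose[OF cf fX ca]]
    unfolding inertia_class_def carrier_pi1 by blast
  then show ?thesis
    using pi1_map_hom[OF cf fX, of a] inj pi1_map_path_class[OF cf fX ca]
      P.central_inertia_eq[OF AP assms(11)]
    by (simp add: mon_def)
qed

end
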